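(* Let $G$ be a finite simple undirected $7$-regular graph. Then $\tau(G)\le 2\nu(G)$.
   Context: All graphs are finite, simple and undirected. A triangle packing of a graph $G$ is a set of triangles of $G$ that are pairwise edge-disjoint (they may share vertices); $\nu(G)$ is the largest size of a triangle packing of $G$. A triangle transversal of $G$ is a set $Y\subseteq E(G)$ such that $G-Y$ (the graph $G$ with the edges of $Y$ deleted) is triangle-free; $\tau(G)$ is the smallest size of a triangle transversal of $G$. *)

theory Defs
  imports Main
begin

text \<open>
  A graph is given by its vertex set \<open>V\<close> and its set \<open>E\<close> of edges; an edge is
  the two-element set of its ends.
\<close>

definition simple_graph :: "'a set \<Rightarrow> 'a set set \<Rightarrow> bool" where
  "simple_graph V E \<longleftrightarrow> finite V \<and> (\<forall>e\<in>E. e \<subseteq> V \<and> card e = 2)"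

definition vertex_degree :: "'a set set \<Rightarrow> 'a \<Rightarrow> nat" where
  "vertex_degree E v = card {e \<in> E. v \<in> e}"

definition regular_graph :: "nat \<Rightarrow> 'a set \<Rightarrow> 'a set set \<Rightarrow> bool" where
  "regular_graph k V E \<longleftrightarrow> (\<forall>v\<in>V. vertex_degree E v = k)"

text \<open>
  A triangle is represented by the set of its three edges, so that edge-disjointness of
  triangles is disjointness of sets.
\<close>

definition triangles :: "'a set set \<Rightarrow> 'a set set set" where
  "triangles E = {{{x, y}, {y, z}, {x, z}} | x y z.
     x \<noteq> y \<and> y \<noteq> z \<and> x \<noteq> z \<and> {x, y} \<in> E \<and> {y, z} \<in> E \<and> {x, z} \<in> E}"

definition triangle_free :: "'a set set \<Rightarrow> bool" where
  "triangle_free E \<longleftrightarrow> triangles E = {}"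

definition triangle_packing :: "'a set set \<Rightarrow> 'a set set set \<Rightarrow> bool" where
  "triangle_packing E P \<longleftrightarrow> P \<subseteq> triangles E \<and> pairwise disjnt P"

definition triangle_transversal :: "'a set set \<Rightarrow> 'a set set \<Rightarrow> bool" where
  "triangle_transversal E Y \<longleftrightarrow> Y \<subseteq> E \<and> triangle_free (E - Y)"

text \<open>
  The numbers \<open>\<nu>\<close> and \<open>\<tau>\<close>. \<^const>\<open>Max\<close> and \<^const>\<open>Min\<close> are meaningful only for
  nonempty finite sets; the lemmas below show that the extrema are attained in every
  finite graph.
\<close>

definition triangle_packing_number :: "'a set set \<Rightarrow> nat" where
  "triangle_packing_number E = Max {card P | P. triangle_packing E P}"

definition triangle_transversal_number :: "'a set set \<Rightarrow> nat" where
  "triangle_transversal_number E = Min {card Y | Y. triangle_transversal E Y}"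

lemma simple_graph_finite_edges:
  assumes "simple_graph V E"
  shows "finite E"
proof -
  have "E \<subseteq> Pow V" "finite V" using assms by (auto simp: simple_graph_def)
  then show ?thesis by (meson finite_Pow_iff finite_subset)
qed

lemma finite_triangles:
  assumes "finite E"
  shows "finite (triangles E)"
proof -
  have "triangles E \<subseteq> Pow E" by (auto simp: triangles_def)
  with assms show ?thesis by (meson finite_Pow_iff finite_subset)
qed

lemma triangle_packing_number_attained:
  assumes "finite E"
  shows "\<exists>P. triangle_packing E P \<and> finite P \<and> card P = triangle_packing_number E"
    and "triangle_packing E P \<Longrightarrow> card P \<le> triangle_packing_number E"
proof -
  have fin: "finite {P. triangle_packing E P}"
    using finite_triangles[OF assms]
    by (auto simp: triangle_packing_def intro: finite_subset[of _ "Pow (triangles E)"])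
  then have fin': "finite {card P | P. triangle_packing E P}" by simp
  have "triangle_packing E {}" by (simp add: triangle_packing_def)
  then have "{card P | P. triangle_packing E P} \<noteq> {}" by blast
  from Max_in[OF fin' this] obtain Q
    where "triangle_packing E Q" "card Q = triangle_packing_number E"
    unfolding triangle_packing_number_def by auto
  then show "\<exists>P. triangle_packing E P \<and> finite P \<and> card P = triangle_packing_number E"
    using finite_triangles[OF assms] by (auto simp: triangle_packing_def intro: finite_subset)
  show "card P \<le> triangle_packing_number E" if "triangle_packing E P"
    unfolding triangle_packing_number_def using Max_ge[OF fin'] that by blast
qed

lemma triangle_transversal_number_attained:
  assumes "finite E"
  shows "\<exists>Y. triangle_transversal E Y \<and> finite Y \<and> card Y = triangle_transversal_number E"
    and "triangle_transversal E Y \<Longrightarrow> triangle_transversal_number E \<le> card Y"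
proof -
  have fin: "finite {Y. triangle_transversal E Y}"
    using assms by (auto simp: triangle_transversal_def intro: finite_subset[of _ "Pow E"])
  then have fin': "finite {card Y | Y. triangle_transversal E Y}" by simp
  have "triangle_transversal E E"
    by (simp add: triangle_transversal_def triangle_free_def triangles_def)
  then have "{card Y | Y. triangle_transversal E Y} \<noteq> {}" by blast
  from Min_in[OF fin' this] obtain Z
    where "triangle_transversal E Z" "card Z = triangle_transversal_number E"
    unfolding triangle_transversal_number_def by auto
  then show "\<exists>Y. triangle_transversal E Y \<and> finite Y \<and> card Y = triangle_transversal_number E"
    using assms by (auto simp: triangle_transversal_def intro: finite_subset)
  show "triangle_transversal_number E \<le> card Y" if "triangle_transversal E Y"
    unfolding triangle_transversal_number_def using Min_le[OF fin'] that by blast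
qed

end

theory Submission
  imports Defs
begin

text \<open>
  In a minimal counterexample, among graphs of maximum degree at most 7, every edge lies in a
  triangle, and there are no edge-disjoint triangles \<open>S \<noteq> {}\<close> together with a set \<open>Y\<close> of at most
  \<open>2 * card S\<close> edges that meets every triangle sharing an edge with a member of \<open>S\<close>: otherwise
  deleting \<open>Y\<close> and the edges of \<open>S\<close> gives a smaller counterexample. Such a reduction can
  however be found near any non-isolated vertex \<open>v\<close>. Either \<open>S\<close> comes from a matching in the
  neighbourhood of \<open>v\<close> and \<open>Y\<close> from that matching and a small vertex cover of the rest, or the
  neighbourhood is so dense that \<open>S\<close> can be a large triangle packing near \<open>v\<close> and \<open>Y\<close> the edges
  inside the two sides of a cut together with the edges leaving one side. The case analysis is
  a tree found by a computer search, which a verified checker evaluates.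
\<close>

section \<open>Reductions\<close>

text \<open>Deleting edges destroys regularity but keeps all degrees at most 7, which is why the
  induction runs over \<open>sparse\<close>. If \<open>M\<close> is a matching of size k between
  neighbours of \<open>v\<close>, the triangles on \<open>v\<close> and the edges of
  \<open>M\<close> are edge-disjoint, and \<open>Y\<close> consists of \<open>M\<close> and of the
  edges from \<open>v\<close> to k vertices that cover the other neighbourhood edges at ends of
  \<open>M\<close>; this costs 2k. A neighbourhood K_5 defeats it: there are two matching edges, but
  three vertices are needed to cover the rest. There a cut helps: an edge between the sides has no
  apex left once the edges inside the sides and those from one side to unnamed vertices are gone,
  whatever packing of named edges is used. The degree bound makes this affordable, since a vertex
  with many named neighbours has few others. Within each degree the cases run from dense to sparse
  neighbourhoods, so that splitting a pair usually sends the adjacent branch to a configuration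
  refuted before and adds a nonadjacency in the other. Undetermined cells keep a refuted
  configuration usable elsewhere, also with another vertex as centre.\<close>

definition tuza :: "'a set set \<Rightarrow> bool" where
  "tuza E \<longleftrightarrow> triangle_transversal_number E \<le> 2 * triangle_packing_number E"

definition sparse :: "'a set set \<Rightarrow> bool" where
  "sparse E \<longleftrightarrow> finite E \<and> (\<forall>e\<in>E. card e = 2) \<and> (\<forall>v. vertex_degree E v \<le> 7)"

definition reducible :: "'a set set \<Rightarrow> bool" where
  "reducible E \<longleftrightarrow> (\<exists>S Y. triangle_packing E S \<and> S \<noteq> {} \<and> Y \<subseteq> E \<and> card Y \<le> 2 * card S \<and>
     (\<forall>t\<in>triangles E. (\<exists>s\<in>S. \<not> disjnt s t) \<longrightarrow> \<not> disjnt t Y))"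

text \<open>Only those consequences of minimality that the case analysis uses. They do not refer to
  smaller graphs, so a contradiction can be sought locally in a single graph.\<close>

definition irreducible :: "'a set set \<Rightarrow> bool" where
  "irreducible E \<longleftrightarrow> sparse E \<and> \<not> reducible E \<and>
     (\<forall>x y. {x, y} \<in> E \<longrightarrow> (\<exists>z. {x, z} \<in> E \<and> {y, z} \<in> E))"

lemma sparse_Diff: "sparse E \<Longrightarrow> sparse (E - D)"
proof -
  assume E: "sparse E"
  have "card {e \<in> E - D. v \<in> e} \<le> card {e \<in> E. v \<in> e}" for v
    using E by (intro card_mono) (auto simp: sparse_def)
  with E show ?thesis
    unfolding sparse_def vertex_degree_def by (meson DiffD1 finite_Diff le_trans)
qed

lemma sparse_no_loop: "sparse E \<Longrightarrow> {x} \<notin> E"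
  by (auto simp: sparse_def)

lemma triangles_Diff: "t \<in> triangles (E - D) \<longleftrightarrow> t \<in> triangles E \<and> disjnt t D"
proof
  show "t \<in> triangles (E - D) \<Longrightarrow> t \<in> triangles E \<and> disjnt t D"
    by (auto simp: triangles_def disjnt_def)
next
  assume t: "t \<in> triangles E \<and> disjnt t D"
  then obtain x y z where xyz: "t = {{x, y}, {y, z}, {x, z}}" "x \<noteq> y" "y \<noteq> z" "x \<noteq> z"
    "{x, y} \<in> E" "{y, z} \<in> E" "{x, z} \<in> E"
    by (auto simp: triangles_def)
  with t have "{x, y} \<in> E - D" "{y, z} \<in> E - D" "{x, z} \<in> E - D"
    by (auto simp: disjnt_def)
  with xyz show "t \<in> triangles (E - D)" unfolding triangles_def by blast
qed

lemma triangle_subset: "t \<in> triangles E \<Longrightarrow> t \<subseteq> E"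
  by (auto simp: triangles_def)

lemma triangle_nonempty: "t \<in> triangles E \<Longrightarrow> t \<noteq> {}"
  by (auto simp: triangles_def)

lemma triangle_apex:
  assumes "t \<in> triangles E" "{p, q} \<in> t"
  shows "\<exists>z. {p, z} \<in> E \<and> {q, z} \<in> E"
  using assms unfolding triangles_def
  by (auto simp: doubleton_eq_iff) (metis insert_commute)+

text \<open>Optimal solutions for \<open>E - D\<close> are extended: a maximum packing there avoids
  the edges of \<open>S\<close>, so \<open>S\<close> can be added to it, and a minimum transversal
  there needs only \<open>Y\<close> in addition, since the triangles lost by the deletion all meet
  \<open>Y\<close>. \<open>D\<close> is a parameter because it has two uses: the edges of
  \<open>S\<close>, and a single edge in no triangle, with \<open>S\<close> and \<open>Y\<close>
  empty.\<close>

lemma tuza_reduce: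
  assumes fin: "finite E" and S: "triangle_packing E S" and Y: "Y \<subseteq> E" "card Y \<le> 2 * card S"
    and SD: "\<Union>S \<subseteq> D"
    and hit: "\<And>t. t \<in> triangles E \<Longrightarrow> \<not> disjnt t D \<Longrightarrow> \<not> disjnt t Y"
    and tuza: "tuza (E - D)"
  shows "tuza E"
proof -
  have finS: "finite S"
    using S finite_triangles[OF fin] by (auto simp: triangle_packing_def intro: finite_subset)
  from fin have fin': "finite (E - D)" by simp
  obtain P where P: "triangle_packing (E - D) P" "finite P" "card P = triangle_packing_number (E - D)"
    using triangle_packing_number_attained(1)[OF fin'] by blast
  obtain Z where Z: "triangle_transversal (E - D) Z" "finite Z"
    "card Z = triangle_transversal_number (E - D)"
    using triangle_transversal_number_attained(1)[OF fin'] by blast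
  have PS: "disjnt p s" if "p \<in> P" "s \<in> S" for p s
  proof -
    have "p \<in> triangles (E - D)" using P that by (auto simp: triangle_packing_def)
    then have "disjnt p D" by (simp add: triangles_Diff)
    with SD that show ?thesis by (auto simp: disjnt_def)
  qed
  have "triangle_packing E (P \<union> S)"
    unfolding triangle_packing_def
  proof
    show "P \<union> S \<subseteq> triangles E"
      using P S by (auto simp: triangle_packing_def triangles_Diff)
    show "pairwise disjnt (P \<union> S)"
      using P S PS unfolding triangle_packing_def pairwise_def by (metis Un_iff disjnt_sym)
  qed
  \<comment> \<open>A common member would be disjoint from itself, hence empty, which no triangle
    is.\<close>
  moreover have "P \<inter> S = {}"
  proof (rule ccontr)
    assume "P \<inter> S \<noteq> {}"
    then obtain s where s: "s \<in> P" "s \<in> S" by blast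
    then have "s \<noteq> {}" using S triangle_nonempty by (auto simp: triangle_packing_def)
    with PS[OF s] show False by (simp add: disjnt_def)
  qed
  then have "card (P \<union> S) = card P + card S"
    using P finS by (simp add: card_Un_disjoint)
  ultimately have nu: "card P + card S \<le> triangle_packing_number E"
    using triangle_packing_number_attained(2)[OF fin] by metis
  have "triangle_transversal E (Z \<union> Y)"
    unfolding triangle_transversal_def triangle_free_def
  proof
    show "Z \<union> Y \<subseteq> E" using Z Y by (auto simp: triangle_transversal_def)
    have "t \<notin> triangles (E - (Z \<union> Y))" for t
    proof
      assume "t \<in> triangles (E - (Z \<union> Y))"
      then have t: "t \<in> triangles E" "disjnt t Z" "disjnt t Y"
        by (auto simp: triangles_Diff)
      with hit have "disjnt t D" by blast
      with t have "t \<in> triangles (E - D - Z)" by (simp add: triangles_Diff)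
      with Z show False by (simp add: triangle_transversal_def triangle_free_def)
    qed
    then show "triangles (E - (Z \<union> Y)) = {}" by blast
  qed
  then have "triangle_transversal_number E \<le> card (Z \<union> Y)"
    using triangle_transversal_number_attained(2)[OF fin] by blast
  also have "\<dots> \<le> card Z + card Y" by (rule card_Un_le)
  finally show ?thesis using Z P nu Y tuza unfolding tuza_def by linarith
qed

lemma tuza_minimal_counterexample:
  assumes "\<And>E :: 'a set set. irreducible E \<Longrightarrow> E = {}"
  shows "sparse (E :: 'a set set) \<Longrightarrow> tuza E"
proof (induction "card E" arbitrary: E rule: less_induct)
  case less
  then have fin: "finite E" by (simp add: sparse_def)
  have smaller: "tuza (E - D)" if "e \<in> D" "e \<in> E" for e D
  proof (rule less.hyps)
    show "card (E - D) < card E" using fin that by (intro psubset_card_mono) auto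
  qed (use less.prems sparse_Diff in blast)
  consider "E = {}" | "reducible E"
    | x y where "{x, y} \<in> E" "\<nexists>z. {x, z} \<in> E \<and> {y, z} \<in> E"
    using assms[of E] less.prems unfolding irreducible_def by blast
  then show ?case
  proof cases
    case 1
    then have "triangle_transversal E {}"
      by (simp add: triangle_transversal_def triangle_free_def triangles_def)
    then have "triangle_transversal_number E \<le> card ({} :: 'a set set)"
      by (rule triangle_transversal_number_attained(2)[OF fin])
    then show ?thesis by (simp add: tuza_def)
  next
    case 2
    then obtain S Y where S: "triangle_packing E S" "S \<noteq> {}" and Y: "Y \<subseteq> E" "card Y \<le> 2 * card S"
      and hit: "\<And>t s. t \<in> triangles E \<Longrightarrow> s \<in> S \<Longrightarrow> \<not> disjnt s t \<Longrightarrow> \<not> disjnt t Y"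
      unfolding reducible_def by blast
    obtain s where s: "s \<in> S" using S by blast
    with S have "s \<in> triangles E" by (auto simp: triangle_packing_def)
    then obtain e where e: "e \<in> s" "e \<in> E"
      using triangle_nonempty triangle_subset by blast
    show ?thesis
    proof (rule tuza_reduce[OF fin S(1) Y])
      show "\<Union>S \<subseteq> \<Union>S" ..
      show "\<not> disjnt t Y" if "t \<in> triangles E" "\<not> disjnt t (\<Union>S)" for t
        using that hit by (auto simp: disjnt_def)
      show "tuza (E - \<Union>S)" using s e by (intro smaller[of e]) auto
    qed
  next
    case (3 x y)
    \<comment> \<open>No triangle contains this edge, so the condition that \<open>Y\<close> meets
      the lost triangles is vacuous and \<open>Y = {}\<close> serves.\<close>
    have "disjnt t {{x, y}}" if "t \<in> triangles E" for t
      using 3 triangle_apex[OF that] by (auto simp: disjnt_def)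
    then have "\<not> disjnt t {}" if "t \<in> triangles E" "\<not> disjnt t {{x, y}}" for t
      using that by blast
    moreover have "triangle_packing E {}" by (simp add: triangle_packing_def)
    moreover have "tuza (E - {{x, y}})" using 3 by (intro smaller[of "{x, y}"]) simp_all
    ultimately show ?thesis
      by (intro tuza_reduce[OF fin, of "{}" "{}" "{{x, y}}"]) simp_all
  qed
qed

section \<open>Partial configurations\<close>

text \<open>
  Known adjacencies between finitely many named vertices: \<open>A\<close> for adjacent, \<open>N\<close> for nonadjacent,
  \<open>U\<close> for undetermined; the diagonal is \<open>N\<close>. A configuration also flags the vertices all of whose neighbours are named.
  Conditionals stand for Boolean connectives below where simplification should be lazy.
\<close>

datatype cell = U | A | N

type_synonym config = "cell list list \<times> bool list"

fun agrees :: "cell \<Rightarrow> bool \<Rightarrow> bool" where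
  "agrees U b = True"
| "agrees A b = b"
| "agrees N b = (\<not> b)"

text \<open>Agreement says nothing about \<open>U\<close> cells, so symmetry of the matrix is a
  condition of its own; \<open>holds_saturate\<close> uses it to read a full column as a full row. A
  flag in \<open>cl\<close> says that all neighbours are named, while their cells may still be
  \<open>U\<close>.\<close>

definition holds :: "'a set set \<Rightarrow> (nat \<Rightarrow> 'a) \<Rightarrow> config \<Rightarrow> bool" where
  "holds E f c \<longleftrightarrow> (case c of (m, cl) \<Rightarrow>
     inj_on f {..<length m} \<and> length cl = length m \<and>
     (\<forall>i<length m. length (m ! i) = length m) \<and>
     (\<forall>i<length m. \<forall>j<length m. m ! i ! j = m ! j ! i) \<and>
     (\<forall>i<length m. \<forall>j<length m. agrees (m ! i ! j) ({f i, f j} \<in> E)) \<and>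
     (\<forall>i<length m. cl ! i \<longrightarrow> (\<forall>y. {f i, y} \<in> E \<longrightarrow> y \<in> f ` {..<length m})))"

definition put :: "nat \<Rightarrow> nat \<Rightarrow> cell \<Rightarrow> cell list list \<Rightarrow> cell list list" where
  "put x y c m = m[x := (m ! x)[y := c], y := (m ! y)[x := c]]"

definition add_row :: "cell list \<Rightarrow> cell list list \<Rightarrow> cell list list" where
  "add_row r m = map2 (\<lambda>row c. row @ [c]) m r @ [r @ [N]]"

definition known_degree :: "cell list \<Rightarrow> nat" where
  "known_degree row = length (filter (\<lambda>c. c = A) row)"

text \<open>By the degree bound, seven known neighbours are all of them. This is why configurations
  with a centre of degree 7 carry no flag, whereas a centre of lower degree has to be flagged. Rows
  and columns are treated at once, which keeps the matrix symmetric.\<close>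

definition saturate :: "config \<Rightarrow> config" where
  "saturate c = (case c of (m, cl) \<Rightarrow>
     let full = map (\<lambda>row. 7 \<le> known_degree row) m
     in (map2 (\<lambda>b row. map2 (\<lambda>b' c. if c = U then if b then N else if b' then N else U else c)
           full row) full m,
         map2 (\<or>) full cl))"

lemma holdsD:
  assumes "holds E f (m, cl)"
  shows "inj_on f {..<length m}" "length cl = length m"
    "i < length m \<Longrightarrow> length (m ! i) = length m"
    "i < length m \<Longrightarrow> j < length m \<Longrightarrow> agrees (m ! i ! j) ({f i, f j} \<in> E)"
    "i < length m \<Longrightarrow> cl ! i \<Longrightarrow> {f i, y} \<in> E \<Longrightarrow> y \<in> f ` {..<length m}"
    "i < length m \<Longrightarrow> j < length m \<Longrightarrow> m ! i ! j = m ! j ! i"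
  using assms unfolding holds_def by blast+

lemma holds_inj:
  "holds E f (m, cl) \<Longrightarrow> i < length m \<Longrightarrow> j < length m \<Longrightarrow> f i = f j \<longleftrightarrow> i = j"
  by (auto simp: holds_def inj_on_def)

lemma put_nth:
  assumes "x < length m" "y < length m" "x \<noteq> y"
    and "\<And>i. i < length m \<Longrightarrow> length (m ! i) = length m"
  shows "length (put x y c m) = length m"
    and "i < length m \<Longrightarrow> length (put x y c m ! i) = length m"
    and "i < length m \<Longrightarrow> j < length m \<Longrightarrow>
      put x y c m ! i ! j = (if i = x \<and> j = y \<or> i = y \<and> j = x then c else m ! i ! j)"
  using assms by (auto simp: put_def nth_list_update)

lemma holds_put:
  assumes h: "holds E f (m, cl)" and xy: "x < length m" "y < length m" "x \<noteq> y"
    and c: "agrees c ({f x, f y} \<in> E)"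
  shows "holds E f (put x y c m, cl)"
proof -
  note p = put_nth[OF xy holdsD(3)[OF h]]
  have "agrees (put x y c m ! i ! j) ({f i, f j} \<in> E)" if "i < length m" "j < length m" for i j
    using that holdsD(4)[OF h that] c by (auto simp: p insert_commute)
  with h show ?thesis by (simp add: holds_def p)
qed

lemma holds_cut:
  assumes h: "holds E f (m, cl)" and xy: "x < length m" "y < length m" "x \<noteq> y"
  shows "holds (E - {{f x, f y}}) f (put x y N m, cl)"
proof -
  note p = put_nth[OF xy holdsD(3)[OF h]]
  have "agrees (put x y N m ! i ! j) ({f i, f j} \<in> E - {{f x, f y}})"
    if "i < length m" "j < length m" for i j
    using that xy holdsD(4)[OF h that] holds_inj[OF h]
    by (cases "m ! i ! j") (auto simp: p doubleton_eq_iff)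
  with h show ?thesis by (auto simp: holds_def p)
qed

lemma holds_close:
  assumes h: "holds E f (m, cl)" and x: "x < length m"
    and closed: "\<And>y. {f x, y} \<in> E \<Longrightarrow> y \<in> f ` {..<length m}"
  shows "holds E f (m, cl[x := True])"
  using h x closed by (auto simp: holds_def nth_list_update)

lemma holds_isolate:
  assumes h: "holds E f (m, cl)" and x: "x < length m"
  shows "holds (E - {{f x, y} | y. y \<notin> f ` {..<length m}}) f (m, cl[x := True])"
proof (rule holds_close[OF _ x])
  have "{f i, f j} \<notin> {{f x, y} | y. y \<notin> f ` {..<length m}}"
    if "i < length m" "j < length m" for i j
    using that by (auto simp: doubleton_eq_iff)
  with h show "holds (E - {{f x, y} | y. y \<notin> f ` {..<length m}}) f (m, cl)"
    by (auto simp: holds_def)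
qed blast

lemma known_neighbours:
  assumes h: "holds E f (m, cl)" and x: "x < length m"
  defines "K \<equiv> (\<lambda>j. {f x, f j}) ` {j. j < length m \<and> m ! x ! j = A}"
  shows "K \<subseteq> {e \<in> E. f x \<in> e}" "card K = known_degree (m ! x)"
proof -
  have "{f x, f j} \<in> E" if "j < length m" "m ! x ! j = A" for j
    using holdsD(4)[OF h x that(1)] that by simp
  then show "K \<subseteq> {e \<in> E. f x \<in> e}" by (auto simp: K_def)
  have "inj_on (\<lambda>j. {f x, f j}) {j. j < length m \<and> m ! x ! j = A}"
    using holds_inj[OF h] x by (auto simp: inj_on_def doubleton_eq_iff)
  then have "card K = card {j. j < length m \<and> m ! x ! j = A}"
    by (simp add: K_def card_image)
  then show "card K = known_degree (m ! x)"
    using holdsD(3)[OF h x] by (simp add: known_degree_def length_filter_conv_card)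
qed

text \<open>The edges to known neighbours and those to unnamed vertices are disjoint sets of edges
  at \<open>f x\<close>, at most 7 together. The bound is the price of cutting \<open>x\<close> off
  from the unnamed vertices.\<close>

lemma card_outside:
  assumes h: "holds E f (m, cl)" and x: "x < length m" and E: "sparse E"
  shows "card (E \<inter> {{f x, y} | y. y \<notin> f ` {..<length m}}) \<le> 7 - known_degree (m ! x)"
proof -
  define K where "K = (\<lambda>j. {f x, f j}) ` {j. j < length m \<and> m ! x ! j = A}"
  define R where "R = E \<inter> {{f x, y} | y. y \<notin> f ` {..<length m}}"
  note K = known_neighbours[OF h x, folded K_def]
  have fin: "finite {e \<in> E. f x \<in> e}" using E by (auto simp: sparse_def)
  have R: "R \<subseteq> {e \<in> E. f x \<in> e}" by (auto simp: R_def)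
  have "f x \<in> f ` {..<length m}" using x by simp
  then have "K \<inter> R = {}" by (auto simp: K_def R_def doubleton_eq_iff)
  then have "card K + card R = card (K \<union> R)"
    using K R fin by (metis card_Un_disjoint finite_subset)
  also have "\<dots> \<le> card {e \<in> E. f x \<in> e}" using K R fin by (intro card_mono) auto
  also have "\<dots> \<le> 7" using E by (simp add: sparse_def vertex_degree_def)
  finally show ?thesis using K by (simp add: R_def)
qed

text \<open>The known neighbours give at least 7 distinct edges at \<open>f x\<close>, and there are
  no more than 7, so these are all.\<close>

lemma full_vertex:
  assumes h: "holds E f (m, cl)" and x: "x < length m" and E: "sparse E"
    and full: "7 \<le> known_degree (m ! x)" and y: "{f x, y} \<in> E"
  shows "\<exists>j<length m. m ! x ! j = A \<and> y = f j"
proof -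
  define K where "K = (\<lambda>j. {f x, f j}) ` {j. j < length m \<and> m ! x ! j = A}"
  note K = known_neighbours[OF h x, folded K_def]
  have "finite {e \<in> E. f x \<in> e}" "card {e \<in> E. f x \<in> e} \<le> card K"
    using E full K by (auto simp: sparse_def vertex_degree_def intro: le_trans)
  with K have "K = {e \<in> E. f x \<in> e}" by (metis card_seteq)
  with y have "{f x, y} \<in> K" by simp
  then show ?thesis by (auto simp: K_def doubleton_eq_iff)
qed

lemma holds_saturate:
  assumes h: "holds E f c" and E: "sparse E"
  shows "holds E f (saturate c)"
proof -
  obtain m cl where c: "c = (m, cl)" by fastforce
  note h = h[unfolded c]
  have no: "{f i, f j} \<notin> E" if "i < length m" "j < length m" "m ! i ! j \<noteq> A"
    "7 \<le> known_degree (m ! i)" for i j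
    using full_vertex[OF h that(1) E that(4)] holds_inj[OF h] that by metis
  have no': "{f i, f j} \<notin> E" if "i < length m" "j < length m" "m ! i ! j \<noteq> A"
    "7 \<le> known_degree (m ! j)" for i j
    using no[of j i] that holdsD(6)[OF h that(1,2)] by (simp add: insert_commute)
  define m' where "m' = fst (saturate c)"
  define cl' where "cl' = snd (saturate c)"
  have len: "length m' = length m" "length cl' = length m"
    using holdsD(2)[OF h] by (simp_all add: m'_def cl'_def saturate_def c Let_def)
  have row: "length (m' ! i) = length m" if "i < length m" for i
    using that holdsD(3)[OF h that] by (simp add: m'_def saturate_def c Let_def)
  have cell: "m' ! i ! j = (if m ! i ! j = U then if 7 \<le> known_degree (m ! i) then N
      else if 7 \<le> known_degree (m ! j) then N else U else m ! i ! j)"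
    if "i < length m" "j < length m" for i j
    using that holdsD(3)[OF h that(1)] by (simp add: m'_def saturate_def c Let_def)
  have closed: "cl' ! i \<longleftrightarrow> 7 \<le> known_degree (m ! i) \<or> cl ! i" if "i < length m" for i
    using that holdsD(2)[OF h] by (simp add: cl'_def saturate_def c Let_def)
  have "agrees (m' ! i ! j) ({f i, f j} \<in> E)" if "i < length m" "j < length m" for i j
    using holdsD(4)[OF h that] no[OF that] no'[OF that] by (auto simp: cell[OF that])
  moreover have "m' ! i ! j = m' ! j ! i" if "i < length m" "j < length m" for i j
    using that holdsD(6)[OF h that] by (simp add: cell)
  moreover have "y \<in> f ` {..<length m}" if "i < length m" "cl' ! i" "{f i, y} \<in> E" for i y
    using that closed holdsD(5)[OF h] full_vertex[OF h that(1) E] by blast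
  ultimately have "holds E f (m', cl')"
    using holdsD(1)[OF h] by (simp add: holds_def len row)
  then show ?thesis by (simp add: m'_def cl'_def)
qed

section \<open>Checking reductions\<close>

text \<open>A sufficient test for lying in no triangle: as one end is closed, a common neighbour
  would have to be named, but every column has an \<open>N\<close> in one of the two rows. A
  \<open>U\<close> cell counts as a possible edge.\<close>

definition bare :: "config \<Rightarrow> nat \<Rightarrow> nat \<Rightarrow> bool" where
  "bare c x y = (case c of (m, cl) \<Rightarrow>
     if m ! x ! y = N then True
     else if (if cl ! x then True else cl ! y)
     then list_all2 (\<lambda>c d. if c = N then True else d = N) (m ! x) (m ! y) else False)"

fun sides :: "nat \<times> nat \<times> nat \<Rightarrow> (nat \<times> nat) list" where
  "sides (a, b, c) = [(a, b), (b, c), (a, c)]"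

text \<open>
  The edge set removed by a reduction consists of the named edges \<open>xs\<close> and of all edges from
  a vertex in \<open>os\<close> to unnamed vertices. As degrees are at most 7, the latter are counted by the
  known degrees.
\<close>

definition reduces ::
    "(nat \<times> nat \<times> nat) list \<Rightarrow> (nat \<times> nat) list \<Rightarrow> nat list \<Rightarrow> config \<Rightarrow> bool" where
  "reduces ts xs os c = (case c of (m, cl) \<Rightarrow>
     let es = concat (map sides ts);
         m' = fold (\<lambda>(a, b). put a b N) xs m;
         cl' = fold (\<lambda>x cl. cl[x := True]) os cl
     in ts \<noteq> [] \<and> distinct es
      \<and> list_all (\<lambda>(a, b). a < b \<and> b < length m) es
      \<and> list_all (\<lambda>(a, b). a < b \<and> b < length m) xs
      \<and> list_all (\<lambda>a. a < length m) os
      \<and> length xs + sum_list (map (\<lambda>x. 7 - known_degree (m ! x)) os) \<le> 2 * length ts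
      \<and> list_all (\<lambda>(a, b). m ! a ! b = A) es
      \<and> list_all (\<lambda>(a, b). bare (m', cl') a b) es)"

lemma bare_no_apex:
  assumes h: "holds E f c" and b: "bare c x y" and xy: "x < length (fst c)" "y < length (fst c)"
    and e: "{f x, f y} \<in> E"
  shows "\<nexists>z. {f x, z} \<in> E \<and> {f y, z} \<in> E"
proof
  assume "\<exists>z. {f x, z} \<in> E \<and> {f y, z} \<in> E"
  then obtain z where z: "{f x, z} \<in> E" "{f y, z} \<in> E" by blast
  obtain m cl where c: "c = (m, cl)" by fastforce
  note h = h[unfolded c]
  have xy: "x < length m" "y < length m" using xy by (simp_all add: c)
  have "m ! x ! y \<noteq> N" using holdsD(4)[OF h xy] e by auto
  with b have cl: "cl ! x \<or> cl ! y"
    and no: "list_all2 (\<lambda>c d. if c = N then True else d = N) (m ! x) (m ! y)"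
    unfolding bare_def c prod.case by presburger+
  from cl z holdsD(5)[OF h, of x z] holdsD(5)[OF h, of y z] xy obtain k where k: "k < length m" "z = f k" by blast
  have "m ! x ! k = N \<or> m ! y ! k = N"
    using list_all2_nthD[OF no, of k] k holdsD(3)[OF h xy(1)] by (auto split: if_splits)
  then show False using holdsD(4)[OF h xy(1) k(1)] holdsD(4)[OF h xy(2) k(1)] z k by auto
qed

text \<open>Removing edges to unnamed vertices changes no cell, so the price of every vertex in
  \<open>os\<close> can be read off the same matrix \<open>m\<close>.\<close>

lemma holds_isolate_all:
  assumes "holds E f (m, cl)" "sparse E" "\<forall>x\<in>set os. x < length m"
  shows "\<exists>Y\<subseteq>E. card Y \<le> sum_list (map (\<lambda>x. 7 - known_degree (m ! x)) os) \<and>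
    holds (E - Y) f (m, fold (\<lambda>x cl. cl[x := True]) os cl)"
  using assms
proof (induction os arbitrary: E cl)
  case Nil
  then show ?case by (intro exI[of _ "{}"]) simp
next
  case (Cons x os)
  define R where "R = E \<inter> {{f x, y} | y. y \<notin> f ` {..<length m}}"
  have x: "x < length m" using Cons.prems by simp
  have "E - R = E - {{f x, y} | y. y \<notin> f ` {..<length m}}" by (auto simp: R_def)
  then have "holds (E - R) f (m, cl[x := True])"
    using holds_isolate[OF Cons.prems(1) x] by simp
  from Cons.IH[OF this sparse_Diff[OF Cons.prems(2)]] Cons.prems(3)
  obtain Y where Y: "Y \<subseteq> E - R" "card Y \<le> sum_list (map (\<lambda>x. 7 - known_degree (m ! x)) os)"
    "holds (E - R - Y) f (m, fold (\<lambda>x cl. cl[x := True]) os (cl[x := True]))"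
    by auto
  have "card (R \<union> Y) \<le> card R + card Y" by (rule card_Un_le)
  also have "card R \<le> 7 - known_degree (m ! x)"
    unfolding R_def by (rule card_outside[OF Cons.prems(1) x Cons.prems(2)])
  finally have "card (R \<union> Y) \<le> sum_list (map (\<lambda>x. 7 - known_degree (m ! x)) (x # os))"
    using Y by simp
  moreover have "R \<union> Y \<subseteq> E" using Y by (auto simp: R_def)
  ultimately show ?case using Y(3) by (intro exI[of _ "R \<union> Y"]) (simp add: Diff_eq Int_assoc)
qed

lemma holds_cut_all:
  assumes "holds E f (m, cl)" "\<forall>(a, b)\<in>set xs. a < b \<and> b < length m"
  shows "\<exists>Y. finite Y \<and> card Y \<le> length xs \<and> holds (E - Y) f (fold (\<lambda>(a, b). put a b N) xs m, cl)"
  using assms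
proof (induction xs arbitrary: E m)
  case Nil
  then show ?case by (intro exI[of _ "{}"]) simp
next
  case (Cons e xs)
  obtain a b where e: "e = (a, b)" by fastforce
  with Cons.prems have ab: "a < length m" "b < length m" "a \<noteq> b" by auto
  note h = holds_cut[OF Cons.prems(1) ab]
  have "length (put a b N m) = length m" by (simp add: put_def)
  with Cons.IH[OF h] Cons.prems(2)
  obtain Y where Y: "finite Y" "card Y \<le> length xs"
    "holds (E - {{f a, f b}} - Y) f (fold (\<lambda>(a, b). put a b N) xs (put a b N m), cl)"
    by auto
  have "card (insert {f a, f b} Y) \<le> length (e # xs)"
    using Y(1,2) by (simp add: card_insert_if)
  moreover have "E - {{f a, f b}} - Y = E - insert {f a, f b} Y" by blast
  ultimately show ?case using Y(1,3) e by (intro exI[of _ "insert {f a, f b} Y"]) simp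
qed

text \<open>The triangles of \<open>ts\<close> form the packing. After the removals each of their
  edges is \<open>bare\<close>, that is, gone or in no remaining triangle; this is exactly the
  condition that \<open>Y\<close> meets every triangle sharing an edge with the packing.\<close>

lemma reduces_sound:
  assumes h: "holds E f c" and E: "sparse E" and r: "reduces ts xs os c"
  shows "reducible E"
proof -
  obtain m cl where c: "c = (m, cl)" by fastforce
  note h = h[unfolded c]
  define es where "es = concat (map sides ts)"
  define m' where "m' = fold (\<lambda>(a, b). put a b N) xs m"
  define cl' where "cl' = fold (\<lambda>x cl. cl[x := True]) os cl"
  have ts: "ts \<noteq> []" and dist: "distinct es"
    and es: "\<And>a b. (a, b) \<in> set es \<Longrightarrow> a < b \<and> b < length m \<and> m ! a ! b = A \<and> bare (m', cl') a b"
    and xs: "\<forall>(a, b)\<in>set xs. a < b \<and> b < length m" and os: "\<forall>x\<in>set os. x < length m"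
    and cost: "length xs + sum_list (map (\<lambda>x. 7 - known_degree (m ! x)) os) \<le> 2 * length ts"
    using r by (auto simp: reduces_def c Let_def list_all_iff simp flip: es_def m'_def cl'_def)
  \<comment> \<open>Isolation comes first, while the matrix still has its original known degrees;
    the cuts would lower them and thereby raise the price.\<close>
  obtain Y1 where Y1: "Y1 \<subseteq> E" "holds (E - Y1) f (m, cl')"
    "card Y1 \<le> sum_list (map (\<lambda>x. 7 - known_degree (m ! x)) os)"
    using holds_isolate_all[OF h E os] by (auto simp: cl'_def)
  obtain Y2 where Y2: "finite Y2" "card Y2 \<le> length xs" "holds (E - Y1 - Y2) f (m', cl')"
    using holds_cut_all[OF Y1(2) xs] by (auto simp: m'_def)
  \<comment> \<open>\<open>xs\<close> may list pairs whose cell is \<open>U\<close>. Those that turn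
    out not to be edges only make the bound on \<open>card Y\<close> generous.\<close>
  define Y where "Y = E \<inter> (Y1 \<union> Y2)"
  have fin: "finite E" using E by (simp add: sparse_def)
  have len: "length m' = length m"
  proof -
    have "length (fold (\<lambda>(a, b). put a b N) zs k) = length k" for zs k
      by (induction zs arbitrary: k) (auto simp: put_def)
    then show ?thesis by (simp add: m'_def)
  qed
  have "E - Y1 - Y2 = E - Y" by (auto simp: Y_def)
  with Y2 have hY: "holds (E - Y) f (m', cl')" by simp
  define g where "g = (\<lambda>(a, b). {f a, f b})"
  have edge: "g e \<in> E" if "e \<in> set es" for e
    using es[of "fst e" "snd e"] that holdsD(4)[OF h, of "fst e" "snd e"]
    by (auto simp: g_def split_beta)
  \<comment> \<open>All pairs are increasing, so distinct pairs name distinct edges, and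
    \<open>distinct es\<close> becomes edge-disjointness of the triangles.\<close>
  have inj: "inj_on g (set es)"
  proof (rule inj_onI)
    fix d e assume d: "d \<in> set es" and e: "e \<in> set es" and eq: "g d = g e"
    obtain p q where d': "d = (p, q)" by fastforce
    obtain r s where e': "e = (r, s)" by fastforce
    have "p < q" "q < length m" "r < s" "s < length m"
      using es[of p q] es[of r s] d e by (auto simp: d' e')
    with eq show "d = e" using holds_inj[OF h] by (auto simp: g_def d' e' doubleton_eq_iff)
  qed
  define T where "T = (\<lambda>t. g ` set (sides t))"
  have sub: "set (sides t) \<subseteq> set es" if "t \<in> set ts" for t
    using that by (auto simp: es_def)
  have tri: "T t \<in> triangles E" if "t \<in> set ts" for t
  proof -
    obtain a b d where t: "t = (a, b, d)" by (metis prod_cases3)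
    have e: "(a, b) \<in> set es" "(b, d) \<in> set es" "(a, d) \<in> set es"
      using sub[OF that] by (auto simp: t)
    then have "a < b" "b < d" "d < length m" using es by blast+
    then have "f a \<noteq> f b" "f b \<noteq> f d" "f a \<noteq> f d" using holds_inj[OF h] by auto
    moreover have "{f a, f b} \<in> E" "{f b, f d} \<in> E" "{f a, f d} \<in> E"
      using e edge by (fastforce simp: g_def)+
    ultimately show ?thesis unfolding triangles_def T_def t g_def by auto
  qed
  \<comment> \<open>\<open>distinct_concat_iff\<close> ignores empty lists; each
    \<open>sides t\<close> has three entries, so nothing is dropped.\<close>
  have removeAll: "removeAll [] (map sides ts) = map sides ts"
    by (rule removeAll_id) auto
  have dT: "disjnt (T t) (T u)" if "t \<in> set ts" "u \<in> set ts" "t \<noteq> u" for t u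
  proof -
    have "sides t \<noteq> sides u" using that(3) by (cases t; cases u) simp
    moreover have "sides t \<in> set (map sides ts)" "sides u \<in> set (map sides ts)"
      using that by simp_all
    ultimately have "set (sides t) \<inter> set (sides u) = {}"
      using dist unfolding es_def distinct_concat_iff by blast
    then have "T t \<inter> T u = {}"
      using inj_on_image_Int[OF inj sub[OF that(1)] sub[OF that(2)]] by (simp add: T_def)
    then show ?thesis by (simp add: disjnt_def)
  qed
  have "inj_on T (set ts)"
  proof (rule inj_onI)
    fix t u assume tu: "t \<in> set ts" "u \<in> set ts" "T t = T u"
    then show "t = u" using dT[of t u] triangle_nonempty[OF tri[of t]] by (auto simp: disjnt_def)
  qed
  moreover have "distinct ts"
    using dist removeAll by (auto simp: es_def distinct_concat_iff distinct_map)
  ultimately have card: "card (T ` set ts) = length ts"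
    by (simp add: card_image distinct_card)
  show ?thesis
    unfolding reducible_def
  proof (intro exI[of _ "T ` set ts"] exI[of _ Y] conjI ballI impI)
    show "triangle_packing E (T ` set ts)"
      using tri dT unfolding triangle_packing_def pairwise_def by blast
    show "T ` set ts \<noteq> {}" using ts by simp
    show "Y \<subseteq> E" by (simp add: Y_def)
    have "card Y \<le> card (Y1 \<union> (E \<inter> Y2))"
      using fin Y1(1) by (intro card_mono) (auto simp: Y_def intro: finite_subset)
    also have "\<dots> \<le> card Y1 + card (E \<inter> Y2)" by (rule card_Un_le)
    also have "card (E \<inter> Y2) \<le> length xs"
      using Y2(1,2) card_mono[of Y2 "E \<inter> Y2"] by simp
    finally show "card Y \<le> 2 * card (T ` set ts)" using Y1(3) cost card by simp
  next
    fix t assume t: "t \<in> triangles E" and "\<exists>s\<in>T ` set ts. \<not> disjnt s t"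
    then obtain u e where u: "u \<in> set ts" "e \<in> set (sides u)" "g e \<in> t"
      unfolding disjnt_def T_def by blast
    obtain a b where e: "e = (a, b)" by fastforce
    have ab: "a < length m'" "b < length m'" "bare (m', cl') a b"
      using es[of a b] sub[OF u(1)] u(2) len by (auto simp: e)
    show "\<not> disjnt t Y"
    proof
      \<comment> \<open>A triangle avoiding \<open>Y\<close> survives the removals and would give a
        \<open>bare\<close> edge an apex.\<close>
      assume "disjnt t Y"
      with t have t': "t \<in> triangles (E - Y)" by (simp add: triangles_Diff)
      have "{f a, f b} \<in> t" using u(3) by (simp add: g_def e)
      with triangle_apex[OF t'] triangle_subset[OF t'] bare_no_apex[OF hY] ab
      show False by fastforce
    qed
  qed
qed

section \<open>Case analysis\<close>

text \<open>Vertex \<open>i\<close> of the pattern \<open>c'\<close> is played by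
  \<open>p ! i\<close>, and a \<open>U\<close> of the pattern accepts any cell. Closedness is
  relative to the named vertices, of which the pattern may have fewer: a vertex flagged in
  \<open>c'\<close> needs a flag in \<open>c\<close> and \<open>N\<close> towards all vertices
  outside \<open>p\<close>.\<close>

definition matches :: "config \<Rightarrow> nat list \<Rightarrow> config \<Rightarrow> bool" where
  "matches c' p c = (case (c', c) of ((m', cl'), (m, cl)) \<Rightarrow>
     distinct p \<and> list_all (\<lambda>i. i < length m) p
     \<and> list_all2 (list_all2 (\<lambda>d e. if d = U then True else d = e)) m'
         (map (\<lambda>i. let r = m ! i in map (\<lambda>j. r ! j) p) p)
     \<and> list_all2 (\<lambda>b i. if b then if cl ! i
           then list_all (\<lambda>j. if m ! i ! j = N then True else List.member p j) [0..<length m]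
           else False else True) cl' p)"

text \<open>
  A case tree refutes a configuration in every irreducible graph: \<open>Reduce\<close> exhibits a reduction,
  \<open>Bare\<close> an edge that lies in no triangle, \<open>Use k p\<close> embeds the \<open>k\<close>-th of the configurations
  \<open>cs\<close> refuted before by renaming \<open>i\<close> to \<open>p ! i\<close>, \<open>Split x y\<close> distinguishes whether \<open>x\<close> and \<open>y\<close> are adjacent,
  and \<open>Extend x\<close> whether all neighbours of \<open>x\<close> are named; if not, it names a new one.
\<close>

datatype case_tree =
    Reduce "(nat \<times> nat \<times> nat) list" "(nat \<times> nat) list" "nat list"
  | Bare nat nat
  | Use nat "nat list"
  | Split nat nat case_tree case_tree
  | Extend nat case_tree case_tree

text \<open>Splitting and extending act on the unsaturated configuration; only the leaves saturate
  it. A vertex named by \<open>Extend\<close> gets \<open>U\<close> even towards closed vertices, a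
  sound weakening that saturation repairs at vertices with seven known neighbours.\<close>

fun check :: "config list \<Rightarrow> case_tree \<Rightarrow> config \<Rightarrow> bool" where
  "check cs (Reduce ts xs os) c = reduces ts xs os (saturate c)"
| "check cs (Bare x y) c = (x < length (fst c) \<and> y < length (fst c) \<and>
     fst c ! x ! y = A \<and> bare (saturate c) x y)"
| "check cs (Use k p) c = (k < length cs \<and> matches (cs ! k) p (saturate c))"
| "check cs (Split x y t u) c = (x < length (fst c) \<and> y < length (fst c) \<and> x \<noteq> y \<and>
     check cs t (put x y A (fst c), snd c) \<and> check cs u (put x y N (fst c), snd c))"
| "check cs (Extend x t u) c = (x < length (fst c) \<and>
     check cs t (fst c, (snd c)[x := True]) \<and>
     check cs u (add_row (map (\<lambda>i. if i = x then A else U) [0..<length (fst c)]) (fst c),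
       snd c @ [False]))"

text \<open>Checked for patterns because \<open>matches\<close> does not imply it: a
  \<open>U\<close> cell may face a determined one across the diagonal.\<close>

definition symmetric :: "cell list list \<Rightarrow> bool" where
  "symmetric m = list_all (\<lambda>i. list_all (\<lambda>j. m ! i ! j = m ! j ! i) [0..<i]) [0..<length m]"

text \<open>No graph occurs here, so every refutation below is a closed statement that evaluation
  derives from earlier ones. The order of \<open>cs\<close> numbers these for
  \<open>Use\<close>.\<close>

inductive refutable :: "config \<Rightarrow> bool" where
  "(\<And>c'. c' \<in> set cs \<Longrightarrow> refutable c') \<Longrightarrow> symmetric (fst c) \<and> check cs t c \<Longrightarrow> refutable c"

text \<open>The adjacencies are given by the part of the matrix below the diagonal.\<close>

definition cfg :: "cell list list \<Rightarrow> nat list \<Rightarrow> config" where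
  "cfg rows cl = (fold add_row rows [], map (\<lambda>i. List.member cl i) [0..<length rows])"

lemma holds_Use:
  assumes h: "holds E f c" and ma: "matches c' p c" and sym: "symmetric (fst c')"
  shows "holds E (\<lambda>i. f (p ! i)) c'"
proof -
  obtain m cl where c: "c = (m, cl)" by fastforce
  obtain m' cl' where c': "c' = (m', cl')" by fastforce
  note h = h[unfolded c]
  have p: "distinct p" "\<And>i. i < length p \<Longrightarrow> p ! i < length m"
    and cells: "list_all2 (list_all2 (\<lambda>d e. if d = U then True else d = e)) m'
         (map (\<lambda>i. let r = m ! i in map (\<lambda>j. r ! j) p) p)"
    and closed: "list_all2 (\<lambda>b i. if b then if cl ! i
           then list_all (\<lambda>j. if m ! i ! j = N then True else List.member p j) [0..<length m]
           else False else True) cl' p"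
    using ma by (simp_all add: matches_def c c' list_all_length)
  have len: "length m' = length p" "length cl' = length p"
    using list_all2_lengthD[OF cells] list_all2_lengthD[OF closed] by simp_all
  have row: "list_all2 (\<lambda>d e. if d = U then True else d = e) (m' ! i) (map (\<lambda>j. m ! (p ! i) ! j) p)"
    if "i < length p" for i
    using list_all2_nthD[OF cells, of i] that len by (simp add: Let_def)
  have rowlen: "length (m' ! i) = length p" if "i < length p" for i
    using list_all2_lengthD[OF row[OF that]] by simp
  have cell: "m' ! i ! j = U \<or> m' ! i ! j = m ! (p ! i) ! (p ! j)"
    if "i < length p" "j < length p" for i j
    using list_all2_nthD[OF row[OF that(1)], of j] rowlen that by (simp split: if_splits)
  have sym': "\<forall>i<length p. \<forall>j<i. m' ! i ! j = m' ! j ! i"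
    using sym len by (simp add: symmetric_def c' list_all_length)
  have "inj_on (\<lambda>i. f (p ! i)) {..<length p}"
    using holds_inj[OF h] p by (auto simp: inj_on_def nth_eq_iff_index_eq)
  moreover have "agrees (m' ! i ! j) ({f (p ! i), f (p ! j)} \<in> E)"
    if "i < length p" "j < length p" for i j
    using cell[OF that] holdsD(4)[OF h p(2)[OF that(1)] p(2)[OF that(2)]] by auto
  moreover have "m' ! i ! j = m' ! j ! i" if "i < length p" "j < length p" for i j
    using sym' that by (cases i j rule: linorder_cases) auto
  \<comment> \<open>A neighbour of a flagged vertex is named in \<open>c\<close> and its cell there
    is not \<open>N\<close>, so \<open>matches\<close> places it in \<open>p\<close>.\<close>
  moreover have "y \<in> (\<lambda>i. f (p ! i)) ` {..<length p}"
    if i: "i < length p" "cl' ! i" and y: "{f (p ! i), y} \<in> E" for i y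
  proof -
    have cl: "cl ! (p ! i)"
      and rest: "\<And>j. j < length m \<Longrightarrow> m ! (p ! i) ! j = N \<or> j \<in> set p"
      using list_all2_nthD[OF closed, of i] i len
      by (auto simp: list_all_iff split: if_splits)
    obtain j where j: "j < length m" "y = f j"
      using holdsD(5)[OF h p(2)[OF i(1)] cl y] by blast
    have "m ! (p ! i) ! j \<noteq> N" using holdsD(4)[OF h p(2)[OF i(1)] j(1)] y j by auto
    with rest[OF j(1)] obtain k where "k < length p" "j = p ! k" by (auto simp: in_set_conv_nth)
    with j show ?thesis by auto
  qed
  ultimately show ?thesis by (simp add: holds_def c' len rowlen)
qed

lemma add_row_nth:
  assumes "length r = length m" and "\<And>i. i < length m \<Longrightarrow> length (m ! i) = length m"
  shows "length (add_row r m) = Suc (length m)"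
    and "i \<le> length m \<Longrightarrow> length (add_row r m ! i) = Suc (length m)"
    and "i \<le> length m \<Longrightarrow> j \<le> length m \<Longrightarrow> add_row r m ! i ! j =
      (if i < length m then if j < length m then m ! i ! j else r ! i
       else if j < length m then r ! j else N)"
  using assms by (auto simp: add_row_def nth_append)

lemma holds_Extend:
  assumes h: "holds E f (m, cl)" and E: "sparse E" and x: "x < length m"
    and z: "{f x, z} \<in> E" "z \<notin> f ` {..<length m}"
  shows "holds E (f(length m := z))
    (add_row (map (\<lambda>i. if i = x then A else U) [0..<length m]) m, cl @ [False])"
    (is "holds E ?f (add_row ?r m, _)")
proof -
  have len: "length ?r = length m" by simp
  note a = add_row_nth[OF len holdsD(3)[OF h]]
  have inj: "inj_on ?f {..<Suc (length m)}"
    using holdsD(1)[OF h] z(2) by (auto simp: inj_on_def less_Suc_eq)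
  \<comment> \<open>The new diagonal cell is \<open>N\<close>; it agrees because \<open>E\<close>
    has no loops.\<close>
  have "agrees (add_row ?r m ! i ! j) ({?f i, ?f j} \<in> E)" if "i \<le> length m" "j \<le> length m" for i j
    using that holdsD(4)[OF h, of i j] z(1) sparse_no_loop[OF E, of z]
    by (auto simp: a insert_commute le_less)
  moreover have "add_row ?r m ! i ! j = add_row ?r m ! j ! i"
    if "i \<le> length m" "j \<le> length m" for i j
    using that holdsD(6)[OF h, of i j] by (auto simp: a)
  moreover have "y \<in> ?f ` {..<Suc (length m)}"
    if "i < length m" "cl ! i" "{f i, y} \<in> E" for i y
  proof -
    have "f ` {..<length m} \<subseteq> ?f ` {..<Suc (length m)}" by force
    with holdsD(5)[OF h that] show ?thesis by blast
  qed
  ultimately show ?thesis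
    using inj holdsD(2)[OF h]
    by (auto simp: holds_def a less_Suc_eq_le nth_append le_less)
qed

text \<open>The naming \<open>f\<close> varies in the induction because \<open>Extend\<close>
  enlarges it. \<open>Split\<close> argues by the actual adjacency in \<open>E\<close>, so it may
  even overwrite a cell that was determined before. A leaf \<open>Reduce\<close> contradicts
  irreducibility through \<open>reducible\<close>, a leaf \<open>Bare\<close> through the triangle
  on every edge.\<close>

lemma check_sound:
  assumes E: "irreducible E" and cs: "\<And>c f. c \<in> set cs \<Longrightarrow> symmetric (fst c) \<and> \<not> holds E f c"
  shows "check cs t c \<Longrightarrow> \<not> holds E f c"
proof (induction t arbitrary: c f)
  case (Reduce ts xs os)
  show ?case
  proof
    assume "holds E f c"
    with E have "holds E f (saturate c)" by (auto simp: irreducible_def intro: holds_saturate)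
    with E Reduce.prems show False
      using reduces_sound[of E f "saturate c" ts xs os] by (auto simp: irreducible_def)
  qed
next
  case (Bare x y)
  show ?case
  proof
    assume h: "holds E f c"
    obtain m cl where c: "c = (m, cl)" by fastforce
    have xy: "x < length m" "y < length m" "m ! x ! y = A" "bare (saturate c) x y"
      using Bare by (auto simp: c)
    have e: "{f x, f y} \<in> E" using holdsD(4)[OF h[unfolded c] xy(1,2)] xy(3) by simp
    have hs: "holds E f (saturate c)" using h E by (auto simp: irreducible_def intro: holds_saturate)
    have "length (fst (saturate c)) = length m" by (simp add: saturate_def c Let_def)
    with bare_no_apex[OF hs xy(4) _ _ e] xy have "\<nexists>z. {f x, z} \<in> E \<and> {f y, z} \<in> E" by simp
    with E e show False by (auto simp: irreducible_def)
  qed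
next
  case (Use k p)
  then have c': "cs ! k \<in> set cs" "matches (cs ! k) p (saturate c)" by simp_all
  show ?case
  proof
    assume "holds E f c"
    with E have "holds E f (saturate c)" by (auto simp: irreducible_def intro: holds_saturate)
    with holds_Use c' cs[OF c'(1)] show False by blast
  qed
next
  case (Split x y t u)
  show ?case
  proof
    assume h: "holds E f c"
    obtain m cl where c: "c = (m, cl)" by fastforce
    have xy: "x < length m" "y < length m" "x \<noteq> y" using Split.prems by (simp_all add: c)
    show False
    proof (cases "{f x, f y} \<in> E")
      case True
      then have "holds E f (put x y A m, cl)" using holds_put[OF h[unfolded c] xy] by simp
      with Split.IH(1) Split.prems show False by (simp add: c)
    next
      case False
      then have "holds E f (put x y N m, cl)" using holds_put[OF h[unfolded c] xy] by simp
      with Split.IH(2) Split.prems show False by (simp add: c)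
    qed
  qed
next
  case (Extend x t u)
  show ?case
  proof
    assume h: "holds E f c"
    obtain m cl where c: "c = (m, cl)" by fastforce
    have x: "x < length m" using Extend.prems by (simp add: c)
    show False
    proof (cases "\<forall>y. {f x, y} \<in> E \<longrightarrow> y \<in> f ` {..<length m}")
      case True
      then have "holds E f (m, cl[x := True])" using holds_close[OF h[unfolded c] x] by blast
      with Extend.IH(1) Extend.prems show False by (simp add: c)
    next
      case False
      then obtain z where "{f x, z} \<in> E" "z \<notin> f ` {..<length m}" by blast
      with holds_Extend[OF h[unfolded c] _ x] E Extend.IH(2) Extend.prems show False
        by (auto simp: c irreducible_def)
    qed
  qed
qed

lemma refutable_sound:
  assumes E: "irreducible E"
  shows "refutable c \<Longrightarrow> symmetric (fst c) \<and> \<not> holds E f c"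
  by (induction arbitrary: f rule: refutable.induct) (use check_sound[OF E] in blast)

lemma refutableI: "list_all refutable cs \<Longrightarrow> symmetric (fst c) \<and> check cs t c \<Longrightarrow> refutable c"
  by (auto simp: list_all_iff intro: refutable.intros)

lemma no_deps: "list_all refutable []"
  by simp

lemma dep: "refutable c \<Longrightarrow> list_all refutable cs \<Longrightarrow> list_all refutable (c # cs)"
  by simp

section \<open>Refuted configurations\<close>

lemma r0: "refutable (cfg [[], [A], [A,A], [U,U,U]] [0])"
  \<comment> \<open>Here and below, vertex 0 is the centre. The matching is 12, and vertex 3 covers
    the remaining neighbourhood edges.\<close>
  by (rule refutableI[OF no_deps, where t = "Reduce [(0,1,2)] [(1,2), (0,3)] []"]) code_simp

text \<open>Matching 12, 34; the ends 1 and 2 cover the four possible edges between the two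
  pairs.\<close>

lemma r1: "refutable (cfg [[], [A], [A,A], [A,U,U], [A,U,U,A]] [0])"
  by (rule refutableI[OF no_deps, where t = "Reduce [(0,1,2), (0,3,4)] [(0,1), (0,2), (1,2),
    (3,4)] []"]) code_simp

lemma r2: "refutable (cfg [[], [A], [A,U], [A,A,U], [A,U,U,N]] [0])"
  by (rule refutableI[OF dep[OF r1 no_deps], where t = "Split 2 3 (Split 1 4 (Use 0 [0,1,4,2,3])
    (Reduce [(0,1,3)] [(0,2), (1,3)] [])) (Reduce [(0,1,3)] [(0,1), (1,3)] [])"]) code_simp

lemma r3: "refutable (cfg [[], [A], [A,A], [A,U,U], [A,U,U,U]] [0])"
  by (rule refutableI[OF dep[OF r1 dep[OF r2 no_deps]], where t = "Split 3 4 (Use 0 [0,1,2,3,4])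
    (Split 1 3 (Use 1 [0,1,2,3,4]) (Use 1 [0,2,4,1,3]))"]) code_simp

section \<open>Centre of degree 5\<close>

lemma r4: "refutable (cfg [[], [A], [A,A], [A,A,A], [A,A,A,U], [U,A,A,A,A], [U,A,A,U,N,U]] [0])"
  by (rule refutableI[OF no_deps, where t = "Reduce [(1,2,6), (0,1,3), (1,4,5), (0,2,4), (2,3,5)]
    [(0,1), (0,2), (1,2), (3,4), (3,5), (4,5), (3,6), (5,6)] [1,2]"]) code_simp

lemma r5: "refutable (cfg [[], [A], [A,A], [A,A,A], [A,A,A,A], [U,A,A,A,A], [U,A,A,U,U,U]] [0])"
  by (rule refutableI[OF dep[OF r4 no_deps], where t = "Split 3 6 (Split 4 6 (Reduce [(1,2,6),
    (3,4,6), (0,1,3), (1,4,5), (0,2,4), (2,3,5)] [(0,1), (0,2), (1,2), (3,4), (3,5), (4,5), (3,6),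
    (4,6), (5,6)] [1,2]) (Use 0 [0,1,2,3,4,5,6])) (Use 0 [0,1,2,4,3,5,6])"]) code_simp

text \<open>The K_6 on 0,...,5 carries four edge-disjoint triangles. If 6 is adjacent to none of
  2,...,5, the sides {0,1} and {2,3,4,5} have 1 + 6 inner edges, and at most one edge leads from 1
  to an unnamed vertex: 8 in all.\<close>

lemma r6: "refutable (cfg [[], [A], [A,A], [A,A,A], [A,A,A,A], [A,A,A,A,A], [U,A,U,U,U,U]] [0])"
  by (rule refutableI[OF dep[OF r5 no_deps], where t = "Split 2 6 (Use 0 [0,1,2,3,4,5,6]) (Split 3
    6 (Use 0 [0,1,3,2,4,5,6]) (Split 4 6 (Use 0 [0,1,4,2,3,5,6]) (Split 5 6 (Use 0
    [0,1,5,2,3,4,6]) (Reduce [(0,1,2), (0,3,4), (1,3,5), (2,4,5)] [(0,1), (2,3), (2,4), (3,4),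
    (2,5), (3,5), (4,5)] [1]))))"]) code_simp

text \<open>With 45 this is K_6: either 1 is closed and the cut around {0,1} costs only 7, or 1 has
  a sixth neighbour as in \<open>r6\<close>. Without 45 there are still four triangles, against 6
  inner edges and at most two edges leaving at 1.\<close>

lemma r7: "refutable (cfg [[], [A], [A,A], [A,A,A], [A,A,A,A], [A,A,A,A,U]] [0])"
  by (rule refutableI[OF dep[OF r6 no_deps], where t = "Split 4 5 (Extend 1 (Reduce [(0,1,2),
    (0,3,4), (1,3,5), (2,4,5)] [(0,1), (2,3), (2,4), (3,4), (2,5), (3,5), (4,5)] []) (Use 0
    [0,1,2,3,4,5,6])) (Reduce [(0,1,4), (2,3,4), (0,2,5), (1,3,5)] [(0,1), (2,3), (2,4), (3,4),
    (2,5), (3,5)] [1])"]) code_simp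

text \<open>Matching 12, 34 with cover {1,2}; as 5 is adjacent to neither 3 nor 4, no edge at the
  matching escapes the cover.\<close>

lemma r8: "refutable (cfg [[], [A], [A,A], [A,U,U], [A,U,U,A], [U,U,U,N,N]] [0])"
  by (rule refutableI[OF no_deps, where t = "Reduce [(0,1,2), (0,3,4)] [(0,1), (0,2), (1,2),
    (3,4)] []"]) code_simp

lemma r9: "refutable (cfg [[], [A], [A,A], [A,A,A], [A,A,A,A], [A,A,A,U,U]] [0])"
  by (rule refutableI[OF dep[OF r7 dep[OF r8 no_deps]], where t = "Split 3 5 (Use 0 [0,1,2,3,4,5])
    (Split 4 5 (Use 0 [0,1,2,4,3,5]) (Use 1 [0,1,2,3,4,5]))"]) code_simp

lemma r10: "refutable (cfg [[], [A], [A,A], [A,A,A], [A,A,A,A], [A,A,U,U,U]] [0])"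
  by (rule refutableI[OF dep[OF r9 dep[OF r8 no_deps]], where t = "Split 2 5 (Use 0 [0,1,2,3,4,5])
    (Split 3 5 (Use 0 [0,1,3,2,4,5]) (Use 1 [0,1,4,2,3,5]))"]) code_simp

lemma r11: "refutable (cfg [[], [A], [A,A], [A,A,A], [A,A,A,A], [A,U,U,U,U]] [0])"
  by (rule refutableI[OF dep[OF r10 dep[OF r8 no_deps]], where t = "Split 1 5 (Use 0
    [0,1,2,3,4,5]) (Split 2 5 (Use 0 [0,2,1,3,4,5]) (Use 1 [0,3,4,1,2,5]))"]) code_simp

lemma r12: "refutable (cfg [[], [A], [A,U], [A,A,U], [A,U,A,N], [U,U,U,N,N]] [0])"
  by (rule refutableI[OF no_deps, where t = "Reduce [(0,1,3), (0,2,4)] [(0,1), (0,2), (1,3),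
    (2,4)] []"]) code_simp

lemma r13: "refutable (cfg [[], [A], [A,A], [A,A,A], [A,A,A,N], [A,A,U,U,U]] [0])"
  by (rule refutableI[OF dep[OF r11 dep[OF r12 dep[OF r8 no_deps]]], where t = "Split 2 5 (Split 3
    5 (Use 0 [0,1,2,3,5,4]) (Split 4 5 (Use 0 [0,1,2,4,5,3]) (Use 1 [0,1,2,3,4,5]))) (Split 3 5
    (Split 4 5 (Reduce [(0,2,3), (1,2,4), (0,4,5), (1,3,5)] [(0,1), (2,3), (2,4), (3,5), (4,5)]
    [1]) (Use 2 [0,1,3,2,4,5])) (Use 2 [0,1,4,2,3,5]))"]) code_simp

lemma r14: "refutable (cfg [[], [A], [A,A], [A,U,U], [U,U,U,U], [A,N,N,A,U]] [0])"
  by (rule refutableI[OF no_deps, where t = "Reduce [(0,1,2), (0,3,5)] [(1,2), (0,3), (0,4),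
    (3,5)] []"]) code_simp

lemma r15: "refutable (cfg [[], [A], [A,A], [A,A,A], [A,A,A,U], [A,U,U,U,U]] [0])"
  by (rule refutableI[OF dep[OF r11 dep[OF r13 dep[OF r14 dep[OF r8 no_deps]]]], where t = "Split
    3 4 (Use 0 [0,1,2,3,4,5]) (Split 1 5 (Use 1 [0,1,2,3,4,5]) (Split 3 5 (Split 2 5 (Use 1
    [0,2,1,3,4,5]) (Use 2 [0,1,2,3,4,5])) (Use 3 [0,2,4,1,3,5])))"]) code_simp

lemma r16: "refutable (cfg [[], [A], [A,A], [A,A,A], [A,A,U,U], [A,U,U,U,U]] [0])"
  by (rule refutableI[OF dep[OF r15 dep[OF r14 no_deps]], where t = "Split 2 4 (Use 0
    [0,1,2,3,4,5]) (Split 3 4 (Use 0 [0,1,3,2,4,5]) (Use 1 [0,2,3,1,5,4]))"]) code_simp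

lemma r17: "refutable (cfg [[], [A], [A,A], [U,U,U], [A,N,N,N], [A,U,U,U,U]] [0])"
  by (rule refutableI[OF dep[OF r14 no_deps], where t = "Split 4 5 (Use 0 [0,1,2,5,3,4]) (Bare 0
    4)"]) code_simp

lemma r18: "refutable (cfg [[], [A], [A,A], [A,A,A], [A,U,U,U], [A,U,U,U,U]] [0])"
  by (rule refutableI[OF dep[OF r16 dep[OF r17 no_deps]], where t = "Split 1 4 (Use 0
    [0,1,2,3,4,5]) (Split 2 4 (Use 0 [0,2,1,3,4,5]) (Split 3 4 (Use 0 [0,3,1,2,4,5]) (Use 1
    [0,1,2,3,4,5])))"]) code_simp

lemma r19: "refutable (cfg [[], [A], [A,A], [A,A,N], [A,A,U,U], [A,U,U,U,U]] [0])"
  by (rule refutableI[OF dep[OF r18 dep[OF r12 no_deps]], where t = "Split 2 4 (Use 0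
    [0,1,2,4,3,5]) (Split 2 5 (Split 3 4 (Use 0 [0,1,3,4,2,5]) (Use 1 [0,5,1,2,3,4])) (Reduce
    [(0,1,2)] [(0,1), (1,2)] []))"]) code_simp

lemma r20: "refutable (cfg [[], [A], [A,A], [A,A,U], [A,U,U,U], [A,U,U,U,U]] [0])"
  by (rule refutableI[OF dep[OF r18 dep[OF r19 dep[OF r14 dep[OF r12 dep[OF r17 no_deps]]]]],
    where t = "Split 2 3 (Use 0 [0,1,2,3,4,5]) (Split 1 4 (Use 1 [0,1,2,3,4,5]) (Split 1 5 (Use 1
    [0,1,2,3,5,4]) (Split 4 5 (Use 2 [0,4,5,2,3,1]) (Split 2 4 (Use 3 [0,3,2,1,4,5]) (Use 4
    [0,1,2,5,4,3])))))"]) code_simp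

lemma r21: "refutable (cfg [[], [A], [A,A], [A,U,U], [A,U,U,U], [A,U,U,U,U]] [0])"
  by (rule refutableI[OF dep[OF r20 dep[OF r14 dep[OF r17 no_deps]]], where t = "Split 1 3 (Use 0
    [0,1,2,3,4,5]) (Split 2 3 (Use 0 [0,2,1,3,4,5]) (Split 3 4 (Use 1 [0,1,2,4,5,3]) (Use 2
    [0,1,2,4,3,5])))"]) code_simp

text \<open>Since 01 lies in a triangle, 1 has a neighbour among 2,...,5, which is the case of
  \<open>r21\<close>. Degree 5 is thereby excluded altogether.\<close>

lemma r22: "refutable (cfg [[], [A], [A,U], [A,U,U], [A,U,U,U], [A,U,U,U,U]] [0])"
  by (rule refutableI[OF dep[OF r21 no_deps], where t = "Split 1 2 (Use 0 [0,1,2,3,4,5]) (Split 1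
    3 (Use 0 [0,1,3,2,4,5]) (Split 1 4 (Use 0 [0,1,4,2,3,5]) (Split 1 5 (Use 0 [0,1,5,2,3,4])
    (Bare 0 1))))"]) code_simp

section \<open>Centre of degree 6\<close>

lemma r23: "refutable (cfg [[], [A], [A,A], [A,A,A], [A,A,A,A], [A,A,A,A,N], [A,A,U,U,U,U]] [0])"
  by (rule refutableI[OF no_deps, where t = "Split 2 6 (Reduce [(0,1,6), (0,2,4), (0,3,5),
    (1,3,4), (1,2,5)] [(0,1), (0,2), (1,2), (3,4), (3,5), (3,6), (4,6), (5,6)] [1,2]) (Reduce
    [(0,1,6), (0,2,4), (0,3,5), (1,3,4), (1,2,5)] [(0,1), (2,3), (2,4), (3,4), (2,5), (3,5),
    (3,6), (4,6), (5,6)] [1])"]) code_simp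

text \<open>Matching 12, 35, 46 with cover {3,4,5}: the cover misses only edges among 1, 2 and 6, of
  which 12 is in the matching and the others are absent.\<close>

lemma r24: "refutable (cfg [[], [A], [A,A], [A,U,U], [A,U,U,U], [A,U,U,A,U], [A,N,N,U,A,U]] [0])"
  by (rule refutableI[OF no_deps, where t = "Reduce [(0,1,2), (0,3,5), (0,4,6)] [(1,2), (0,3),
    (0,4), (0,5), (3,5), (4,6)] []"]) code_simp

lemma r25: "refutable (cfg [[], [A], [A,U], [A,U,A], [A,A,U,U], [A,U,U,U,N], [A,N,N,N,N,U]] [0])"
  by (rule refutableI[OF dep[OF r24 no_deps], where t = "Split 5 6 (Use 0 [0,5,6,2,1,3,4]) (Bare 0
    6)"]) code_simp

lemma r26: "refutable (cfg [[], [A], [A,A], [A,U,A], [A,A,U,U], [A,U,U,A,N], [A,N,N,N,U,U]] [0])"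
  by (rule refutableI[OF dep[OF r24 dep[OF r25 no_deps]], where t = "Split 4 6 (Use 0
    [0,1,2,3,4,5,6]) (Use 1 [0,1,2,3,4,5,6])"]) code_simp

lemma r27: "refutable (cfg [[], [A], [A,A], [A,A,A], [A,A,A,A], [A,A,A,A,U], [A,U,U,U,U,U]] [0])"
  by (rule refutableI[OF dep[OF r6 dep[OF r23 dep[OF r26 no_deps]]], where t = "Split 4 5 (Split 1
    6 (Use 0 [0,1,2,3,4,5,6]) (Split 2 6 (Use 0 [0,2,1,3,4,5,6]) (Split 3 6 (Use 0
    [0,3,1,2,4,5,6]) (Split 4 6 (Use 0 [0,4,1,2,3,5,6]) (Split 5 6 (Use 0 [0,5,1,2,3,4,6]) (Bare 0
    6)))))) (Split 1 6 (Use 1 [0,1,2,3,4,5,6]) (Split 2 6 (Use 1 [0,2,1,3,4,5,6]) (Split 3 6 (Use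
    1 [0,3,1,2,4,5,6]) (Use 2 [0,1,2,3,4,5,6]))))"]) code_simp

lemma r28: "refutable (cfg [[], [A], [A,A], [A,U,U], [A,U,A,A], [A,A,U,N,N], [A,U,U,A,U,U]] [0])"
  by (rule refutableI[OF dep[OF r24 no_deps], where t = "Split 5 6 (Use 0 [0,3,4,1,6,2,5]) (Use 0
    [0,3,6,2,1,4,5])"]) code_simp

lemma r29: "refutable (cfg [[], [A], [A,A], [A,U,A], [A,U,A,A], [A,A,U,N,N], [A,N,U,U,U,U]] [0])"
  by (rule refutableI[OF dep[OF r24 dep[OF r28 dep[OF r26 no_deps]]], where t = "Split 2 6 (Use 0
    [0,3,4,2,1,6,5]) (Split 3 6 (Use 1 [0,1,2,3,4,5,6]) (Use 2 [0,1,2,3,5,4,6]))"]) code_simp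

lemma r30: "refutable (cfg [[], [A], [A,A], [A,U,A], [A,U,A,A], [A,A,A,N,N], [A,U,U,U,U,U]] [0])"
  by (rule refutableI[OF dep[OF r24 dep[OF r29 no_deps]], where t = "Split 1 6 (Use 0
    [0,3,4,1,2,6,5]) (Use 1 [0,1,2,3,4,5,6])"]) code_simp

lemma r31: "refutable (cfg [[], [A], [A,A], [A,A,A], [A,A,A,A], [A,A,A,U,U], [A,U,U,U,U,U]] [0])"
  by (rule refutableI[OF dep[OF r27 dep[OF r30 no_deps]], where t = "Split 3 5 (Use 0
    [0,1,2,3,4,5,6]) (Split 4 5 (Use 0 [0,1,2,4,3,5,6]) (Use 1 [0,1,2,3,4,5,6]))"]) code_simp

text \<open>In the neighbourhood of the centre, 5 is a leaf attached to 1: two deletions, 01 and 15,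
  leave 05 without a triangle.\<close>

lemma r32: "refutable (cfg [[], [A], [U,U], [U,U,U], [U,U,U,U], [A,A,N,N,N], [U,U,U,U,U,N]] [0])"
  by (rule refutableI[OF no_deps, where t = "Reduce [(0,1,5)] [(0,1), (1,5)] []"]) code_simp

lemma r33: "refutable (cfg [[], [A], [A,A], [A,A,A], [A,U,U,U], [A,A,N,N,N], [A,A,U,U,U,U]] [0])"
  by (rule refutableI[OF dep[OF r30 dep[OF r32 no_deps]], where t = "Split 5 6 (Use 0
    [0,6,1,2,3,5,4]) (Use 1 [0,1,2,3,4,5,6])"]) code_simp

lemma r34: "refutable (cfg [[], [A], [A,A], [A,A,A], [A,A,A,A], [A,A,U,U,U], [A,U,U,U,U,U]] [0])"
  by (rule refutableI[OF dep[OF r31 dep[OF r33 dep[OF r29 no_deps]]], where t = "Split 2 5 (Use 0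
    [0,1,2,3,4,5,6]) (Split 3 5 (Use 0 [0,1,3,2,4,5,6]) (Split 1 6 (Split 4 5 (Use 0
    [0,1,4,2,3,5,6]) (Use 1 [0,1,2,3,4,5,6])) (Use 2 [0,1,4,2,3,5,6])))"]) code_simp

lemma r35: "refutable (cfg [[], [A], [A,A], [A,A,A], [A,A,A,A], [A,U,U,U,U], [A,U,U,U,U,U]] [0])"
  by (rule refutableI[OF dep[OF r34 dep[OF r25 no_deps]], where t = "Split 1 5 (Use 0
    [0,1,2,3,4,5,6]) (Split 2 5 (Use 0 [0,2,1,3,4,5,6]) (Split 3 5 (Use 0 [0,3,1,2,4,5,6]) (Split
    4 5 (Use 0 [0,4,1,2,3,5,6]) (Split 1 6 (Use 0 [0,1,2,3,4,6,5]) (Use 1 [0,2,3,4,1,6,5])))))"])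
    code_simp

lemma r36: "refutable (cfg [[], [A], [A,U], [A,U,U], [A,A,U,N], [A,U,A,N,N], [A,U,U,A,U,U]] [0])"
  by (rule refutableI[OF no_deps, where t = "Reduce [(0,1,4), (0,2,5), (0,3,6)] [(0,1), (0,2),
    (1,4), (2,5), (0,6), (3,6)] []"]) code_simp

lemma r37: "refutable (cfg [[], [A], [A,U], [A,A,U], [A,U,A,N], [U,U,U,N,N], [U,U,U,N,N,U]] [0])"
  by (rule refutableI[OF no_deps, where t = "Reduce [(0,1,3), (0,2,4)] [(0,1), (0,2), (1,3),
    (2,4)] []"]) code_simp

lemma r38: "refutable (cfg [[], [A], [A,U], [A,A,A], [A,U,A,N], [A,A,U,N,N], [A,U,U,N,U,U]] [0])"
  by (rule refutableI[OF dep[OF r36 dep[OF r37 no_deps]], where t = "Split 4 6 (Use 0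
    [0,6,1,3,4,5,2]) (Use 1 [0,1,2,3,4,5,6])"]) code_simp

lemma r39: "refutable (cfg [[], [A], [A,A], [A,A,A], [A,A,A,N], [A,A,N,A,A], [A,N,A,U,U,U]] [0])"
  by (rule refutableI[OF dep[OF r30 dep[OF r28 no_deps]], where t = "Split 3 6 (Split 4 6 (Reduce
    [(0,3,5), (1,4,5), (0,1,2), (0,4,6), (2,3,6)] [(1,2), (0,3), (0,4), (1,5), (2,6), (5,6)]
    [3,4]) (Use 0 [0,1,2,3,6,4,5])) (Use 1 [0,2,4,3,1,6,5])"]) code_simp

lemma r40: "refutable (cfg [[], [A], [A,A], [A,A,A], [A,A,U,U], [A,A,N,N,U], [A,U,U,U,U,U]] [0])"
  by (rule refutableI[OF dep[OF r24 dep[OF r33 no_deps]], where t = "Split 5 6 (Use 0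
    [0,2,3,1,6,4,5]) (Use 1 [0,1,2,3,6,5,4])"]) code_simp

lemma r41: "refutable (cfg [[], [A], [A,A], [A,A,A], [A,A,A,N], [A,A,U,U,U], [A,U,U,U,U,U]] [0])"
  by (rule refutableI[OF dep[OF r35 dep[OF r36 dep[OF r38 dep[OF r39 dep[OF r26 dep[OF r30 dep[OF
    r40 no_deps]]]]]]], where t = "Split 2 5 (Split 3 5 (Use 0 [0,1,2,3,5,4,6]) (Split 4 5 (Use 0
    [0,1,2,4,5,3,6]) (Split 3 6 (Use 1 [0,1,2,3,4,5,6]) (Use 2 [0,1,2,3,4,5,6])))) (Split 3 5
    (Split 4 5 (Split 1 6 (Reduce [(0,1,6), (0,2,3), (0,4,5), (1,2,4), (1,3,5)] [(0,1), (2,3),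
    (2,4), (3,5), (4,5), (2,6), (3,6), (4,6), (5,6)] [1]) (Split 2 6 (Use 3 [0,1,2,3,4,5,6])
    (Split 5 6 (Use 3 [0,1,5,3,4,2,6]) (Use 4 [0,2,1,5,3,4,6])))) (Use 5 [0,2,1,3,5,4,6])) (Use 6
    [0,1,2,3,4,5,6]))"]) code_simp

lemma r42: "refutable (cfg [[], [A], [A,A], [A,U,U], [U,U,U,U], [A,N,N,A,U], [U,N,N,U,U,N]] [0])"
  by (rule refutableI[OF no_deps, where t = "Reduce [(0,1,2), (0,3,5)] [(1,2), (0,3), (0,4),
    (3,5)] []"]) code_simp

lemma r43: "refutable (cfg [[], [A], [A,A], [A,A,U], [A,U,A,U], [A,N,N,U,U], [A,N,N,U,U,U]] [0])"
  by (rule refutableI[OF dep[OF r24 dep[OF r42 dep[OF r25 no_deps]]], where t = "Split 5 6 (Use 0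
    [0,5,6,2,3,4,1]) (Split 3 5 (Use 1 [0,1,2,3,4,5,6]) (Split 4 5 (Use 1 [0,1,2,4,3,5,6]) (Use 2
    [0,3,2,4,1,6,5])))"]) code_simp

lemma r44: "refutable (cfg [[], [A], [A,A], [A,A,A], [A,A,A,U], [A,U,U,U,U], [A,U,U,U,U,U]] [0])"
  by (rule refutableI[OF dep[OF r35 dep[OF r41 dep[OF r43 no_deps]]], where t = "Split 3 4 (Use 0
    [0,1,2,3,4,5,6]) (Split 1 5 (Use 1 [0,1,2,3,4,5,6]) (Split 2 5 (Use 1 [0,2,1,3,4,5,6]) (Split
    1 6 (Use 1 [0,1,2,3,4,6,5]) (Split 2 6 (Use 1 [0,2,1,3,4,6,5]) (Use 2 [0,1,2,3,4,5,6])))))"])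
    code_simp

lemma r45: "refutable (cfg [[], [A], [A,A], [A,A,A], [A,A,U,U], [A,N,A,U,U], [A,N,U,U,U,N]] [0])"
  by (rule refutableI[OF dep[OF r44 dep[OF r36 dep[OF r43 no_deps]]], where t = "Split 3 5 (Use 0
    [0,2,3,1,5,4,6]) (Split 3 6 (Use 1 [0,2,3,1,5,6,4]) (Use 2 [0,1,3,4,2,5,6]))"]) code_simp

lemma r46: "refutable (cfg [[], [A], [A,A], [A,A,A], [A,A,U,U], [A,U,U,U,U], [A,U,U,U,U,U]] [0])"
  by (rule refutableI[OF dep[OF r44 dep[OF r40 dep[OF r24 dep[OF r45 dep[OF r43 no_deps]]]]],
    where t = "Split 2 4 (Use 0 [0,1,2,3,4,5,6]) (Split 3 4 (Use 0 [0,1,3,2,4,5,6]) (Split 1 5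
    (Use 1 [0,1,2,3,5,4,6]) (Split 1 6 (Use 1 [0,1,2,3,6,4,5]) (Split 5 6 (Use 2 [0,5,6,2,4,3,1])
    (Split 2 5 (Use 3 [0,1,2,3,4,5,6]) (Split 2 6 (Use 3 [0,1,2,3,4,6,5]) (Use 4
    [0,1,2,4,3,5,6])))))))"]) code_simp

lemma r47: "refutable (cfg [[], [A], [A,A], [U,U,U], [A,N,N,N], [A,N,N,U,U], [A,U,U,U,U,U]] [0])"
  by (rule refutableI[OF dep[OF r42 no_deps], where t = "Split 4 5 (Reduce [(0,1,2), (0,4,5)]
    [(1,2), (0,3), (4,5), (0,6)] []) (Split 4 6 (Use 0 [0,1,2,6,3,4,5]) (Bare 0 4))"]) code_simp

lemma r48: "refutable (cfg [[], [A], [A,A], [A,A,A], [A,U,U,U], [A,U,U,U,U], [A,U,U,U,U,U]] [0])"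
  by (rule refutableI[OF dep[OF r46 dep[OF r47 no_deps]], where t = "Split 1 4 (Use 0
    [0,1,2,3,4,5,6]) (Split 2 4 (Use 0 [0,2,1,3,4,5,6]) (Split 3 4 (Use 0 [0,3,1,2,4,5,6]) (Split
    1 5 (Use 0 [0,1,2,3,5,4,6]) (Split 2 5 (Use 0 [0,2,1,3,5,4,6]) (Use 1 [0,1,2,3,4,5,6])))))"])
    code_simp

lemma r49: "refutable (cfg [[], [A], [A,U], [A,A,N], [A,A,N,N], [A,U,A,U,U], [A,U,U,U,U,U]] [0])"
  by (rule refutableI[OF dep[OF r36 dep[OF r38 dep[OF r32 no_deps]]], where t = "Split 3 6 (Use 0
    [0,6,1,2,3,4,5]) (Split 3 5 (Use 1 [0,1,5,3,2,4,6]) (Use 2 [0,1,2,4,5,3,6]))"]) code_simp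

lemma r50: "refutable (cfg [[], [A], [A,A], [A,A,N], [A,A,U,U], [A,U,U,U,U], [A,U,U,U,U,U]] [0])"
  \<comment> \<open>The pair 24 is split twice. The second time \<open>put\<close> overwrites the
    \<open>N\<close> by \<open>A\<close>, and that branch is refuted by the same triangle pattern
    \<open>r48\<close>.\<close>
  by (rule refutableI[OF dep[OF r48 dep[OF r49 dep[OF r37 dep[OF r32 no_deps]]]], where t = "Split
    2 4 (Use 0 [0,1,2,4,3,5,6]) (Split 3 4 (Use 0 [0,1,3,4,2,5,6]) (Split 2 5 (Use 1
    [0,1,2,3,4,5,6]) (Split 3 5 (Use 1 [0,1,3,2,4,5,6]) (Split 2 4 (Use 0 [0,1,2,4,3,5,6]) (Split
    2 6 (Split 3 4 (Use 0 [0,1,3,4,2,5,6]) (Use 2 [0,6,1,2,3,5,4])) (Use 3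
    [0,1,3,5,4,2,6]))))))"]) code_simp

lemma r51: "refutable (cfg [[], [A], [A,A], [A,A,U], [A,N,A,U], [A,N,U,U,U], [A,N,U,U,U,U]] [0])"
  by (rule refutableI[OF dep[OF r50 dep[OF r43 no_deps]], where t = "Split 2 5 (Use 0
    [0,2,1,4,5,3,6]) (Split 2 6 (Use 0 [0,2,1,4,6,3,5]) (Use 1 [0,1,2,3,4,5,6]))"]) code_simp

lemma r52: "refutable (cfg [[], [A], [A,A], [A,A,U], [A,U,U,U], [A,U,U,U,U], [A,U,U,U,U,U]] [0])"
  by (rule refutableI[OF dep[OF r48 dep[OF r50 dep[OF r51 dep[OF r47 no_deps]]]], where t = "Split
    2 3 (Use 0 [0,1,2,3,4,5,6]) (Split 1 4 (Use 1 [0,1,2,3,4,5,6]) (Split 1 5 (Use 1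
    [0,1,2,3,5,4,6]) (Split 1 6 (Use 1 [0,1,2,3,6,4,5]) (Split 2 4 (Use 2 [0,1,2,3,4,5,6]) (Split
    3 4 (Use 2 [0,1,3,2,4,5,6]) (Split 2 5 (Use 2 [0,1,2,3,5,4,6]) (Use 3
    [0,1,2,3,4,5,6])))))))"]) code_simp

lemma r53: "refutable (cfg [[], [A], [A,A], [A,U,U], [A,U,U,U], [A,U,U,U,U], [A,U,U,U,U,U]] [0])"
  by (rule refutableI[OF dep[OF r52 dep[OF r42 dep[OF r47 no_deps]]], where t = "Split 1 3 (Use 0
    [0,1,2,3,4,5,6]) (Split 2 3 (Use 0 [0,2,1,3,4,5,6]) (Split 1 4 (Use 0 [0,1,2,4,3,5,6]) (Split
    2 4 (Use 0 [0,2,1,4,3,5,6]) (Split 3 5 (Split 3 4 (Use 0 [0,3,4,5,1,2,6]) (Use 1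
    [0,1,2,5,6,3,4])) (Use 2 [0,1,2,5,3,4,6])))))"]) code_simp

text \<open>Excludes degree 6 altogether. The degree-7 part also applies it around other vertices,
  to conclude that six named neighbours cannot be all.\<close>

lemma r54: "refutable (cfg [[], [A], [A,U], [A,U,U], [A,U,U,U], [A,U,U,U,U], [A,U,U,U,U,U]] [0])"
  by (rule refutableI[OF dep[OF r53 no_deps], where t = "Split 1 2 (Use 0 [0,1,2,3,4,5,6]) (Split
    1 3 (Use 0 [0,1,3,2,4,5,6]) (Split 1 4 (Use 0 [0,1,4,2,3,5,6]) (Split 1 5 (Use 0
    [0,1,5,2,3,4,6]) (Split 1 6 (Use 0 [0,1,6,2,3,4,5]) (Bare 0 1)))))"]) code_simp

section \<open>Centre of degree 7: four pairwise adjacent neighbours\<close>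

lemma r55: "refutable (cfg [[], [A], [A,A], [A,A,A], [A,A,A,A], [A,A,A,A,U], [A,A,A,A,U,N],
    [A,A,U,U,U,U,U]] [])"
  \<comment> \<open>Six triangles pay for 12 edges. With 27, the vertices 0, 1, 2 have all seven
    neighbours named, and 3 + 9 edges lie inside the sides of the cut around them. Without 27, the
    side {0,1,3} gives 3 + 8 inner edges and at most one edge leaving at 3.\<close>
  by (rule refutableI[OF no_deps, where t = "Split 2 7 (Reduce [(0,1,7), (0,2,5), (0,3,4),
    (1,3,5), (2,3,6), (1,2,4)] [(0,1), (0,2), (1,2), (3,4), (3,5), (4,5), (3,6), (4,6), (3,7),
    (4,7), (5,7), (6,7)] []) (Reduce [(0,1,7), (0,2,5), (0,3,4), (1,3,5), (2,3,6), (1,2,4)]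
    [(0,1), (0,3), (1,3), (2,4), (2,5), (4,5), (2,6), (4,6), (4,7), (5,7), (6,7)] [3])"])
    code_simp

text \<open>With 56 the vertices 0,...,6 span a K_7. If 17 is missing, the packing is a Fano plane
  on them and the cut around {0,2,3} costs 12 + 2. If 17 is an edge, seven other triangles, one of
  them 017, pay for the cut around {0,1,2} at cost 13 + 1.\<close>

lemma r56: "refutable (cfg [[], [A], [A,A], [A,A,A], [A,A,A,A], [A,A,A,A,A], [A,A,A,A,A,U],
    [A,U,U,U,U,U,U]] [])"
  by (rule refutableI[OF dep[OF r55 no_deps], where t = "Split 5 6 (Split 1 7 (Reduce [(0,1,7),
    (0,2,3), (0,4,5), (1,2,4), (2,5,6), (1,3,5), (3,4,6)] [(0,1), (0,2), (1,2), (3,4), (3,5),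
    (4,5), (3,6), (4,6), (5,6), (3,7), (4,7), (5,7), (6,7)] [2]) (Reduce [(0,1,2), (0,3,4),
    (0,5,6), (1,3,5), (1,4,6), (2,3,6), (2,4,5)] [(0,2), (0,3), (2,3), (1,4), (1,5), (4,5), (1,6),
    (4,6), (5,6), (4,7), (5,7), (6,7)] [2,3])) (Split 1 7 (Use 0 [0,1,2,3,4,5,6,7]) (Split 2 7
    (Use 0 [0,2,1,3,4,5,6,7]) (Reduce [(0,1,5), (2,3,5), (0,2,4), (0,3,6), (1,2,6), (1,3,4)]
    [(1,2), (0,3), (0,4), (3,4), (1,5), (2,5), (1,6), (2,6), (5,7), (6,7)] [3,4])))"]) code_simp

lemma r57: "refutable (cfg [[], [A], [A,A], [A,A,A], [A,A,A,A], [A,A,A,A,U], [A,A,A,A,N,N],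
    [A,U,U,U,U,U,U]] [])"
  by (rule refutableI[OF dep[OF r55 no_deps], where t = "Split 1 7 (Use 0 [0,1,2,3,5,4,6,7])
    (Reduce [(0,1,6), (2,3,6), (0,2,4), (0,3,5), (1,2,5), (1,3,4)] [(0,2), (0,3), (2,3), (1,4),
    (1,5), (4,5), (1,6), (4,7), (5,7), (6,7)] [2,3])"]) code_simp

lemma r58: "refutable (cfg [[], [A], [A,A], [A,A,A], [A,A,A,A], [A,A,A,A,A], [A,A,A,A,U,U],
    [A,U,U,U,U,U,U]] [])"
  by (rule refutableI[OF dep[OF r56 dep[OF r57 no_deps]], where t = "Split 4 6 (Use 0
    [0,1,2,3,4,5,6,7]) (Split 5 6 (Use 0 [0,1,2,3,5,4,6,7]) (Use 1 [0,1,2,3,4,5,6,7]))"])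
    code_simp

lemma r59: "refutable (cfg [[], [A], [A,A], [A,A,A], [A,A,A,A], [A,A,A,A,U], [A,A,A,N,N,N],
    [A,U,U,A,U,U,U]] [])"
  by (rule refutableI[OF no_deps, where t = "Reduce [(0,3,7), (1,2,6), (0,1,4), (0,2,5), (1,3,5),
    (2,3,4)] [(0,1), (0,2), (1,2), (3,4), (3,5), (4,5), (3,7), (4,7), (5,7), (6,7)] [1,2]"])
    code_simp

lemma r60: "refutable (cfg [[], [A], [A,A], [A,A,A], [A,A,A,A], [A,A,A,A,A], [A,A,A,U,U,U],
    [A,U,U,U,U,U,U]] [])"
  by (rule refutableI[OF dep[OF r58 dep[OF r59 no_deps]], where t = "Split 3 6 (Use 0
    [0,1,2,3,4,5,6,7]) (Split 4 6 (Use 0 [0,1,2,4,3,5,6,7]) (Split 5 6 (Use 0 [0,1,2,5,3,4,6,7])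
    (Split 3 7 (Use 1 [0,1,2,3,4,5,6,7]) (Split 4 7 (Use 1 [0,1,2,4,3,5,6,7]) (Reduce [(0,1,6),
    (0,2,3), (0,4,5), (1,2,4), (1,3,5)] [(0,1), (0,2), (1,2), (3,4), (3,5), (4,5), (5,7), (6,7)]
    [1,2])))))"]) code_simp

text \<open>Matching 14, 23, 67 with cover {1,4,5}; edges that it misses would join {2,3} to {6,7},
  and these are absent.\<close>

lemma r61: "refutable (cfg [[], [A], [A,U], [A,U,A], [A,A,U,U], [A,U,U,U,U], [A,U,N,N,U,U],
    [A,U,N,N,U,U,A]] [])"
  by (rule refutableI[OF no_deps, where t = "Reduce [(0,1,4), (0,2,3), (0,6,7)] [(0,1), (2,3),
    (0,4), (1,4), (0,5), (6,7)] []"]) code_simp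

lemma r62: "refutable (cfg [[], [A], [A,A], [A,A,A], [A,A,A,A], [A,A,A,A,A], [A,U,N,N,U,U],
    [A,A,U,U,U,U,A]] [])"
  by (rule refutableI[OF dep[OF r60 dep[OF r61 no_deps]], where t = "Split 2 7 (Use 0
    [0,1,2,3,4,5,7,6]) (Split 3 7 (Use 0 [0,1,3,2,4,5,7,6]) (Use 1 [0,1,2,3,4,5,6,7]))"])
    code_simp

lemma r63: "refutable (cfg [[], [A], [A,U], [A,U,U], [A,U,U,U], [A,U,U,U,U], [A,A,N,N,N,N],
    [A,U,U,U,U,U,N]] [])"
  by (rule refutableI[OF no_deps, where t = "Reduce [(0,1,6)] [(0,1), (1,6)] []"]) code_simp

lemma r64: "refutable (cfg [[], [A], [A,A], [A,A,A], [A,A,A,A], [A,A,A,A,A], [A,A,U,U,U,U],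
    [A,U,U,U,U,U,U]] [])"
  by (rule refutableI[OF dep[OF r60 dep[OF r62 dep[OF r63 no_deps]]], where t = "Split 2 6 (Use 0
    [0,1,2,3,4,5,6,7]) (Split 3 6 (Use 0 [0,1,3,2,4,5,6,7]) (Split 4 6 (Use 0 [0,1,4,2,3,5,6,7])
    (Split 5 6 (Use 0 [0,1,5,2,3,4,6,7]) (Split 6 7 (Split 2 7 (Use 1 [0,2,3,4,1,5,6,7]) (Split 3
    7 (Use 1 [0,3,2,4,1,5,6,7]) (Use 1 [0,1,2,3,4,5,7,6]))) (Use 2 [0,1,2,3,4,5,6,7])))))"])
    code_simp

text \<open>Within the neighbourhood, 6 can only see 7. Without 67 the edge 06 lies in no triangle;
  with it, 6 is a leaf attached to 7, as in \<open>r63\<close>.\<close>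

lemma r65: "refutable (cfg [[], [A], [A,U], [A,U,U], [A,U,U,U], [A,U,U,U,U], [A,N,N,N,N,N],
    [A,U,U,U,U,U,U]] [])"
  by (rule refutableI[OF dep[OF r63 no_deps], where t = "Split 6 7 (Use 0 [0,7,1,2,3,4,6,5]) (Bare
    0 6)"]) code_simp

lemma r66: "refutable (cfg [[], [A], [A,A], [A,A,A], [A,A,A,A], [A,A,A,A,A], [A,U,U,U,U,U],
    [A,U,U,U,U,U,U]] [])"
  by (rule refutableI[OF dep[OF r64 dep[OF r65 no_deps]], where t = "Split 1 6 (Use 0
    [0,1,2,3,4,5,6,7]) (Split 2 6 (Use 0 [0,2,1,3,4,5,6,7]) (Split 3 6 (Use 0 [0,3,1,2,4,5,6,7])
    (Split 4 6 (Use 0 [0,4,1,2,3,5,6,7]) (Split 5 6 (Use 0 [0,5,1,2,3,4,6,7]) (Use 1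
    [0,1,2,3,4,5,6,7])))))"]) code_simp

lemma r67: "refutable (cfg [[], [A], [A,A], [A,A,A], [A,A,A,U], [A,A,A,A,N], [A,A,A,N,A,A],
    [A,A,U,U,U,U,U]] [])"
  by (rule refutableI[OF no_deps, where t = "Reduce [(0,1,7), (0,2,3), (0,4,6), (1,2,4), (1,3,5),
    (2,5,6)] [(0,1), (0,2), (1,2), (3,4), (3,5), (4,6), (5,6), (3,7), (4,7), (5,7), (6,7)] [2]"])
    code_simp

lemma r68: "refutable (cfg [[], [A], [A,A], [A,A,A], [A,A,A,A], [A,A,A,A,N], [A,A,A,N,A,A],
    [A,N,N,A,U,U,U]] [])"
  by (rule refutableI[OF no_deps, where t = "Reduce [(0,3,7), (1,3,4), (2,3,5), (0,2,4), (1,2,6),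
    (0,1,5)] [(1,2), (0,3), (1,4), (2,4), (1,5), (2,5), (0,6), (4,7), (5,7)] [3,6]"]) code_simp

lemma r69: "refutable (cfg [[], [A], [A,A], [A,A,A], [A,A,A,A], [A,A,A,A,N], [A,A,A,N,U,N],
    [A,U,U,A,U,U,U]] [])"
  by (rule refutableI[OF no_deps, where t = "Reduce [(0,3,7), (0,1,5), (2,3,5), (1,3,4), (1,2,6),
    (0,2,4)] [(0,1), (0,2), (1,2), (3,4), (3,5), (4,6), (3,7), (4,7), (5,7), (6,7)] [1,2]"])
    code_simp

lemma r70: "refutable (cfg [[], [A], [A,A], [A,A,A], [A,A,A,A], [A,A,A,A,N], [A,A,A,N,A,U],
    [A,U,U,U,U,U,U]] [])"
  by (rule refutableI[OF dep[OF r67 dep[OF r68 dep[OF r65 dep[OF r69 no_deps]]]], where t = "Split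
    5 6 (Split 1 7 (Use 0 [0,1,2,3,4,5,6,7]) (Split 2 7 (Use 0 [0,2,1,5,6,3,4,7]) (Split 3 7 (Use
    1 [0,1,2,3,4,5,6,7]) (Split 4 7 (Use 1 [0,1,2,4,3,6,5,7]) (Split 5 7 (Use 1 [0,1,2,5,3,6,4,7])
    (Use 2 [0,1,2,3,4,5,7,6])))))) (Split 3 7 (Use 3 [0,1,2,3,4,5,6,7]) (Split 4 7 (Use 3
    [0,1,2,4,3,6,5,7]) (Reduce [(0,1,5), (2,3,5), (0,3,4), (0,2,6), (1,2,4)] [(0,1), (0,2), (1,2),
    (3,4), (3,5), (4,6), (5,7), (6,7)] [1,2])))"]) code_simp

lemma r71: "refutable (cfg [[], [A], [A,A], [A,A,A], [A,A,A,A], [A,A,A,A,N], [A,A,A,U,U,U],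
    [A,U,U,U,U,U,U]] [])"
  by (rule refutableI[OF dep[OF r66 dep[OF r57 dep[OF r70 dep[OF r69 no_deps]]]], where t = "Split
    3 6 (Split 4 6 (Use 0 [0,1,2,3,4,6,5,7]) (Use 1 [0,1,2,3,5,6,4,7])) (Split 4 6 (Use 2
    [0,1,2,3,4,5,6,7]) (Split 5 6 (Use 2 [0,1,2,3,5,4,6,7]) (Split 3 7 (Use 3 [0,1,2,3,5,4,6,7])
    (Reduce [(0,1,6), (0,2,4), (0,3,5), (1,3,4), (1,2,5)] [(0,1), (0,2), (1,2), (3,4), (3,5),
    (4,7), (5,7), (6,7)] [1,2]))))"]) code_simp

lemma r72: "refutable (cfg [[], [A], [A,U], [A,U,A], [A,A,U,U], [A,U,U,U,U], [A,U,N,N,U,A],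
    [A,U,N,N,U,U,U]] [])"
  by (rule refutableI[OF dep[OF r61 no_deps], where t = "Split 6 7 (Use 0 [0,1,2,3,4,5,6,7])
    (Reduce [(0,1,4), (0,2,3), (0,5,6)] [(0,1), (2,3), (0,4), (1,4), (0,5), (5,6)] [])"])
    code_simp

lemma r73: "refutable (cfg [[], [A], [A,A], [A,A,A], [A,A,A,A], [A,A,A,A,N], [A,A,U,N,A,A],
    [A,U,A,U,U,U,U]] [])"
  by (rule refutableI[OF dep[OF r71 no_deps], where t = "Split 3 7 (Use 0 [0,2,3,1,4,5,7,6])
    (Reduce [(0,2,7), (1,2,4), (2,3,5), (0,1,3), (0,4,6), (1,5,6)] [(0,1), (0,2), (1,2), (3,4),
    (3,5), (4,6), (5,6), (4,7), (5,7), (6,7)] [1,2])"]) code_simp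

lemma r74: "refutable (cfg [[], [A], [A,A], [A,A,A], [A,A,A,A], [A,A,A,A,N], [A,A,N,N,A,A],
    [A,U,U,U,U,U,U]] [])"
  by (rule refutableI[OF dep[OF r73 dep[OF r72 no_deps]], where t = "Split 2 7 (Use 0
    [0,1,2,3,4,5,6,7]) (Split 3 7 (Use 0 [0,1,3,2,4,5,6,7]) (Use 1 [0,1,2,3,5,4,6,7]))"])
    code_simp

lemma r75: "refutable (cfg [[], [A], [A,A], [A,A,A], [A,A,A,A], [A,A,A,A,N], [A,A,U,N,U,N],
    [A,N,A,U,U,U,U]] [])"
  by (rule refutableI[OF dep[OF r71 dep[OF r74 dep[OF r72 no_deps]]], where t = "Split 3 7 (Use 0
    [0,2,3,1,4,5,7,6]) (Split 5 7 (Split 4 7 (Use 1 [0,2,1,3,4,5,7,6]) (Reduce [(0,1,6), (0,2,4),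
    (0,3,5), (1,3,4), (1,2,5)] [(0,1), (0,2), (1,2), (3,4), (3,5), (4,6), (5,7), (6,7)] [1,2]))
    (Use 2 [0,2,3,5,4,1,6,7]))"]) code_simp

lemma r76: "refutable (cfg [[], [A], [A,A], [A,A,A], [A,A,A,A], [A,A,A,A,N], [A,A,N,N,A,U],
    [A,U,U,U,U,U,U]] [])"
  by (rule refutableI[OF dep[OF r74 dep[OF r71 dep[OF r72 dep[OF r75 no_deps]]]], where t = "Split
    5 6 (Use 0 [0,1,2,3,4,5,6,7]) (Split 1 7 (Split 2 7 (Use 1 [0,1,2,3,5,4,7,6]) (Split 3 7 (Use
    1 [0,1,3,2,5,4,7,6]) (Use 2 [0,1,2,3,5,4,6,7]))) (Split 2 7 (Use 3 [0,1,2,3,4,5,6,7]) (Split 3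
    7 (Use 3 [0,1,3,2,4,5,6,7]) (Use 2 [0,1,2,3,5,4,6,7]))))"]) code_simp

lemma r77: "refutable (cfg [[], [A], [A,A], [A,A,A], [A,A,A,A], [A,A,A,A,N], [A,A,U,U,U,U],
    [A,U,U,U,U,U,U]] [])"
  by (rule refutableI[OF dep[OF r71 dep[OF r76 dep[OF r75 dep[OF r72 dep[OF r65 no_deps]]]]],
    where t = "Split 2 6 (Use 0 [0,1,2,3,4,5,6,7]) (Split 3 6 (Use 0 [0,1,3,2,4,5,6,7]) (Split 4 6
    (Use 1 [0,1,2,3,4,5,6,7]) (Split 5 6 (Use 1 [0,1,2,3,5,4,6,7]) (Split 6 7 (Split 1 7 (Split 2
    7 (Use 0 [0,1,2,3,4,5,7,6]) (Reduce [(0,1,6), (0,2,4), (0,3,5), (1,3,4), (1,2,5)] [(0,1),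
    (2,3), (2,4), (3,4), (2,5), (3,5), (3,7), (4,7), (5,7), (6,7)] [])) (Split 2 7 (Use 2
    [0,1,2,3,5,4,6,7]) (Split 3 7 (Use 2 [0,1,3,2,5,4,6,7]) (Use 3 [0,1,6,7,5,4,2,3])))) (Use 4
    [0,2,3,4,5,7,6,1])))))"]) code_simp

lemma r78: "refutable (cfg [[], [A], [A,A], [A,U,U], [A,U,U,A], [A,U,U,U,U], [A,N,N,N,N,U],
    [A,N,N,U,U,U,U]] [])"
  by (rule refutableI[OF dep[OF r72 dep[OF r65 no_deps]], where t = "Split 5 6 (Use 0
    [0,3,1,2,4,5,6,7]) (Use 1 [0,1,2,3,4,5,6,7])"]) code_simp

lemma r79: "refutable (cfg [[], [A], [A,A], [A,U,U], [A,U,U,A], [A,U,U,A,U], [A,N,N,N,U,U],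
    [A,N,N,U,U,U,U]] [])"
  by (rule refutableI[OF dep[OF r72 dep[OF r78 no_deps]], where t = "Split 4 6 (Use 0
    [0,3,1,2,5,4,6,7]) (Use 1 [0,1,2,3,4,5,6,7])"]) code_simp

lemma r80: "refutable (cfg [[], [A], [A,A], [A,A,A], [A,A,A,A], [A,A,A,A,U], [A,U,U,U,U,U],
    [A,U,U,U,U,U,U]] [])"
  by (rule refutableI[OF dep[OF r66 dep[OF r77 dep[OF r79 no_deps]]], where t = "Split 4 5 (Use 0
    [0,1,2,3,4,5,6,7]) (Split 1 6 (Use 1 [0,1,2,3,4,5,6,7]) (Split 2 6 (Use 1 [0,2,1,3,4,5,6,7])
    (Split 3 6 (Use 1 [0,3,1,2,4,5,6,7]) (Split 1 7 (Use 1 [0,1,2,3,4,5,7,6]) (Split 2 7 (Use 1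
    [0,2,1,3,4,5,7,6]) (Use 2 [0,1,2,3,4,5,6,7]))))))"]) code_simp

lemma r81: "refutable (cfg [[], [A], [A,U], [A,U,U], [A,U,U,A], [A,A,U,N,N], [A,U,A,N,N,N],
    [A,U,U,U,U,U,U]] [])"
  by (rule refutableI[OF no_deps, where t = "Reduce [(0,1,5), (0,2,6), (0,3,4)] [(0,1), (0,2),
    (3,4), (1,5), (2,6), (0,7)] []"]) code_simp

lemma r82: "refutable (cfg [[], [A], [A,A], [A,U,U], [A,U,U,A], [A,A,U,N,N], [A,U,A,N,N,U],
    [A,U,U,U,U,U,U]] [])"
  by (rule refutableI[OF dep[OF r61 dep[OF r81 no_deps]], where t = "Split 5 6 (Use 0
    [0,1,3,4,2,7,5,6]) (Use 1 [0,1,2,3,4,5,6,7])"]) code_simp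

lemma r83: "refutable (cfg [[], [A], [A,A], [A,A,A], [A,A,A,A], [A,A,U,N,N], [A,A,A,U,U,U],
    [A,U,U,U,U,U,U]] [])"
  by (rule refutableI[OF dep[OF r80 dep[OF r82 no_deps]], where t = "Split 3 6 (Use 0
    [0,1,2,3,4,6,5,7]) (Split 4 6 (Use 0 [0,1,2,4,3,6,5,7]) (Use 1 [0,1,2,3,4,5,6,7]))"])
    code_simp

lemma r84: "refutable (cfg [[], [A], [A,A], [A,A,A], [A,A,A,A], [A,A,A,N,N], [A,A,N,A,N,U],
    [A,A,U,U,U,U,U]] [])"
  by (rule refutableI[OF dep[OF r83 no_deps], where t = "Split 2 7 (Use 0 [0,1,2,3,4,5,7,6])
    (Split 3 7 (Use 0 [0,1,3,2,4,6,7,5]) (Reduce [(0,1,7), (0,2,4), (0,3,6), (1,3,4), (1,2,5)]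
    [(0,1), (2,3), (2,4), (3,4), (2,5), (3,6), (5,6), (4,7), (5,7), (6,7)] []))"]) code_simp

lemma r85: "refutable (cfg [[], [A], [A,A], [A,A,A], [A,A,A,A], [A,A,A,N,N], [A,A,U,A,N,A],
    [A,U,A,U,U,U,U]] [])"
  by (rule refutableI[OF no_deps, where t = "Reduce [(0,2,7), (1,2,5), (0,5,6), (1,3,6), (0,1,4),
    (2,3,4)] [(0,1), (0,2), (1,2), (3,4), (3,6), (5,6), (3,7), (4,7), (5,7), (6,7)] [1,2]"])
    code_simp

lemma r86: "refutable (cfg [[], [A], [A,A], [A,A,A], [A,A,A,U], [A,A,U,N,N], [A,A,N,A,N,U],
    [A,U,N,N,A,U,N]] [])"
  by (rule refutableI[OF no_deps, where t = "Reduce [(0,4,7), (1,2,4), (0,2,3), (1,3,6), (0,1,5)]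
    [(0,1), (2,3), (2,4), (3,4), (2,5), (3,6), (5,6), (4,7), (5,7)] [1]"]) code_simp

lemma r87: "refutable (cfg [[], [A], [A,A], [A,A,A], [A,A,A,U], [A,A,U,N,N], [A,A,N,A,N,A],
    [A,U,N,N,A,A,U]] [])"
  by (rule refutableI[OF dep[OF r86 no_deps], where t = "Split 6 7 (Reduce [(0,4,7), (5,6,7),
    (0,1,5), (0,2,3), (1,2,4), (1,3,6)] [(0,1), (2,3), (2,4), (3,4), (2,5), (3,6), (5,6), (4,7),
    (5,7), (6,7)] [1]) (Use 0 [0,1,2,3,4,5,6,7])"]) code_simp

lemma r88: "refutable (cfg [[], [A], [A,A], [A,A,A], [A,A,A,A], [A,A,A,N,N], [A,A,U,A,N,N],
    [A,U,A,U,U,U,U]] [])"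
  by (rule refutableI[OF dep[OF r80 no_deps], where t = "Split 3 7 (Split 4 7 (Use 0
    [0,2,3,4,1,7,5,6]) (Reduce [(0,1,5), (0,3,6), (0,2,4), (1,3,4), (2,3,7)] [(0,1), (0,2), (1,2),
    (3,4), (3,6), (3,7), (5,7), (6,7)] [1,2])) (Reduce [(0,2,7), (0,1,5), (0,3,4), (1,2,4),
    (1,3,6)] [(0,1), (0,2), (1,2), (3,4), (3,6), (4,7), (5,7), (6,7)] [1,2])"]) code_simp

lemma r89: "refutable (cfg [[], [A], [A,A], [A,A,A], [A,A,A,A], [A,A,A,N,N], [A,A,N,A,U,U],
    [A,U,U,U,U,U,U]] [])"
  by (rule refutableI[OF dep[OF r80 dep[OF r84 dep[OF r85 dep[OF r87 dep[OF r86 dep[OF r79 dep[OF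
    r88 no_deps]]]]]]], where t = "Split 4 6 (Use 0 [0,1,3,4,2,6,5,7]) (Split 5 6 (Split 1 7 (Use
    1 [0,1,2,3,4,5,6,7]) (Split 2 7 (Use 2 [0,1,2,3,4,5,6,7]) (Split 4 7 (Split 3 7 (Use 2
    [0,1,3,2,4,6,5,7]) (Split 5 7 (Use 3 [0,1,2,3,4,5,6,7]) (Use 4 [0,1,3,2,4,6,5,7]))) (Use 5
    [0,2,4,1,3,5,7,6])))) (Split 1 7 (Use 1 [0,1,2,3,4,5,6,7]) (Split 2 7 (Use 6
    [0,1,2,3,4,5,6,7]) (Split 4 7 (Split 3 7 (Use 6 [0,1,3,2,4,6,5,7]) (Reduce [(0,4,7), (0,1,5),
    (0,2,3), (1,2,4), (1,3,6)] [(0,1), (2,3), (2,4), (3,4), (2,5), (3,6), (4,7), (5,7), (6,7)]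
    [1])) (Use 5 [0,2,4,1,3,5,7,6])))))"]) code_simp

lemma r90: "refutable (cfg [[], [A], [A,A], [A,A,A], [A,A,A,A], [A,A,A,N,N], [A,A,U,U,U,U],
    [A,U,U,U,U,U,U]] [])"
  by (rule refutableI[OF dep[OF r83 dep[OF r89 no_deps]], where t = "Split 2 6 (Use 0
    [0,1,2,3,4,5,6,7]) (Split 3 6 (Use 1 [0,1,2,3,4,5,6,7]) (Split 4 6 (Use 1 [0,1,2,4,3,5,6,7])
    (Use 0 [0,1,2,3,4,6,5,7])))"]) code_simp

lemma r91: "refutable (cfg [[], [A], [A,A], [A,A,U], [A,A,U,A], [A,U,A,U,U], [A,N,N,U,U,U],
    [A,N,N,U,U,U,U]] [])"
  by (rule refutableI[OF dep[OF r72 dep[OF r79 no_deps]], where t = "Split 5 6 (Use 0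
    [0,3,1,2,4,5,6,7]) (Split 5 7 (Use 0 [0,3,1,2,4,5,7,6]) (Use 1 [0,2,5,1,3,4,6,7]))"])
    code_simp

lemma r92: "refutable (cfg [[], [A], [A,A], [A,A,A], [A,A,A,A], [A,A,A,U,U], [A,U,U,U,U,U],
    [A,U,U,U,U,U,U]] [])"
  by (rule refutableI[OF dep[OF r80 dep[OF r90 dep[OF r91 no_deps]]], where t = "Split 3 5 (Use 0
    [0,1,2,3,4,5,6,7]) (Split 4 5 (Use 0 [0,1,2,4,3,5,6,7]) (Split 1 6 (Use 1 [0,1,2,3,4,5,6,7])
    (Split 2 6 (Use 1 [0,2,1,3,4,5,6,7]) (Split 1 7 (Use 1 [0,1,2,3,4,5,7,6]) (Split 2 7 (Use 1
    [0,2,1,3,4,5,7,6]) (Use 2 [0,1,2,3,4,5,6,7]))))))"]) code_simp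

lemma r93: "refutable (cfg [[], [A], [A,U], [A,U,A], [A,U,U,U], [A,U,N,N,N], [A,A,N,N,U,N],
    [A,U,U,U,U,U,U]] [])"
  by (rule refutableI[OF dep[OF r81 dep[OF r65 no_deps]], where t = "Split 5 7 (Use 0
    [0,7,1,2,3,5,6,4]) (Use 1 [0,2,3,4,6,7,5,1])"]) code_simp

lemma r94: "refutable (cfg [[], [A], [A,A], [A,A,A], [A,U,A,U], [A,U,N,N,N], [A,A,N,N,N,U],
    [A,U,U,U,U,U,U]] [])"
  by (rule refutableI[OF dep[OF r82 dep[OF r93 no_deps]], where t = "Split 5 6 (Use 0
    [0,1,2,5,6,3,4,7]) (Use 1 [0,1,2,3,4,5,6,7])"]) code_simp

lemma r95: "refutable (cfg [[], [A], [A,A], [A,A,A], [A,A,A,A], [A,U,N,N,N], [A,A,U,U,U,U],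
    [A,U,U,U,U,U,U]] [])"
  by (rule refutableI[OF dep[OF r92 dep[OF r94 no_deps]], where t = "Split 2 6 (Use 0
    [0,1,2,3,4,6,5,7]) (Split 3 6 (Use 0 [0,1,3,2,4,6,5,7]) (Split 4 6 (Use 0 [0,1,4,2,3,6,5,7])
    (Use 1 [0,1,2,3,4,5,6,7])))"]) code_simp

lemma r96: "refutable (cfg [[], [A], [A,A], [A,A,A], [A,A,A,A], [A,A,U,N,N], [A,U,A,U,U,U],
    [A,U,U,U,U,U,U]] [])"
  by (rule refutableI[OF dep[OF r92 dep[OF r82 no_deps]], where t = "Split 3 6 (Use 0
    [0,2,3,1,4,6,5,7]) (Split 4 6 (Use 0 [0,2,4,1,3,6,5,7]) (Use 1 [0,1,2,3,4,5,6,7]))"])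
    code_simp

lemma r97: "refutable (cfg [[], [A], [A,A], [A,A,A], [A,A,A,A], [A,A,U,U,U], [A,U,U,U,U,U],
    [A,U,U,U,U,U,U]] [])"
  by (rule refutableI[OF dep[OF r92 dep[OF r95 dep[OF r96 dep[OF r91 no_deps]]]], where t = "Split
    2 5 (Use 0 [0,1,2,3,4,5,6,7]) (Split 3 5 (Use 0 [0,1,3,2,4,5,6,7]) (Split 4 5 (Use 0
    [0,1,4,2,3,5,6,7]) (Split 1 6 (Use 1 [0,1,2,3,4,5,6,7]) (Split 1 7 (Use 1 [0,1,2,3,4,5,7,6])
    (Split 2 6 (Use 2 [0,1,2,3,4,5,6,7]) (Split 2 7 (Use 2 [0,1,2,3,4,5,7,6]) (Use 3
    [0,2,1,3,4,5,6,7])))))))"]) code_simp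

lemma r98: "refutable (cfg [[], [A], [A,A], [A,A,A], [A,A,A,A], [A,U,U,U,U], [A,U,U,U,U,U],
    [A,U,U,U,U,U,U]] [])"
  by (rule refutableI[OF dep[OF r97 dep[OF r82 dep[OF r65 no_deps]]], where t = "Split 1 5 (Use 0
    [0,1,2,3,4,5,6,7]) (Split 2 5 (Use 0 [0,2,1,3,4,5,6,7]) (Split 3 5 (Use 0 [0,3,1,2,4,5,6,7])
    (Split 4 5 (Use 0 [0,4,1,2,3,5,6,7]) (Split 5 6 (Split 1 6 (Use 0 [0,1,2,3,4,6,5,7]) (Split 2
    6 (Use 0 [0,2,1,3,4,6,5,7]) (Use 1 [0,3,4,5,6,1,2,7]))) (Use 2 [0,1,2,3,4,6,5,7])))))"])
    code_simp

section \<open>Centre of degree 7: an edge with three common neighbours inside the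
  neighbourhood\<close>

lemma r99: "refutable (cfg [[], [A], [A,U], [A,U,U], [A,A,U,N], [A,U,A,N,N], [A,U,U,N,N,N],
    [A,U,U,A,U,U,U]] [])"
  by (rule refutableI[OF no_deps, where t = "Reduce [(0,1,4), (0,2,5), (0,3,7)] [(0,1), (0,2),
    (1,4), (2,5), (0,7), (3,7)] []"]) code_simp

lemma r100: "refutable (cfg [[], [A], [A,U], [A,A,U], [A,U,A,N], [A,U,U,N,N], [A,U,U,N,N,U],
    [A,U,U,N,N,U,U]] [])"
  by (rule refutableI[OF no_deps, where t = "Reduce [(0,1,3), (0,2,4)] [(0,1), (0,2), (1,3),
    (2,4)] []"]) code_simp

lemma r101: "refutable (cfg [[], [A], [A,U], [A,A,A], [A,U,A,N], [A,A,U,N,N], [A,U,U,N,N,N],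
    [A,U,U,N,U,U,U]] [])"
  by (rule refutableI[OF dep[OF r99 dep[OF r100 no_deps]], where t = "Split 4 7 (Use 0
    [0,7,1,3,4,5,6,2]) (Use 1 [0,1,2,3,4,5,6,7])"]) code_simp

lemma r102: "refutable (cfg [[], [A], [A,U], [A,A,A], [A,A,A,N], [A,A,A,N,N], [A,U,U,N,N,N],
    [A,U,U,U,U,U,U]] [])"
  by (rule refutableI[OF dep[OF r99 dep[OF r101 no_deps]], where t = "Split 3 7 (Use 0
    [0,1,2,3,4,5,6,7]) (Use 1 [0,1,2,3,4,5,6,7])"]) code_simp

lemma r103: "refutable (cfg [[], [A], [A,A], [A,A,A], [A,A,A,N], [A,A,A,N,N], [A,A,A,U,U,U],
    [A,U,U,U,U,U,U]] [])"
  by (rule refutableI[OF dep[OF r98 dep[OF r102 no_deps]], where t = "Split 3 6 (Use 0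
    [0,1,2,3,6,4,5,7]) (Split 4 6 (Use 0 [0,1,2,4,6,3,5,7]) (Split 5 6 (Use 0 [0,1,2,5,6,3,4,7])
    (Use 1 [0,1,2,3,4,5,6,7])))"]) code_simp

lemma r104: "refutable (cfg [[], [A], [A,A], [A,A,A], [A,A,A,N], [A,A,U,N,N], [A,A,N,A,A,A],
    [A,A,N,U,U,U,U]] [])"
  by (rule refutableI[OF dep[OF r103 no_deps], where t = "Split 6 7 (Use 0 [0,1,6,3,4,5,7,2])
    (Reduce [(0,1,7), (0,2,3), (0,4,6), (1,3,6), (1,2,4)] [(0,1), (2,3), (2,4), (2,5), (3,6),
    (4,6), (5,6), (3,7), (4,7), (5,7)] [])"]) code_simp

lemma r105: "refutable (cfg [[], [A], [A,A], [A,A,A], [A,A,A,N], [A,A,A,N,N], [A,A,N,U,A,A],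
    [A,N,A,A,U,U,U]] [])"
  by (rule refutableI[OF no_deps, where t = "Reduce [(2,3,7), (0,1,3), (0,2,4), (0,5,6), (1,2,5),
    (1,4,6)] [(0,2), (1,3), (1,4), (1,5), (0,6), (3,7), (4,7), (5,7)] [2,6]"]) code_simp

lemma r106: "refutable (cfg [[], [A], [A,A], [A,A,A], [A,A,A,N], [A,A,A,N,N], [A,A,N,A,A,A],
    [A,N,A,U,U,U,U]] [])"
  by (rule refutableI[OF dep[OF r105 no_deps], where t = "Split 3 7 (Use 0 [0,1,2,3,4,5,6,7])
    (Reduce [(0,2,7), (1,2,3), (0,3,6), (0,1,4), (1,5,6)] [(0,2), (1,3), (1,4), (1,5), (0,6),
    (4,7), (5,7)] [2,6])"]) code_simp

lemma r107: "refutable (cfg [[], [A], [A,A], [A,A,A], [A,A,A,U], [A,A,U,U,N], [A,A,N,A,A,A],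
    [A,U,N,A,U,A,N], [U,A,U,A,U,U,U,U]] [])"
  by (rule refutableI[OF no_deps, where t = "Reduce [(1,3,8), (0,2,3), (1,2,4), (0,4,6), (0,5,7),
    (1,5,6)] [(0,1), (0,3), (1,3), (2,4), (2,5), (4,6), (5,6), (4,7), (5,7), (1,8), (3,8)] [3]"])
    code_simp

lemma r108: "refutable (cfg [[], [A], [A,A], [A,A,A], [A,A,A,N], [A,A,U,N,N], [A,A,N,U,A,U],
    [A,U,N,A,U,N,N]] [])"
  by (rule refutableI[OF no_deps, where t = "Reduce [(0,3,7), (1,2,3), (0,2,4), (1,4,6), (0,1,5)]
    [(0,1), (2,3), (2,4), (2,5), (3,6), (4,6), (5,6), (3,7), (4,7)] [1]"]) code_simp

text \<open>The neighbourhood of 0 does not always decide: in one branch 1 becomes a second centre.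
  \<open>r54\<close> gives it a seventh neighbour, 8, and the adjacencies of 8 settle the
  case.\<close>

lemma r109: "refutable (cfg [[], [A], [A,A], [A,A,A], [A,A,A,N], [A,A,A,N,N], [A,A,N,A,A,U],
    [A,U,U,U,U,U,U]] [])"
  by (rule refutableI[OF dep[OF r103 dep[OF r104 dep[OF r106 dep[OF r54 dep[OF r107 dep[OF r65
    dep[OF r108 dep[OF r105 dep[OF r87 dep[OF r79 no_deps]]]]]]]]]], where t = "Split 5 6 (Split 1
    7 (Split 2 7 (Use 0 [0,1,2,3,4,5,7,6]) (Use 1 [0,1,2,3,4,5,6,7])) (Split 2 7 (Use 2
    [0,1,2,3,4,5,6,7]) (Split 6 7 (Use 2 [0,1,6,3,4,5,2,7]) (Split 3 7 (Split 4 7 (Split 5 7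
    (Extend 1 (Use 3 [1,0,2,3,4,5,6]) (Split 2 8 (Use 2 [1,0,2,3,4,5,6,8]) (Split 6 8 (Use 2
    [1,0,6,3,4,5,2,8]) (Split 3 8 (Use 4 [0,1,2,3,4,5,6,7,8]) (Split 4 8 (Use 4
    [0,1,6,4,3,5,2,7,8]) (Use 5 [1,0,2,3,4,6,8,5])))))) (Use 6 [0,1,2,3,4,5,6,7])) (Use 6
    [0,1,2,3,5,4,6,7])) (Reduce [(0,2,3), (1,3,6), (1,2,4), (0,1,5), (0,4,6)] [(0,1), (2,3),
    (2,4), (2,5), (3,6), (4,6), (5,6), (4,7), (5,7)] [1]))))) (Split 1 7 (Split 6 7 (Split 2 7
    (Use 0 [0,1,2,3,4,5,7,6]) (Reduce [(0,1,5), (0,6,7), (0,2,3), (1,2,4), (1,3,6)] [(0,1), (2,3),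
    (2,4), (2,5), (3,6), (4,6), (3,7), (4,7), (5,7), (6,7)] [])) (Use 1 [0,1,6,3,4,5,2,7])) (Split
    2 7 (Split 5 7 (Use 7 [0,1,2,5,3,4,6,7]) (Reduce [(0,2,7), (0,1,5), (0,3,6), (1,2,3), (1,4,6)]
    [(0,1), (0,2), (1,2), (3,6), (4,6), (3,7), (4,7), (6,7)] [1,2])) (Split 5 7 (Split 3 7 (Split
    4 7 (Split 6 7 (Reduce [(0,5,7), (1,2,5), (0,2,3), (1,3,6), (0,1,4)] [(0,1), (2,3), (2,4),
    (2,5), (3,6), (4,6), (0,7)] [1,7]) (Reduce [(0,3,7), (1,2,3), (0,1,5), (0,2,4), (1,4,6)]
    [(0,1), (2,3), (2,4), (2,5), (3,6), (4,6), (3,7), (4,7), (5,7)] [1])) (Use 8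
    [0,1,2,4,5,3,6,7])) (Reduce [(0,5,7), (1,2,5), (0,2,3), (1,3,6), (0,1,4)] [(0,1), (2,3),
    (2,4), (2,5), (3,6), (4,6), (4,7), (5,7), (6,7)] [1])) (Use 9 [0,2,5,1,3,4,7,6]))))"])
    code_simp

lemma r110: "refutable (cfg [[], [A], [A,A], [A,A,A], [A,A,A,N], [A,A,A,N,N], [A,A,N,A,U,U],
    [A,U,U,U,U,U,U]] [])"
  by (rule refutableI[OF dep[OF r109 dep[OF r82 no_deps]], where t = "Split 4 6 (Use 0
    [0,1,2,3,4,5,6,7]) (Split 5 6 (Use 0 [0,1,2,3,5,4,6,7]) (Use 1 [0,1,2,3,6,4,5,7]))"])
    code_simp

lemma r111: "refutable (cfg [[], [A], [A,A], [A,A,A], [A,A,A,N], [A,A,A,N,N], [A,A,U,U,U,U],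
    [A,U,U,U,U,U,U]] [])"
  by (rule refutableI[OF dep[OF r103 dep[OF r110 dep[OF r102 no_deps]]], where t = "Split 2 6 (Use
    0 [0,1,2,3,4,5,6,7]) (Split 3 6 (Use 1 [0,1,2,3,4,5,6,7]) (Split 4 6 (Use 1 [0,1,2,4,3,5,6,7])
    (Split 5 6 (Use 1 [0,1,2,5,3,4,6,7]) (Use 2 [0,1,2,3,4,5,6,7]))))"]) code_simp

text \<open>Refuted around the centre 1: by \<open>r54\<close> its six named neighbours cannot be
  all, and once the seventh, 9, is named, \<open>r111\<close> applies: the edge 02 has the common
  neighbours 3, 4, 5 there, and 8 is attached to 2.\<close>

lemma r112: "refutable (cfg [[], [A], [A,A], [A,A,A], [A,A,A,N], [A,A,A,N,N], [U,N,U,U,U,U],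
    [U,N,U,U,U,U,U], [U,A,A,U,U,U,U,U]] [])"
  by (rule refutableI[OF dep[OF r54 dep[OF r111 no_deps]], where t = "Extend 1 (Use 0
    [1,0,2,3,4,5,8]) (Use 1 [1,2,0,3,4,5,8,9])"]) code_simp

lemma r113: "refutable (cfg [[], [A], [A,A], [A,A,A], [A,A,A,N], [A,A,A,N,N], [A,N,N,A,A,A],
    [A,N,N,A,A,A,A], [U,A,N,A,A,U,U,U]] [])"
  by (rule refutableI[OF no_deps, where t = "Reduce [(1,3,8), (0,2,3), (1,2,4), (0,1,5), (3,6,7),
    (0,4,6)] [(1,2), (0,3), (0,4), (0,5), (6,7), (1,8), (6,8), (7,8)] [3,4,5]"]) code_simp

lemma r114: "refutable (cfg [[], [A], [A,A], [A,A,A], [A,A,A,N], [A,A,A,N,N], [A,N,N,A,A,A],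
    [A,N,N,A,A,A,A], [U,A,N,A,U,U,U,U]] [])"
  by (rule refutableI[OF dep[OF r113 no_deps], where t = "Split 4 8 (Use 0 [0,1,2,3,4,5,6,7,8])
    (Split 5 8 (Use 0 [0,1,2,3,5,4,6,7,8]) (Split 6 8 (Reduce [(1,3,8), (0,2,3), (1,2,4), (0,1,5),
    (3,6,7), (0,4,6)] [(0,1), (2,3), (2,4), (2,5), (0,6), (0,7), (6,7), (3,8)] [1,6,7]) (Reduce
    [(1,3,8), (0,2,3), (1,2,4), (0,1,5), (3,6,7), (0,4,6)] [(0,1), (2,3), (2,4), (2,5), (3,6),
    (4,6), (5,6), (0,7), (3,8)] [1,7])))"]) code_simp

lemma r115: "refutable (cfg [[], [A], [U,A], [A,A,A], [A,A,A,N], [A,A,A,N,N], [U,N,U,U,U,U],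
    [U,N,U,U,U,U,U], [U,A,U,N,N,N,U,U]] [])"
  by (rule refutableI[OF dep[OF r54 dep[OF r102 no_deps]], where t = "Extend 1 (Use 0
    [1,0,2,3,4,5,8]) (Use 1 [1,0,2,3,4,5,8,9])"]) code_simp

lemma r116: "refutable (cfg [[], [A], [A,A], [A,A,A], [A,A,A,N], [A,A,A,N,N], [A,N,N,A,A,A],
    [A,N,N,A,A,N,A], [U,A,N,A,U,U,U,U]] [])"
  by (rule refutableI[OF no_deps, where t = "Split 4 8 (Split 5 8 (Reduce [(1,3,8), (0,2,3),
    (1,2,4), (0,1,5), (3,6,7), (0,4,6)] [(1,2), (0,3), (0,4), (0,5), (6,7), (1,8), (6,8), (7,8)]
    [3,4,5]) (Reduce [(1,3,8), (0,2,3), (1,2,4), (0,1,5), (3,6,7), (0,4,6)] [(1,2), (0,3), (0,4),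
    (1,5), (2,5), (5,6), (6,7), (1,8), (6,8), (7,8)] [3,4])) (Split 5 8 (Split 6 8 (Reduce
    [(0,1,4), (4,6,7), (0,3,7), (0,2,5), (1,2,3), (1,5,8)] [(0,1), (2,3), (2,4), (2,5), (0,6),
    (3,7), (4,7), (3,8), (5,8), (7,8)] [1,6]) (Reduce [(1,3,8), (0,2,3), (1,2,4), (0,1,5),
    (3,6,7), (0,4,6)] [(1,2), (0,3), (0,4), (0,5), (6,7), (1,8), (7,8)] [3,4,5])) (Reduce
    [(1,3,8), (0,2,3), (1,2,4), (0,1,5), (3,6,7), (0,4,6)] [(0,1), (2,3), (2,4), (2,5), (0,6),
    (3,7), (4,7), (3,8), (7,8)] [1,6]))"]) code_simp

lemma r117: "refutable (cfg [[], [A], [A,A], [A,A,A], [A,A,A,N], [A,A,A,N,N], [A,N,N,A,A,A],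
    [A,N,N,A,A,U,A]] [])"
  by (rule refutableI[OF dep[OF r22 dep[OF r112 dep[OF r114 dep[OF r115 dep[OF r116 no_deps]]]]],
    where t = "Split 5 7 (Extend 1 (Use 0 [1,0,2,3,4,5]) (Split 2 8 (Use 1 [0,1,2,3,4,5,6,7,8])
    (Split 3 8 (Use 2 [0,1,2,3,4,5,6,7,8]) (Split 4 8 (Use 2 [0,1,2,4,3,5,6,7,8]) (Split 5 8 (Use
    2 [0,1,2,5,3,4,6,7,8]) (Use 3 [0,1,2,3,4,5,6,7,8])))))) (Extend 1 (Use 0 [1,0,2,3,4,5]) (Split
    2 8 (Use 1 [0,1,2,3,4,5,6,7,8]) (Split 3 8 (Use 4 [0,1,2,3,4,5,6,7,8]) (Split 4 8 (Use 4
    [0,1,2,4,3,5,6,7,8]) (Split 5 8 (Reduce [(1,5,8), (0,2,5), (1,2,3), (0,1,4), (4,6,7), (0,3,6)]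
    [(0,1), (2,3), (2,4), (2,5), (0,6), (3,7), (4,7), (5,8), (7,8)] [1,6]) (Use 3
    [0,1,2,3,4,5,6,7,8]))))))"]) code_simp

lemma r118: "refutable (cfg [[], [A], [A,A], [A,A,A], [A,A,A,N], [A,A,A,N,N], [A,N,N,A,A,A],
    [A,N,N,A,U,U,U]] [])"
  by (rule refutableI[OF dep[OF r117 dep[OF r91 dep[OF r81 no_deps]]], where t = "Split 6 7 (Split
    4 7 (Use 0 [0,1,2,3,4,5,6,7]) (Split 5 7 (Use 0 [0,1,2,3,5,4,6,7]) (Use 1 [0,3,7,1,2,6,4,5])))
    (Use 2 [0,4,3,1,2,6,7,5])"]) code_simp

lemma r119: "refutable (cfg [[], [A], [A,A], [A,A,A], [A,A,A,N], [A,A,A,N,N], [A,N,N,A,A,A],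
    [A,N,N,U,U,U,U]] [])"
  by (rule refutableI[OF dep[OF r118 dep[OF r102 no_deps]], where t = "Split 3 7 (Use 0
    [0,1,2,3,4,5,6,7]) (Split 4 7 (Use 0 [0,1,2,4,3,5,6,7]) (Split 5 7 (Use 0 [0,1,2,5,3,4,6,7])
    (Use 1 [0,1,2,3,4,5,7,6])))"]) code_simp

lemma r120: "refutable (cfg [[], [A], [A,A], [A,A,A], [A,A,A,U], [A,A,U,U,N], [A,U,N,A,A,N],
    [A,U,N,A,N,U,A], [U,A,U,A,U,U,U,U]] [])"
  by (rule refutableI[OF no_deps, where t = "Reduce [(1,3,8), (0,2,3), (1,2,4), (0,1,5), (0,4,6),
    (3,6,7)] [(0,1), (0,3), (1,3), (2,4), (2,5), (4,6), (5,7), (6,7), (1,8), (3,8)] [1,3]"])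
    code_simp

lemma r121: "refutable (cfg [[], [A], [A,A], [A,A,A], [A,A,A,N], [A,A,A,N,N], [A,N,N,A,A,N],
    [A,N,N,A,U,A,A]] [])"
  by (rule refutableI[OF dep[OF r119 dep[OF r22 dep[OF r112 dep[OF r120 dep[OF r54 dep[OF r79
    no_deps]]]]]], where t = "Split 4 7 (Use 0 [0,1,2,3,4,5,7,6]) (Extend 1 (Use 1 [1,0,2,3,4,5])
    (Split 2 8 (Use 2 [0,1,2,3,4,5,6,7,8]) (Split 3 8 (Use 3 [0,1,2,3,4,5,6,7,8]) (Extend 1 (Use 4
    [1,0,2,3,4,5,8]) (Split 3 9 (Use 3 [0,1,2,3,4,5,6,7,9]) (Use 5 [1,0,3,2,4,5,8,9]))))))"])
    code_simp

lemma r122: "refutable (cfg [[], [A], [A,A], [A,A,A], [A,A,A,N], [A,A,A,N,N], [A,N,N,A,A,U],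
    [A,N,N,U,U,U,U]] [])"
  by (rule refutableI[OF dep[OF r119 dep[OF r121 dep[OF r91 dep[OF r81 dep[OF r94 no_deps]]]]],
    where t = "Split 5 6 (Use 0 [0,1,2,3,4,5,6,7]) (Split 5 7 (Split 6 7 (Split 3 7 (Use 1
    [0,1,2,3,4,5,6,7]) (Split 4 7 (Use 1 [0,1,2,4,5,3,7,6]) (Use 2 [0,5,7,1,2,6,3,4]))) (Use 3
    [0,3,5,1,2,6,7,4])) (Use 4 [0,3,1,2,5,7,6,4]))"]) code_simp

lemma r123: "refutable (cfg [[], [A], [A,A], [A,A,A], [A,A,A,N], [A,A,A,N,N], [A,N,N,A,U,U],
    [A,N,N,U,U,U,U]] [])"
  by (rule refutableI[OF dep[OF r122 dep[OF r82 no_deps]], where t = "Split 4 6 (Use 0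
    [0,1,2,3,4,5,6,7]) (Split 5 6 (Use 0 [0,1,2,3,5,4,6,7]) (Use 1 [0,1,2,3,6,4,5,7]))"])
    code_simp

lemma r124: "refutable (cfg [[], [A], [A,A], [A,A,A], [A,A,A,N], [A,A,A,U,U], [A,U,U,U,U,U],
    [A,U,U,U,U,U,U]] [])"
  by (rule refutableI[OF dep[OF r98 dep[OF r111 dep[OF r123 dep[OF r79 no_deps]]]], where t =
    "Split 3 5 (Use 0 [0,1,2,3,5,4,6,7]) (Split 4 5 (Use 0 [0,1,2,4,5,3,6,7]) (Split 1 6 (Use 1
    [0,1,2,3,4,5,6,7]) (Split 2 6 (Use 1 [0,2,1,3,4,5,6,7]) (Split 1 7 (Use 1 [0,1,2,3,4,5,7,6])
    (Split 2 7 (Use 1 [0,2,1,3,4,5,7,6]) (Split 3 6 (Use 2 [0,1,2,3,4,5,6,7]) (Split 3 7 (Use 2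
    [0,1,2,3,4,5,7,6]) (Use 3 [0,2,3,1,4,5,6,7]))))))))"]) code_simp

section \<open>Centre of degree 7: a 4-wheel or a fan over a three-edge path in the
  neighbourhood\<close>

lemma r125: "refutable (cfg [[], [A], [A,A], [A,A,A], [A,A,A,N], [A,A,N,A,A], [A,A,U,U,U,U],
    [A,U,U,U,U,U,U]] [])"
  by (rule refutableI[OF dep[OF r124 no_deps], where t = "Split 2 6 (Use 0 [0,1,2,3,4,6,5,7])
    (Split 3 6 (Use 0 [0,1,3,2,5,6,4,7]) (Split 4 6 (Use 0 [0,1,4,2,5,6,3,7]) (Split 5 6 (Use 0
    [0,1,5,3,4,6,2,7]) (Split 1 7 (Reduce [(0,1,6), (0,2,3), (0,4,5), (1,2,4), (1,3,5)] [(0,1),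
    (2,3), (2,4), (3,5), (4,5), (2,7), (3,7), (4,7), (5,7), (6,7)] []) (Reduce [(0,1,6), (0,2,4),
    (0,3,5), (1,2,3), (1,4,5)] [(0,1), (2,3), (2,4), (3,5), (4,5), (0,7)] [1])))))"]) code_simp

lemma r126: "refutable (cfg [[], [A], [A,A], [A,A,A], [A,A,A,N], [A,U,N,A,A], [A,N,A,A,A,N],
    [A,N,N,A,U,A,U]] [])"
  by (rule refutableI[OF no_deps, where t = "Reduce [(0,4,5), (1,2,4), (0,1,3), (0,2,6), (3,5,7)]
    [(1,2), (0,3), (0,4), (1,5), (2,6), (5,7), (6,7)] [3,4]"]) code_simp

lemma r127: "refutable (cfg [[], [A], [A,A], [A,A,A], [A,A,A,N], [A,A,N,A,A], [A,N,A,A,U,N],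
    [A,U,U,N,N,A,A], [U,A,A,A,N,A,U,U]] [])"
  by (rule refutableI[OF no_deps, where t = "Reduce [(0,5,7), (1,4,5), (3,5,8), (1,2,8), (0,1,3),
    (2,3,6), (0,2,4)] [(1,2), (0,3), (0,4), (1,5), (2,6), (0,7), (3,8), (7,8)] [1,2,5,6]"])
    code_simp

lemma r128: "refutable (cfg [[], [A], [A,A], [A,A,A], [A,A,A,N], [A,A,N,A,A], [A,N,A,A,A,N],
    [A,N,N,N,N,A,A], [U,A,A,A,U,U,U,U]] [])"
  by (rule refutableI[OF dep[OF r127 dep[OF r54 dep[OF r91 no_deps]]], where t = "Split 4 8
    (Reduce [(0,5,7), (1,3,5), (2,3,8), (0,3,6), (1,4,8), (0,1,2), (2,4,6)] [(1,2), (0,3), (0,4),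
    (1,5), (2,6), (5,7), (6,7), (1,8), (2,8), (5,8), (6,8)] [3,4]) (Split 5 8 (Use 0
    [0,1,2,3,4,5,6,7,8]) (Split 6 8 (Use 0 [0,2,1,3,4,6,5,7,8]) (Extend 1 (Use 1 [1,0,2,3,4,5,8])
    (Split 4 9 (Reduce [(1,4,9), (0,4,5), (0,6,7), (1,3,5), (0,1,2), (2,4,6), (2,3,8)] [(1,2),
    (0,3), (0,4), (1,5), (2,6), (5,7), (6,7), (1,8), (2,8), (3,9), (4,9)] [3,4]) (Use 2
    [1,0,4,2,3,5,8,9])))))"]) code_simp

lemma r129: "refutable (cfg [[], [A], [A,A], [A,A,A], [A,A,A,N], [A,A,U,A,A], [A,N,A,A,A,N],
    [A,U,N,N,N,A,A], [U,A,U,U,U,A,U,U]] [])"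
  by (rule refutableI[OF no_deps, where t = "Split 6 8 (Reduce [(1,5,8), (0,3,5), (0,6,7),
    (1,2,3), (0,1,4), (2,4,6)] [(0,1), (2,3), (2,4), (0,5), (1,5), (0,6), (1,8), (5,8), (6,8)]
    [1,5,6]) (Reduce [(1,5,8), (0,3,5), (0,6,7), (1,2,3), (0,1,4), (2,4,6)] [(0,1), (2,3), (2,4),
    (0,5), (1,5), (0,6), (1,8), (5,8)] [1,5,6])"]) code_simp

lemma r130: "refutable (cfg [[], [A], [A,A], [A,A,A], [A,A,A,N], [A,A,N,A,A], [A,N,A,A,A,N],
    [A,N,N,N,N,A,A], [U,A,N,A,U,U,U,U]] [])"
  by (rule refutableI[OF dep[OF r129 no_deps], where t = "Split 4 8 (Split 5 8 (Use 0
    [0,1,2,3,4,5,6,7,8]) (Reduce [(1,3,8), (0,3,5), (0,6,7), (1,4,5), (0,1,2), (2,3,6)] [(1,2),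
    (0,3), (0,4), (1,5), (2,6), (5,7), (6,7), (1,8), (6,8)] [3,4])) (Split 5 8 (Use 0
    [0,1,2,3,4,5,6,7,8]) (Reduce [(1,3,8), (0,3,5), (0,6,7), (1,4,5), (0,1,2), (2,3,6)] [(0,1),
    (2,3), (2,4), (3,5), (4,5), (0,6), (5,7), (3,8), (7,8)] [1,6]))"]) code_simp

text \<open>Around 1, the vertex 8 sees none of 2,...,5, and not 0 either, whose seven neighbours
  are 1,...,7. Only the new neighbour 9 of 1 remains for it, as in \<open>r65\<close>.\<close>

lemma r131: "refutable (cfg [[], [A], [A,A], [A,A,U], [A,A,U,U], [A,A,U,U,U], [A,N,U,U,U,U],
    [A,N,U,U,U,U,U], [U,A,N,N,N,N,U,U]] [])"
  by (rule refutableI[OF dep[OF r54 dep[OF r65 no_deps]], where t = "Extend 1 (Use 0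
    [1,0,2,3,4,5,8]) (Use 1 [1,0,2,3,4,5,8,9])"]) code_simp

lemma r132: "refutable (cfg [[], [A], [A,A], [A,A,A], [A,A,A,N], [A,A,N,A,A], [A,N,A,A,A,U],
    [A,N,U,U,U,U,U]] [])"
  by (rule refutableI[OF dep[OF r125 dep[OF r65 dep[OF r126 dep[OF r22 dep[OF r128 dep[OF r130
    dep[OF r129 dep[OF r131 dep[OF r91 no_deps]]]]]]]]], where t = "Split 2 7 (Use 0
    [0,2,1,3,4,6,7,5]) (Split 5 6 (Split 3 7 (Use 0 [0,3,1,2,5,6,7,4]) (Split 4 7 (Use 0
    [0,4,1,2,5,6,7,3]) (Split 5 7 (Use 0 [0,5,1,3,4,6,7,2]) (Use 1 [0,1,2,3,4,5,7,6])))) (Split 5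
    7 (Split 6 7 (Split 3 7 (Use 2 [0,1,2,3,4,5,6,7]) (Split 4 7 (Use 2 [0,2,1,4,3,6,5,7]) (Extend
    1 (Use 3 [1,0,2,3,4,5]) (Split 2 8 (Split 3 8 (Use 4 [0,1,2,3,4,5,6,7,8]) (Split 4 8 (Use 4
    [0,1,2,4,3,5,6,7,8]) (Split 5 8 (Reduce [(1,2,8), (0,5,7), (1,3,5), (0,1,4), (2,4,6), (0,2,3)]
    [(0,1), (2,3), (2,4), (0,5), (1,5), (0,6), (2,8), (7,8)] [1,5,6]) (Reduce [(1,2,8), (0,5,7),
    (1,3,5), (0,1,4), (2,4,6), (0,2,3)] [(0,1), (2,3), (2,4), (3,5), (4,5), (0,6), (5,7), (2,8)]
    [1,6])))) (Split 3 8 (Use 5 [0,1,2,3,4,5,6,7,8]) (Split 4 8 (Use 5 [0,1,2,4,3,5,6,7,8]) (Split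
    5 8 (Use 6 [0,1,2,3,4,5,6,7,8]) (Use 7 [0,1,2,3,4,5,6,7,8])))))))) (Use 8 [0,2,6,1,3,4,5,7]))
    (Use 8 [0,1,5,2,3,4,6,7])))"]) code_simp

lemma r133: "refutable (cfg [[], [A], [A,A], [A,A,A], [A,A,A,N], [A,A,N,A,A], [A,N,A,A,U,N],
    [A,N,N,U,A,U,A], [U,A,A,A,A,U,U,U]] [])"
  by (rule refutableI[OF no_deps, where t = "Reduce [(0,6,7), (2,3,6), (1,3,8), (0,3,5), (1,4,5),
    (0,1,2), (2,4,8)] [(1,2), (0,3), (0,4), (1,5), (2,6), (5,7), (6,7), (1,8), (2,8), (5,8),
    (6,8), (7,8)] [3,4]"]) code_simp

lemma r134: "refutable (cfg [[], [A], [A,A], [A,A,A], [A,A,A,N], [A,A,N,A,A], [A,N,A,A,N,N],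
    [A,N,N,N,A,A,A], [U,A,A,A,U,U,U,U]] [])"
  by (rule refutableI[OF dep[OF r133 no_deps], where t = "Split 4 8 (Use 0 [0,1,2,3,4,5,6,7,8])
    (Split 5 8 (Use 0 [0,1,3,2,5,4,6,7,8]) (Split 6 8 (Reduce [(0,6,7), (4,5,7), (0,1,4), (0,2,3),
    (1,2,8), (1,3,5), (3,6,8)] [(0,1), (0,2), (1,2), (3,5), (4,5), (3,6), (0,7), (3,8), (6,8)]
    [1,2,7]) (Split 7 8 (Reduce [(0,6,7), (2,3,6), (1,2,8), (0,2,4), (1,4,5), (0,1,3)] [(0,1),
    (0,2), (1,2), (3,5), (4,5), (3,6), (0,7), (3,8)] [1,2,7]) (Reduce [(0,6,7), (2,3,6), (1,2,8),
    (0,2,4), (1,4,5), (0,1,3)] [(0,1), (0,2), (1,2), (3,5), (4,5), (3,6), (4,7), (5,7), (6,7),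
    (3,8)] [1,2]))))"]) code_simp

lemma r135: "refutable (cfg [[], [A], [A,A], [A,A,A], [A,A,A,U], [A,A,N,U,A], [A,N,A,U,N,U],
    [A,U,N,N,A,A,A], [U,A,A,N,A,N,A,U]] [])"
  by (rule refutableI[OF no_deps, where t = "Reduce [(0,6,7), (2,6,8), (1,4,8), (0,2,4), (1,2,3),
    (0,1,5), (4,5,7)] [(0,1), (2,3), (0,4), (1,4), (3,5), (0,6), (5,7), (2,8), (7,8)] [1,4,6]"])
    code_simp

lemma r136: "refutable (cfg [[], [A], [A,A], [A,A,A], [A,A,A,N], [A,A,N,A,A], [A,N,A,A,N,N],
    [A,N,N,N,A,A,A], [U,A,A,U,U,U,U,U]] [])"
  by (rule refutableI[OF dep[OF r134 dep[OF r135 no_deps]], where t = "Split 3 8 (Use 0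
    [0,1,2,3,4,5,6,7,8]) (Split 4 8 (Split 5 8 (Use 0 [0,1,4,5,2,3,7,6,8]) (Split 6 8 (Use 1
    [0,1,2,3,4,5,6,7,8]) (Split 7 8 (Use 1 [0,1,4,5,2,3,7,6,8]) (Reduce [(0,6,7), (2,3,6),
    (4,5,7), (0,1,2), (0,3,5), (1,4,8)] [(0,1), (0,2), (1,2), (3,5), (4,5), (3,6), (4,7), (5,7),
    (6,7), (4,8)] [1,2])))) (Split 5 8 (Reduce [(1,2,8), (0,2,4), (1,4,5), (0,1,3), (0,5,7),
    (2,3,6)] [(0,2), (1,3), (1,4), (0,5), (3,6), (4,7), (6,7), (1,8), (6,8), (7,8)] [2,5]) (Split
    7 8 (Reduce [(1,2,8), (0,2,4), (1,4,5), (0,1,3), (0,5,7), (2,3,6)] [(0,1), (0,2), (1,2),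
    (3,5), (4,5), (3,6), (0,7), (6,8)] [1,2,7]) (Reduce [(1,2,8), (0,2,4), (1,4,5), (0,1,3),
    (0,5,7), (2,3,6)] [(0,1), (0,2), (1,2), (3,5), (4,5), (3,6), (4,7), (5,7), (6,7), (6,8)]
    [1,2]))))"]) code_simp

lemma r137: "refutable (cfg [[], [A], [A,A], [A,A,A], [A,A,A,N], [A,A,N,A,A], [A,N,A,A,U,U],
    [A,N,U,U,U,U,U]] [])"
  by (rule refutableI[OF dep[OF r132 dep[OF r22 dep[OF r136 dep[OF r131 dep[OF r91 no_deps]]]]],
    where t = "Split 4 6 (Use 0 [0,1,2,3,4,5,6,7]) (Split 4 7 (Split 5 6 (Use 0 [0,1,3,2,5,4,6,7])
    (Split 5 7 (Split 2 7 (Use 0 [0,1,4,2,5,3,7,6]) (Split 6 7 (Split 3 7 (Use 0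
    [0,1,5,3,4,2,7,6]) (Extend 1 (Use 1 [1,0,2,3,4,5]) (Split 2 8 (Use 2 [0,1,2,3,4,5,6,7,8])
    (Split 3 8 (Use 2 [0,1,3,2,5,4,6,7,8]) (Split 4 8 (Use 2 [0,1,4,5,2,3,7,6,8]) (Split 5 8 (Use
    2 [0,1,5,4,3,2,7,6,8]) (Use 3 [0,1,2,3,4,5,6,7,8]))))))) (Use 4 [0,2,6,1,4,3,5,7]))) (Use 4
    [0,1,5,2,3,4,6,7]))) (Use 4 [0,1,4,2,3,5,6,7]))"]) code_simp

lemma r138: "refutable (cfg [[], [A], [A,A], [A,A,A], [A,A,A,N], [A,A,N,A,A], [A,N,A,U,U,A],
    [A,N,N,A,A,N,U], [U,A,A,A,A,A,A,U]] [])"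
  by (rule refutableI[OF no_deps, where t = "Reduce [(0,3,7), (0,2,6), (5,6,8), (1,3,5), (0,1,4),
    (1,2,8)] [(1,2), (0,3), (0,4), (1,5), (2,6), (5,6), (6,7), (3,8), (4,8)] [3,4,8]"]) code_simp

lemma r139: "refutable (cfg [[], [A], [A,A], [A,A,A], [A,A,U,N], [A,A,N,A,A], [A,N,U,N,N,U],
    [A,U,N,A,U,N,U], [U,A,A,A,A,N,U,U]] [])"
  by (rule refutableI[OF no_deps, where t = "Reduce [(0,3,7), (1,3,5), (2,3,8), (1,4,8), (0,1,2),
    (0,4,5)] [(0,2), (1,3), (1,4), (0,5), (0,7), (2,8), (7,8)] [1,3,4]"]) code_simp

lemma r140: "refutable (cfg [[], [A], [A,A], [A,A,A], [A,A,A,N], [A,A,N,A,A], [A,N,A,N,N,A],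
    [A,N,N,A,A,N,U], [U,A,A,A,A,U,U,U]] [])"
  by (rule refutableI[OF dep[OF r138 dep[OF r139 no_deps]], where t = "Split 5 8 (Split 6 8 (Use 0
    [0,1,2,3,4,5,6,7,8]) (Split 7 8 (Use 0 [0,1,3,2,5,4,7,6,8]) (Reduce [(0,2,6), (0,3,7),
    (0,1,4), (2,4,8), (1,2,3), (1,5,8)] [(1,2), (0,3), (0,4), (1,5), (2,6), (5,6), (6,7), (1,8),
    (2,8), (5,8)] [3,4]))) (Use 1 [0,1,2,3,4,5,6,7,8])"]) code_simp

lemma r141: "refutable (cfg [[], [A], [A,A], [A,A,A], [A,A,A,U], [A,A,N,A,A], [A,N,A,N,U,A],
    [A,U,N,A,A,N,A], [U,A,A,A,N,N,A,U]] [])"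
  by (rule refutableI[OF no_deps, where t = "Split 7 8 (Reduce [(0,4,7), (1,2,4), (3,7,8),
    (0,2,3), (0,5,6), (1,3,5), (2,6,8)] [(0,1), (0,3), (1,3), (2,4), (4,5), (0,6), (4,7), (2,8),
    (7,8)] [1,3,6]) (Reduce [(0,3,7), (1,3,5), (2,3,8), (0,2,6), (0,4,5), (1,2,4)] [(0,1), (0,3),
    (1,3), (2,4), (4,5), (0,6), (4,7), (2,8)] [1,3,6])"]) code_simp

lemma r142: "refutable (cfg [[], [A], [A,A], [A,A,A], [A,A,A,N], [A,A,N,A,A], [A,N,A,N,N,A],
    [A,N,N,A,A,N,A], [U,A,A,A,U,U,U,U]] [])"
  by (rule refutableI[OF dep[OF r140 dep[OF r141 no_deps]], where t = "Split 4 8 (Use 0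
    [0,1,2,3,4,5,6,7,8]) (Split 5 8 (Use 0 [0,1,3,2,5,4,7,6,8]) (Split 6 8 (Use 1
    [0,1,2,3,4,5,6,7,8]) (Split 7 8 (Use 1 [0,1,3,2,5,4,7,6,8]) (Reduce [(0,2,6), (1,2,4),
    (2,3,8), (0,3,7), (0,4,5), (1,3,5)] [(0,1), (0,2), (1,2), (3,5), (4,5), (5,6), (3,7), (4,7),
    (6,7), (3,8)] [1,2]))))"]) code_simp

lemma r143: "refutable (cfg [[], [A], [A,A], [A,A,A], [A,A,U,N], [A,A,N,A,U], [A,N,A,N,N,A],
    [A,U,N,U,U,N,U], [U,A,A,N,N,A,N,U]] [])"
  by (rule refutableI[OF no_deps, where t = "Reduce [(0,2,6), (1,2,3), (1,5,8), (0,1,4), (0,3,5)]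
    [(0,2), (1,3), (1,4), (0,5), (0,7), (1,8)] [2,5]"]) code_simp

lemma r144: "refutable (cfg [[], [A], [A,A], [A,A,A], [A,A,A,N], [A,A,N,A,A], [A,N,A,N,N,A],
    [A,N,N,A,A,N,A], [U,A,U,U,U,N,U,U], [U,A,U,A,U,U,U,U,U]] [])"
  by (rule refutableI[OF dep[OF r142 dep[OF r91 no_deps]], where t = "Split 5 9 (Use 0
    [0,1,3,5,2,4,7,6,9]) (Use 1 [1,0,5,2,3,4,8,9])"]) code_simp

lemma r145: "refutable (cfg [[], [A], [A,A], [A,A,A], [A,A,A,N], [A,A,N,A,A], [A,N,A,N,N,A],
    [A,N,N,A,A,N,A], [U,A,A,U,U,U,U,U]] [])"
  by (rule refutableI[OF dep[OF r142 dep[OF r143 dep[OF r54 dep[OF r144 no_deps]]]], where t =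
    "Split 3 8 (Use 0 [0,1,2,3,4,5,6,7,8]) (Split 4 8 (Use 0 [0,1,2,4,3,5,6,7,8]) (Split 5 8
    (Split 6 8 (Reduce [(0,3,7), (1,2,3), (1,5,8), (0,1,4), (0,5,6), (2,6,8)] [(0,2), (1,3),
    (1,4), (0,5), (0,7), (1,8), (6,8)] [2,5,7]) (Use 1 [0,1,2,3,4,5,6,7,8])) (Extend 1 (Use 2
    [1,0,2,3,4,5,8]) (Split 3 9 (Use 3 [0,1,2,3,4,5,6,7,8,9]) (Use 3 [0,1,4,2,5,3,7,6,9,8])))))"])
    code_simp

lemma r146: "refutable (cfg [[], [A], [A,A], [A,A,A], [A,A,A,N], [A,A,N,A,A], [A,N,A,U,U,U],
    [A,N,U,U,U,U,U]] [])"
  by (rule refutableI[OF dep[OF r137 dep[OF r22 dep[OF r145 dep[OF r131 dep[OF r91 no_deps]]]]],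
    where t = "Split 3 6 (Use 0 [0,1,2,3,4,5,6,7]) (Split 3 7 (Split 4 6 (Use 0 [0,1,2,4,3,5,6,7])
    (Split 4 7 (Split 2 7 (Use 0 [0,1,2,3,4,5,7,6]) (Split 5 7 (Use 0 [0,1,3,5,2,4,7,6]) (Split 5
    6 (Split 6 7 (Extend 1 (Use 1 [1,0,2,3,4,5]) (Split 2 8 (Use 2 [0,1,2,3,4,5,6,7,8]) (Split 3 8
    (Use 2 [0,1,3,2,5,4,7,6,8]) (Split 4 8 (Use 2 [0,1,4,2,5,3,7,6,8]) (Split 5 8 (Use 2
    [0,1,5,3,4,2,6,7,8]) (Use 3 [0,1,2,3,4,5,6,7,8])))))) (Reduce [(0,2,6), (1,2,3), (0,3,5),
    (0,4,7), (1,4,5)] [(1,2), (0,3), (0,4), (1,5), (2,6), (5,6)] [3,4])) (Use 4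
    [0,1,5,2,3,4,6,7])))) (Use 4 [0,1,4,2,3,5,6,7]))) (Use 4 [0,1,3,2,4,5,6,7]))"]) code_simp

lemma r147: "refutable (cfg [[], [A], [A,A], [A,A,A], [A,A,A,N], [A,A,N,A,A], [A,U,U,U,U,U],
    [A,U,U,U,U,U,U]] [])"
  by (rule refutableI[OF dep[OF r125 dep[OF r146 dep[OF r91 no_deps]]], where t = "Split 1 6 (Use
    0 [0,1,2,3,4,5,6,7]) (Split 1 7 (Use 0 [0,1,2,3,4,5,7,6]) (Split 2 6 (Use 1 [0,1,2,3,4,5,6,7])
    (Split 2 7 (Use 1 [0,1,2,3,4,5,7,6]) (Use 2 [0,1,2,3,5,4,6,7]))))"]) code_simp

lemma r148: "refutable (cfg [[], [A], [A,A], [A,A,A], [A,A,A,N], [A,A,N,A,N], [A,A,N,N,A,U],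
    [A,N,A,A,U,U,U]] [])"
  by (rule refutableI[OF dep[OF r147 dep[OF r91 no_deps]], where t = "Split 4 7 (Use 0
    [0,2,1,3,4,7,5,6]) (Split 6 7 (Split 5 7 (Use 0 [0,3,1,2,5,7,4,6]) (Reduce [(0,6,7), (2,3,7),
    (1,4,6), (0,2,4), (0,1,3)] [(0,1), (2,3), (2,4), (3,5), (4,6), (5,6), (2,7), (3,7), (6,7)]
    [1])) (Use 1 [0,3,7,1,5,2,4,6]))"]) code_simp

lemma r149: "refutable (cfg [[], [A], [A,A], [A,A,A], [A,A,A,N], [A,A,N,A,N], [A,A,N,N,A,A],
    [A,N,A,U,U,U,U]] [])"
  by (rule refutableI[OF dep[OF r148 no_deps], where t = "Split 3 7 (Use 0 [0,1,2,3,4,5,6,7])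
    (Split 4 7 (Use 0 [0,1,2,4,3,6,5,7]) (Reduce [(0,2,7), (1,2,3), (0,3,5), (1,5,6), (0,1,4)]
    [(0,1), (2,3), (2,4), (3,5), (4,6), (5,6), (2,7), (5,7), (6,7)] [1]))"]) code_simp

lemma r150: "refutable (cfg [[], [A], [A,A], [A,A,A], [A,A,A,N], [A,A,N,A,N], [A,A,U,U,U,U],
    [A,U,U,U,U,U,U]] [])"
  by (rule refutableI[OF dep[OF r124 dep[OF r147 dep[OF r149 dep[OF r91 dep[OF r82 no_deps]]]]],
    where t = "Split 2 6 (Use 0 [0,1,2,3,4,6,5,7]) (Split 4 6 (Split 3 6 (Use 1 [0,1,2,3,4,6,5,7])
    (Split 5 6 (Split 1 7 (Split 2 7 (Use 0 [0,1,2,3,4,7,5,6]) (Reduce [(0,1,7), (0,2,3), (0,4,6),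
    (1,2,4), (1,3,5)] [(0,1), (2,3), (2,4), (3,5), (4,6), (5,6), (3,7), (4,7), (5,7), (6,7)] []))
    (Split 2 7 (Use 2 [0,1,2,3,4,5,6,7]) (Split 3 7 (Use 2 [0,1,3,2,5,4,6,7]) (Use 3
    [0,2,3,1,4,5,6,7])))) (Use 4 [0,1,2,4,6,5,3,7]))) (Use 4 [0,1,3,2,4,6,5,7]))"]) code_simp

text \<open>The vertex 8, which saturation makes nonadjacent to 0, completes a 4-wheel around the
  centre 1, with hub 2 and rim 0, 3, 8, 4. A seventh neighbour of 1 exists by \<open>r54\<close>,
  and then \<open>r147\<close> applies.\<close>

lemma r151: "refutable (cfg [[], [A], [A,A], [A,A,A], [A,A,A,N], [A,A,U,U,U], [A,N,U,U,U,U],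
    [A,N,U,U,U,U,U], [U,A,A,A,A,U,U,U]] [])"
  by (rule refutableI[OF dep[OF r54 dep[OF r147 no_deps]], where t = "Extend 1 (Use 0
    [1,0,2,3,4,5,8]) (Use 1 [1,2,0,3,4,8,5,9])"]) code_simp

lemma r152: "refutable (cfg [[], [A], [A,A], [A,A,A], [A,A,A,N], [A,A,U,A,N], [A,U,A,A,N,N],
    [A,U,U,N,A,A,A], [U,A,A,U,N,U,N,A], [U,A,U,N,U,A,U,N,U], [U,U,A,N,A,N,A,U,U,U]] [])"
  by (rule refutableI[OF no_deps, where t = "Split 7 10 (Reduce [(0,5,7), (1,3,5), (4,7,10),
    (2,6,10), (0,3,6), (0,1,2)] [(0,2), (1,3), (1,4), (1,5), (3,5), (3,6), (0,7), (2,8), (7,8),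
    (4,10), (6,10)] [7]) (Reduce [(1,2,8), (0,1,4), (1,5,9), (0,3,5), (0,6,7), (2,3,6)] [(0,1),
    (2,3), (0,4), (1,4), (3,5), (0,6), (5,7), (1,8), (5,9), (2,10)] [6])"]) code_simp

lemma r153: "refutable (cfg [[], [A], [A,A], [A,A,A], [A,A,A,N], [A,A,N,A,N], [A,N,A,A,N,N],
    [A,N,N,N,A,A,A], [U,A,A,A,N,N,N,A], [U,A,N,N,A,A,A,U,U]] [])"
  by (rule refutableI[OF dep[OF r115 dep[OF r54 dep[OF r150 dep[OF r91 dep[OF r152 no_deps]]]]],
    where t = "Split 7 9 (Use 0 [0,7,9,4,5,6,1,2,8]) (Split 8 9 (Extend 2 (Use 1 [2,0,1,3,4,6,8])
    (Split 4 10 (Split 6 10 (Split 3 10 (Use 2 [2,3,0,1,6,8,10,4]) (Split 5 10 (Split 7 10 (Use 0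
    [0,7,10,4,5,6,1,2,8]) (Split 8 10 (Split 9 10 (Use 0 [1,9,10,4,5,8,0,2,6]) (Reduce [(1,2,8),
    (0,4,7), (1,4,9), (2,4,10), (0,1,3), (0,2,6)] [(1,2), (1,3), (2,3), (0,4), (0,5), (0,6),
    (1,9), (2,10)] [4])) (Use 3 [2,1,8,0,4,3,6,10]))) (Use 4 [0,1,2,3,4,5,6,7,8,9,10]))) (Use 3
    [2,0,6,1,4,3,8,10])) (Use 3 [2,0,4,3,6,1,8,10]))) (Use 3 [1,2,8,0,4,3,5,9]))"]) code_simp

lemma r154: "refutable (cfg [[], [A], [A,A], [U,A,U], [A,A,U,N], [U,A,U,A,N], [U,N,U,U,U,U],
    [U,N,U,U,U,U,U], [U,A,A,N,U,N,U,U]] [])"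
  by (rule refutableI[OF dep[OF r54 dep[OF r82 no_deps]], where t = "Extend 1 (Use 0
    [1,0,2,3,4,5,8]) (Use 1 [1,0,2,3,5,4,8,9])"]) code_simp

text \<open>Both 1 and 2 serve as further centres: by \<open>r54\<close> each has a seventh
  neighbour, named 9 for vertex 1 and 10 for vertex 2 in the branches that need them.\<close>

lemma r155: "refutable (cfg [[], [A], [A,A], [A,A,A], [A,A,A,N], [A,A,N,A,N], [A,N,A,A,N,N],
    [A,N,N,N,A,A,A], [U,A,A,U,U,U,U,U]] [])"
  by (rule refutableI[OF dep[OF r151 dep[OF r54 dep[OF r150 dep[OF r153 dep[OF r152 dep[OF r91
    dep[OF r154 no_deps]]]]]]], where t = "Split 3 8 (Split 4 8 (Use 0 [0,1,2,3,4,5,6,7,8]) (Split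
    5 8 (Use 0 [0,1,3,2,5,4,6,7,8]) (Split 6 8 (Use 0 [0,2,3,1,6,4,5,7,8]) (Split 7 8 (Extend 1
    (Use 1 [1,0,2,3,4,5,8]) (Split 4 9 (Split 5 9 (Split 2 9 (Use 2 [1,2,0,3,4,8,9,5]) (Split 3 9
    (Use 2 [1,3,0,2,5,8,9,4]) (Split 6 9 (Use 3 [0,1,2,3,4,5,6,7,8,9]) (Split 7 9 (Reduce
    [(0,6,7), (2,3,6), (4,7,9), (1,5,9), (0,3,5), (0,1,2)] [(0,1), (2,3), (2,4), (3,5), (2,6),
    (3,6), (0,7), (1,8), (7,8), (4,9), (5,9)] [7]) (Extend 2 (Use 1 [2,0,1,3,4,6,8]) (Split 4 10
    (Split 6 10 (Split 3 10 (Use 2 [2,3,0,1,6,8,10,4]) (Split 5 10 (Use 3 [0,2,1,3,4,6,5,7,8,10])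
    (Use 4 [0,1,2,3,4,5,6,7,8,9,10]))) (Use 5 [2,0,6,1,4,3,8,10])) (Use 5
    [2,0,4,3,6,1,8,10]))))))) (Use 5 [1,0,5,2,4,3,8,9])) (Use 5 [1,0,4,3,5,2,8,9]))) (Extend 1
    (Use 1 [1,0,2,3,4,5,8]) (Split 4 9 (Split 2 9 (Use 2 [1,2,0,3,4,8,9,5]) (Split 3 9 (Use 2
    [1,3,0,2,5,8,9,4]) (Extend 2 (Use 1 [2,0,1,3,4,6,8]) (Split 4 10 (Split 3 10 (Use 2
    [2,3,0,1,6,8,10,4]) (Reduce [(1,4,9), (2,4,10), (0,4,7), (0,3,5), (0,1,2), (1,3,8), (2,3,6)]
    [(1,2), (0,3), (0,4), (1,5), (2,6), (5,7), (6,7), (1,8), (2,8), (4,9), (4,10)] [3,4])) (Use 5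
    [2,0,4,3,6,1,8,10]))))) (Use 5 [1,0,4,3,5,2,8,9]))))))) (Split 4 8 (Split 5 8 (Split 6 8
    (Extend 1 (Use 1 [1,0,2,3,4,5,8]) (Split 3 9 (Reduce [(1,3,9), (0,3,5), (1,5,8), (2,3,6),
    (0,6,7), (2,4,8), (0,1,2)] [(1,2), (0,3), (1,4), (2,4), (1,5), (2,6), (4,7), (5,7), (6,7),
    (3,9), (8,9)] [3,8]) (Use 5 [1,0,3,2,4,5,8,9]))) (Split 7 8 (Reduce [(0,6,7), (2,3,6),
    (4,7,8), (1,2,8), (0,2,4), (0,1,3)] [(0,1), (0,2), (1,2), (3,5), (3,6), (0,7), (4,8), (5,8)]
    [1,2,7]) (Reduce [(0,4,7), (1,5,8), (0,3,5), (0,1,2), (2,3,6), (2,4,8)] [(0,1), (0,2), (1,2),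
    (3,5), (3,6), (4,7), (5,7), (6,7), (4,8), (5,8)] [1,2]))) (Use 6 [0,1,2,3,4,5,6,7,8])) (Split
    5 8 (Split 6 8 (Split 7 8 (Reduce [(0,4,7), (1,2,4), (1,5,8), (0,1,3), (0,2,6), (6,7,8)]
    [(0,1), (0,2), (1,2), (3,5), (3,6), (0,7), (5,8), (6,8)] [1,2,7]) (Reduce [(0,5,7), (1,5,8),
    (2,6,8), (0,3,6), (1,2,3), (0,1,4)] [(0,1), (0,2), (1,2), (3,5), (3,6), (4,7), (5,7), (6,7),
    (5,8), (6,8)] [1,2])) (Use 6 [0,2,1,3,4,6,5,7,8])) (Use 6 [0,1,2,3,4,5,6,7,8])))"]) code_simp

lemma r156: "refutable (cfg [[], [A], [A,A], [A,A,A], [A,A,A,N], [A,A,N,A,N], [A,N,A,A,U,U],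
    [A,N,U,U,U,U,U]] [])"
  by (rule refutableI[OF dep[OF r147 dep[OF r150 dep[OF r22 dep[OF r155 dep[OF r54 dep[OF r91
    no_deps]]]]]], where t = "Split 4 6 (Use 0 [0,2,1,3,4,6,5,7]) (Split 4 7 (Split 5 6 (Use 0
    [0,3,1,2,5,6,4,7]) (Split 5 7 (Split 2 7 (Use 1 [0,2,1,3,4,6,7,5]) (Split 6 7 (Split 3 7 (Use
    1 [0,3,1,2,5,6,7,4]) (Extend 1 (Use 2 [1,0,2,3,4,5]) (Split 2 8 (Use 3 [0,1,2,3,4,5,6,7,8])
    (Extend 1 (Use 4 [1,0,2,3,4,5,8]) (Split 2 9 (Use 3 [0,1,2,3,4,5,6,7,9]) (Use 5
    [1,0,2,3,5,4,8,9])))))) (Use 5 [0,2,6,1,4,3,5,7]))) (Use 5 [0,1,5,2,4,3,6,7]))) (Use 5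
    [0,1,4,3,5,2,6,7]))"]) code_simp

lemma r157: "refutable (cfg [[], [A], [A,A], [A,A,A], [A,A,A,N], [A,A,N,A,N], [A,N,A,N,A,U],
    [A,N,N,A,U,A,A], [U,A,A,A,U,U,U,U]] [])"
  by (rule refutableI[OF dep[OF r151 dep[OF r154 no_deps]], where t = "Split 4 8 (Use 0
    [0,1,2,3,4,5,6,7,8]) (Split 6 8 (Reduce [(2,6,8), (1,3,8), (0,1,5), (1,2,4), (0,2,3), (3,5,7),
    (0,4,6)] [(0,1), (0,3), (1,3), (2,4), (0,6), (4,7), (5,7), (2,8), (5,8), (7,8)] [1,3,6]) (Use
    1 [0,2,1,4,3,6,5,7,8]))"]) code_simp

lemma r158: "refutable (cfg [[], [A], [A,A], [A,A,A], [A,A,A,N], [A,A,N,A,N], [A,N,A,N,A,A],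
    [A,N,N,A,A,A,A], [U,A,A,U,U,U,U,U]] [])"
  by (rule refutableI[OF dep[OF r157 dep[OF r154 no_deps]], where t = "Split 3 8 (Use 0
    [0,1,2,3,4,5,6,7,8]) (Split 5 8 (Split 4 8 (Use 0 [0,2,1,4,3,6,5,7,8]) (Split 6 8 (Reduce
    [(0,1,4), (2,4,6), (0,2,3), (1,2,8), (1,3,5), (5,6,8), (0,5,7)] [(0,1), (0,2), (1,2), (3,5),
    (4,6), (5,6), (0,7), (5,8), (6,8)] [1,2,7]) (Use 1 [0,2,1,4,3,6,5,7,8]))) (Use 1
    [0,1,2,3,4,5,6,7,8]))"]) code_simp

lemma r159: "refutable (cfg [[], [A], [A,A], [A,A,A], [A,A,A,N], [A,A,N,A,N], [A,N,A,N,A,A],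
    [A,N,N,A,A,A,A], [U,A,N,N,A,U,U,U]] [])"
  by (rule refutableI[OF dep[OF r158 dep[OF r154 no_deps]], where t = "Split 5 8 (Split 6 8 (Use 0
    [0,4,6,2,7,1,5,3,8]) (Reduce [(1,4,8), (0,1,2), (1,3,5), (0,3,7), (0,4,6), (5,6,7)] [(1,2),
    (1,3), (2,3), (0,4), (0,5), (2,6), (3,7), (6,7), (1,8), (7,8)] [4,5])) (Use 1
    [0,1,2,4,5,8,6,7,3])"]) code_simp

lemma r160: "refutable (cfg [[], [A], [A,A], [A,A,A], [A,A,A,N], [A,A,N,A,N], [A,N,A,N,A,A],
    [A,N,N,A,A,A,N], [U,A,A,U,U,U,U,U]] [])"
  by (rule refutableI[OF dep[OF r151 dep[OF r154 no_deps]], where t = "Split 3 8 (Split 4 8 (Use 0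
    [0,1,2,3,4,5,6,7,8]) (Split 6 8 (Reduce [(0,4,7), (1,2,4), (1,3,8), (0,1,5), (0,2,3), (2,6,8),
    (3,5,7)] [(0,2), (1,3), (1,4), (0,5), (4,6), (3,7), (4,7), (1,8), (3,8), (6,8), (7,8)] [2,5])
    (Use 1 [0,2,1,4,3,6,5,7,8]))) (Split 5 8 (Split 7 8 (Reduce [(1,2,8), (0,1,4), (1,3,5),
    (0,2,3), (0,5,6), (2,4,6), (5,7,8)] [(0,2), (1,3), (1,4), (0,5), (4,6), (3,7), (4,7), (1,8),
    (4,8), (6,8), (7,8)] [2,5]) (Use 1 [0,5,1,3,6,7,2,4,8])) (Use 1 [0,1,2,3,4,5,6,7,8]))"])
    code_simp

lemma r161: "refutable (cfg [[], [A], [A,A], [A,A,A], [A,A,A,N], [A,A,U,A,N], [A,N,A,N,A,A],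
    [A,N,N,A,A,A,N], [U,A,N,N,A,U,U,U]] [])"
  by (rule refutableI[OF dep[OF r154 no_deps], where t = "Split 5 8 (Reduce [(0,4,7), (3,5,7),
    (2,4,6), (0,5,6), (1,4,8), (0,1,2)] [(1,2), (1,3), (2,3), (0,4), (0,5), (2,6), (3,7), (1,8),
    (6,8), (7,8)] [4,5]) (Use 0 [0,1,2,4,5,8,6,7,3])"]) code_simp

lemma r162: "refutable (cfg [[], [A], [A,A], [A,A,A], [A,A,A,N], [A,A,N,A,N], [A,N,A,N,A,A],
    [A,N,N,A,A,A,U]] [])"
  by (rule refutableI[OF dep[OF r22 dep[OF r158 dep[OF r159 dep[OF r131 dep[OF r160 dep[OF r161
    no_deps]]]]]], where t = "Split 6 7 (Extend 1 (Use 0 [1,0,2,3,4,5]) (Split 2 8 (Use 1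
    [0,1,2,3,4,5,6,7,8]) (Split 3 8 (Use 1 [0,1,3,2,5,4,7,6,8]) (Split 4 8 (Use 2
    [0,1,2,3,4,5,6,7,8]) (Split 5 8 (Use 2 [0,1,3,2,5,4,7,6,8]) (Use 3 [0,1,2,3,4,5,6,7,8]))))))
    (Extend 1 (Use 0 [1,0,2,3,4,5]) (Split 2 8 (Use 4 [0,1,2,3,4,5,6,7,8]) (Split 3 8 (Use 4
    [0,1,3,2,5,4,7,6,8]) (Split 4 8 (Use 5 [0,1,2,3,4,5,6,7,8]) (Split 5 8 (Use 5
    [0,1,3,2,5,4,7,6,8]) (Use 3 [0,1,2,3,4,5,6,7,8]))))))"]) code_simp

lemma r163: "refutable (cfg [[], [A], [A,A], [A,A,A], [A,A,A,N], [A,A,N,A,N], [A,N,A,N,A,A],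
    [A,N,N,A,A,U,U]] [])"
  by (rule refutableI[OF dep[OF r162 no_deps], where t = "Split 5 7 (Use 0 [0,1,2,3,4,5,6,7])
    (Split 6 7 (Use 0 [0,2,1,4,3,6,5,7]) (Reduce [(0,3,7), (1,2,3), (0,1,4), (0,5,6), (2,4,6)]
    [(1,2), (0,3), (0,4), (1,5), (2,6), (5,6)] [3,4]))"]) code_simp

lemma r164: "refutable (cfg [[], [A], [A,A], [A,A,A], [A,A,A,N], [A,A,N,A,N], [A,N,A,N,N,A],
    [A,N,N,A,A,N,A], [U,A,A,U,U,U,U,U]] [])"
  by (rule refutableI[OF dep[OF r151 dep[OF r154 dep[OF r139 dep[OF r143 no_deps]]]], where t =
    "Split 3 8 (Split 4 8 (Use 0 [0,1,2,3,4,5,6,7,8]) (Split 6 8 (Split 5 8 (Use 0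
    [0,1,3,2,5,4,6,7,8]) (Reduce [(0,4,7), (1,2,4), (1,3,8), (0,1,5), (0,2,3), (2,6,8)] [(0,1),
    (0,3), (1,3), (2,4), (0,6), (4,7), (2,8), (7,8)] [1,3,6])) (Use 1 [0,2,1,3,6,8,5,7,4])))
    (Split 5 8 (Split 4 8 (Use 2 [0,1,4,2,5,3,7,6,8]) (Split 6 8 (Use 1 [0,2,1,6,3,8,5,7,4]) (Use
    3 [0,1,2,3,4,5,6,7,8]))) (Use 1 [0,1,2,3,4,5,6,7,8]))"]) code_simp

lemma r165: "refutable (cfg [[], [A], [A,A], [A,A,A], [A,A,A,N], [A,A,N,A,N], [A,N,A,U,U,U],
    [A,N,U,U,U,U,U]] [])"
  by (rule refutableI[OF dep[OF r156 dep[OF r163 dep[OF r22 dep[OF r164 dep[OF r54 dep[OF r91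
    dep[OF r82 no_deps]]]]]]], where t = "Split 3 6 (Use 0 [0,1,2,3,4,5,6,7]) (Split 5 6 (Split 3
    7 (Split 2 7 (Use 0 [0,1,2,3,4,5,7,6]) (Split 4 7 (Split 4 6 (Use 1 [0,1,2,3,4,5,6,7]) (Split
    5 7 (Use 1 [0,1,3,2,5,4,7,6]) (Split 6 7 (Extend 1 (Use 2 [1,0,2,3,4,5]) (Split 2 8 (Use 3
    [0,1,2,3,4,5,6,7,8]) (Extend 1 (Use 4 [1,0,2,3,4,5,8]) (Split 2 9 (Use 3 [0,1,2,3,4,5,6,7,9])
    (Use 5 [1,0,2,3,5,4,8,9]))))) (Use 5 [0,4,7,1,2,3,5,6])))) (Use 6 [0,1,3,2,4,5,7,6]))) (Use 5
    [0,1,3,2,4,5,6,7])) (Use 6 [0,1,2,3,5,4,6,7]))"]) code_simp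

lemma r166: "refutable (cfg [[], [A], [A,A], [A,A,A], [A,A,A,N], [A,A,N,A,U], [A,U,U,U,U,U],
    [A,U,U,U,U,U,U]] [])"
  by (rule refutableI[OF dep[OF r147 dep[OF r150 dep[OF r165 dep[OF r91 no_deps]]]], where t =
    "Split 4 5 (Use 0 [0,1,2,3,4,5,6,7]) (Split 1 6 (Use 1 [0,1,2,3,4,5,6,7]) (Split 1 7 (Use 1
    [0,1,2,3,4,5,7,6]) (Split 2 6 (Use 2 [0,1,2,3,4,5,6,7]) (Split 2 7 (Use 2 [0,1,2,3,4,5,7,6])
    (Use 3 [0,1,2,3,5,4,6,7])))))"]) code_simp

section \<open>Centre of degree 7: two triangles on a common edge in the neighbourhood\<close>

lemma r167: "refutable (cfg [[], [A], [A,A], [A,A,A], [A,A,A,N], [A,A,N,N,N], [A,A,U,U,U,U],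
    [A,U,U,U,U,U,U]] [])"
  by (rule refutableI[OF dep[OF r124 dep[OF r166 dep[OF r94 no_deps]]], where t = "Split 2 6 (Use
    0 [0,1,2,3,4,6,5,7]) (Split 3 6 (Use 1 [0,1,2,3,4,6,5,7]) (Split 4 6 (Use 1 [0,1,2,4,3,6,5,7])
    (Use 2 [0,1,2,3,4,6,5,7])))"]) code_simp

lemma r168: "refutable (cfg [[], [A], [A,A], [A,A,A], [A,A,A,N], [A,A,U,N,N], [A,N,A,U,U,U],
    [A,U,U,U,U,U,U]] [])"
  by (rule refutableI[OF dep[OF r166 dep[OF r82 dep[OF r99 dep[OF r101 no_deps]]]], where t =
    "Split 3 6 (Use 0 [0,2,1,3,4,6,5,7]) (Split 4 6 (Use 0 [0,2,1,4,3,6,5,7]) (Split 5 6 (Use 1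
    [0,1,2,5,6,3,4,7]) (Split 3 7 (Use 2 [0,2,1,3,4,5,6,7]) (Use 3 [0,1,2,3,6,4,5,7]))))"])
    code_simp

lemma r169: "refutable (cfg [[], [A], [A,A], [A,A,A], [A,A,A,N], [A,A,N,U,U], [A,N,N,A,A,U],
    [A,N,N,A,A,N,A]] [])"
  by (rule refutableI[OF no_deps, where t = "Reduce [(0,1,5), (1,2,3), (0,2,4), (4,6,7), (0,3,6)]
    [(1,2), (0,3), (0,4), (1,5), (5,6), (6,7)] [3,4]"]) code_simp

lemma r170: "refutable (cfg [[], [A], [A,A], [A,A,A], [A,A,A,N], [A,A,N,N,N], [A,N,N,A,U,U],
    [A,N,N,U,U,U,U]] [])"
  by (rule refutableI[OF dep[OF r124 dep[OF r169 dep[OF r81 dep[OF r91 dep[OF r82 no_deps]]]]],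
    where t = "Split 4 6 (Split 3 7 (Split 4 7 (Split 6 7 (Split 5 6 (Split 5 7 (Use 0
    [0,6,7,3,4,5,1,2]) (Use 1 [0,1,2,3,4,5,6,7])) (Use 1 [0,1,2,3,4,5,7,6])) (Use 2
    [0,3,4,1,2,6,7,5])) (Use 3 [0,2,4,1,3,6,5,7])) (Use 3 [0,2,3,1,4,6,5,7])) (Use 4
    [0,1,3,2,4,5,6,7])"]) code_simp

lemma r171: "refutable (cfg [[], [A], [A,A], [A,A,A], [A,A,A,N], [A,A,U,U,U], [A,U,U,U,U,U],
    [A,U,U,U,U,U,U]] [])"
  by (rule refutableI[OF dep[OF r124 dep[OF r166 dep[OF r167 dep[OF r168 dep[OF r170 dep[OF r94
    no_deps]]]]]], where t = "Split 2 5 (Use 0 [0,1,2,3,4,5,6,7]) (Split 3 5 (Use 1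
    [0,1,2,3,4,5,6,7]) (Split 4 5 (Use 1 [0,1,2,4,3,5,6,7]) (Split 1 6 (Use 2 [0,1,2,3,4,5,6,7])
    (Split 1 7 (Use 2 [0,1,2,3,4,5,7,6]) (Split 2 6 (Use 3 [0,1,2,3,4,5,6,7]) (Split 2 7 (Use 3
    [0,1,2,3,4,5,7,6]) (Split 3 6 (Use 4 [0,1,2,3,4,5,6,7]) (Split 4 6 (Use 4 [0,1,2,4,3,5,6,7])
    (Use 5 [0,1,2,3,4,6,5,7])))))))))"]) code_simp

lemma r172: "refutable (cfg [[], [A], [A,A], [A,A,A], [A,A,U,U], [A,N,N,A,U], [A,N,N,U,N,U],
    [A,N,U,U,U,U,U]] [])"
  by (rule refutableI[OF dep[OF r72 dep[OF r91 dep[OF r94 no_deps]]], where t = "Split 4 5 (Split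
    4 7 (Use 0 [0,4,1,2,7,3,5,6]) (Use 1 [0,1,4,2,3,5,6,7])) (Use 2 [0,3,1,2,4,6,5,7])"])
    code_simp

lemma r173: "refutable (cfg [[], [A], [A,A], [A,A,A], [A,A,U,U], [A,N,N,A,U], [A,N,N,U,U,U],
    [A,N,N,U,U,U,U]] [])"
  by (rule refutableI[OF dep[OF r72 dep[OF r172 no_deps]], where t = "Split 4 6 (Use 0
    [0,4,1,2,6,3,5,7]) (Use 1 [0,1,2,3,4,5,6,7])"]) code_simp

lemma r174: "refutable (cfg [[], [A], [A,A], [A,A,A], [A,A,A,U], [A,U,U,U,U], [A,U,U,U,U,U],
    [A,U,U,U,U,U,U]] [])"
  by (rule refutableI[OF dep[OF r98 dep[OF r171 dep[OF r173 dep[OF r78 no_deps]]]], where t =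
    "Split 3 4 (Use 0 [0,1,2,3,4,5,6,7]) (Split 1 5 (Use 1 [0,1,2,3,4,5,6,7]) (Split 2 5 (Use 1
    [0,2,1,3,4,5,6,7]) (Split 1 6 (Use 1 [0,1,2,3,4,6,5,7]) (Split 2 6 (Use 1 [0,2,1,3,4,6,5,7])
    (Split 1 7 (Use 1 [0,1,2,3,4,7,5,6]) (Split 2 7 (Use 1 [0,2,1,3,4,7,5,6]) (Split 3 5 (Use 2
    [0,1,2,3,4,5,6,7]) (Split 4 5 (Use 2 [0,1,2,4,3,5,6,7]) (Split 3 6 (Use 2 [0,1,2,3,4,6,5,7])
    (Use 3 [0,1,3,2,4,7,5,6]))))))))))"]) code_simp

section \<open>Centre of degree 7: a triangle in the neighbourhood\<close>

lemma r175: "refutable (cfg [[], [A], [A,A], [A,A,A], [A,A,N,N], [A,A,N,N,A], [A,N,U,N,U,U],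
    [A,N,U,U,U,U,U]] [])"
  by (rule refutableI[OF dep[OF r174 dep[OF r172 dep[OF r91 no_deps]]], where t = "Split 3 7
    (Split 4 7 (Split 5 7 (Use 0 [0,4,5,1,7,2,3,6]) (Use 1 [0,3,2,1,7,4,5,6])) (Use 1
    [0,3,2,1,7,5,4,6])) (Use 2 [0,1,3,4,5,2,6,7])"]) code_simp

lemma r176: "refutable (cfg [[], [A], [A,U], [A,U,A], [A,U,N,N], [A,A,N,N,N], [A,U,U,U,U,U],
    [A,U,U,U,U,U,U]] [])"
  by (rule refutableI[OF dep[OF r81 dep[OF r93 no_deps]], where t = "Split 4 6 (Use 0
    [0,6,1,2,3,4,5,7]) (Use 1 [0,1,2,3,6,4,5,7])"]) code_simp

lemma r177: "refutable (cfg [[], [A], [A,A], [A,A,A], [A,A,N,N], [A,A,U,U,U], [A,U,U,U,U,U],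
    [A,U,U,U,U,U,U]] [])"
  by (rule refutableI[OF dep[OF r174 dep[OF r61 dep[OF r175 dep[OF r176 no_deps]]]], where t =
    "Split 2 5 (Use 0 [0,1,2,3,5,4,6,7]) (Split 3 5 (Use 0 [0,1,3,2,5,4,6,7]) (Split 4 5 (Split 1
    6 (Use 1 [0,1,2,3,6,7,4,5]) (Split 1 7 (Use 1 [0,1,2,3,7,6,4,5]) (Split 2 6 (Split 3 6 (Use 0
    [0,2,3,1,6,4,5,7]) (Use 2 [0,1,2,3,4,5,6,7])) (Use 2 [0,1,3,2,4,5,6,7])))) (Use 3
    [0,1,2,3,4,5,6,7])))"]) code_simp

lemma r178: "refutable (cfg [[], [A], [A,A], [A,A,A], [A,A,U,U], [A,N,A,N,A], [A,N,N,U,U,U],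
    [A,N,N,U,U,U,U]] [])"
  by (rule refutableI[OF dep[OF r72 dep[OF r173 no_deps]], where t = "Split 3 6 (Use 0
    [0,4,1,2,5,3,6,7]) (Split 3 7 (Use 0 [0,4,1,2,5,3,7,6]) (Use 1 [0,1,3,2,4,5,6,7]))"])
    code_simp

lemma r179: "refutable (cfg [[], [A], [A,A], [A,A,A], [A,A,U,U], [A,N,A,N,N], [A,N,N,A,U,U],
    [A,N,U,U,U,U,U]] [])"
  by (rule refutableI[OF dep[OF r177 dep[OF r178 dep[OF r82 no_deps]]], where t = "Split 4 6
    (Split 3 7 (Use 0 [0,3,1,2,6,7,4,5]) (Use 1 [0,1,3,2,4,6,5,7])) (Use 2 [0,2,3,1,4,5,6,7])"])
    code_simp

lemma r180: "refutable (cfg [[], [A], [A,A], [A,A,A], [A,A,U,U], [A,N,A,U,U], [A,N,U,U,U,U],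
    [A,N,U,U,U,U,U]] [])"
  by (rule refutableI[OF dep[OF r174 dep[OF r177 dep[OF r178 dep[OF r179 dep[OF r173 no_deps]]]]],
    where t = "Split 3 5 (Use 0 [0,2,3,1,5,4,6,7]) (Split 2 6 (Use 1 [0,2,1,3,5,6,4,7]) (Split 2 7
    (Use 1 [0,2,1,3,5,7,4,6]) (Split 4 5 (Use 2 [0,1,2,3,4,5,6,7]) (Split 3 6 (Use 3
    [0,1,2,3,4,5,6,7]) (Split 3 7 (Use 3 [0,1,2,3,4,5,7,6]) (Use 4 [0,1,3,2,4,5,6,7]))))))"])
    code_simp

lemma r181: "refutable (cfg [[], [A], [A,A], [A,A,A], [A,A,U,U], [A,U,U,U,U], [A,U,U,U,U,U],
    [A,U,U,U,U,U,U]] [])"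
  by (rule refutableI[OF dep[OF r174 dep[OF r177 dep[OF r180 dep[OF r61 dep[OF r176 no_deps]]]]],
    where t = "Split 2 4 (Use 0 [0,1,2,3,4,5,6,7]) (Split 3 4 (Use 0 [0,1,3,2,4,5,6,7]) (Split 1 5
    (Use 1 [0,1,2,3,4,5,6,7]) (Split 1 6 (Use 1 [0,1,2,3,4,6,5,7]) (Split 1 7 (Use 1
    [0,1,2,3,4,7,5,6]) (Split 2 5 (Use 2 [0,1,2,3,4,5,6,7]) (Split 3 5 (Use 2 [0,1,3,2,4,5,6,7])
    (Split 4 5 (Split 2 6 (Use 2 [0,1,2,3,4,6,5,7]) (Split 5 6 (Split 3 6 (Use 2
    [0,1,3,2,4,6,5,7]) (Use 3 [0,1,2,3,4,7,5,6])) (Use 4 [0,4,1,2,6,5,3,7]))) (Use 4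
    [0,1,2,3,5,4,6,7]))))))))"]) code_simp

text \<open>The matching is 12 alone: only 3 can be attached to it, so 3 is a cover.\<close>

lemma r182: "refutable (cfg [[], [A], [A,A], [A,U,U], [A,N,N,U], [A,N,N,U,U], [A,N,N,U,U,U],
    [A,N,N,U,U,U,U]] [])"
  by (rule refutableI[OF no_deps, where t = "Reduce [(0,1,2)] [(1,2), (0,3)] []"]) code_simp

lemma r183: "refutable (cfg [[], [A], [A,A], [A,A,A], [A,U,U,U], [A,U,U,U,U], [A,U,U,U,U,U],
    [A,U,U,U,U,U,U]] [])"
  by (rule refutableI[OF dep[OF r181 dep[OF r182 no_deps]], where t = "Split 1 4 (Use 0
    [0,1,2,3,4,5,6,7]) (Split 2 4 (Use 0 [0,2,1,3,4,5,6,7]) (Split 1 5 (Use 0 [0,1,2,3,5,4,6,7])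
    (Split 2 5 (Use 0 [0,2,1,3,5,4,6,7]) (Split 1 6 (Use 0 [0,1,2,3,6,4,5,7]) (Split 2 6 (Use 0
    [0,2,1,3,6,4,5,7]) (Split 1 7 (Use 0 [0,1,2,3,7,4,5,6]) (Split 2 7 (Use 0 [0,2,1,3,7,4,5,6])
    (Use 1 [0,1,2,3,4,5,6,7]))))))))"]) code_simp

section \<open>Centre of degree 7: stars, paths and single edges in the neighbourhood\<close>

lemma r184: "refutable (cfg [[], [A], [A,U], [A,A,N], [A,A,N,N], [A,U,N,N,N], [A,U,A,U,U,U],
    [A,U,U,U,U,U,U]] [])"
  by (rule refutableI[OF dep[OF r99 dep[OF r101 dep[OF r65 no_deps]]], where t = "Split 3 7 (Use 0
    [0,7,1,2,3,4,5,6]) (Split 3 6 (Use 1 [0,1,6,3,2,4,5,7]) (Use 2 [0,2,4,5,6,7,3,1]))"])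
    code_simp

lemma r185: "refutable (cfg [[], [A], [A,A], [A,A,N], [A,A,N,N], [A,A,U,U,U], [A,U,U,U,U,U],
    [A,U,U,U,U,U,U]] [])"
  by (rule refutableI[OF dep[OF r183 dep[OF r184 dep[OF r100 dep[OF r65 no_deps]]]], where t =
    "Split 2 5 (Use 0 [0,1,2,5,3,4,6,7]) (Split 3 5 (Use 0 [0,1,3,5,2,4,6,7]) (Split 4 5 (Use 0
    [0,1,4,5,2,3,6,7]) (Split 2 6 (Use 1 [0,1,2,3,4,5,6,7]) (Split 3 6 (Use 1 [0,1,3,2,4,5,6,7])
    (Split 2 5 (Use 0 [0,1,2,5,3,4,6,7]) (Split 2 7 (Split 3 5 (Use 0 [0,1,3,5,2,4,6,7]) (Use 2
    [0,7,1,2,3,4,6,5])) (Use 3 [0,3,4,6,5,7,2,1])))))))"]) code_simp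

lemma r186: "refutable (cfg [[], [A], [A,A], [A,U,U], [A,U,U,U], [A,N,A,U,U], [A,N,N,U,U,N],
    [A,N,U,U,U,N,N]] [])"
  by (rule refutableI[OF dep[OF r184 dep[OF r65 no_deps]], where t = "Split 3 6 (Use 0
    [0,2,6,1,5,7,3,4]) (Use 1 [0,1,2,3,5,7,6,4])"]) code_simp

lemma r187: "refutable (cfg [[], [A], [A,A], [A,U,U], [A,U,U,U], [A,N,A,A,U], [A,N,U,U,U,N],
    [A,N,U,U,U,N,U]] [])"
  by (rule refutableI[OF dep[OF r176 dep[OF r184 dep[OF r186 no_deps]]], where t = "Split 6 7 (Use
    0 [0,2,6,7,5,1,3,4]) (Split 2 6 (Use 1 [0,2,5,1,6,7,3,4]) (Use 2 [0,1,2,3,4,5,6,7]))"])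
    code_simp

lemma r188: "refutable (cfg [[], [A], [A,A], [A,U,N], [A,U,N,N], [A,N,A,A,A], [A,N,U,U,U,U],
    [A,N,U,U,U,U,U]] [])"
  by (rule refutableI[OF dep[OF r185 dep[OF r187 no_deps]], where t = "Split 5 6 (Use 0
    [0,5,2,3,4,6,1,7]) (Split 5 7 (Use 0 [0,5,2,3,4,7,1,6]) (Use 1 [0,1,2,3,4,5,6,7]))"])
    code_simp

lemma r189: "refutable (cfg [[], [A], [A,A], [A,U,N], [A,A,N,N], [A,N,A,A,N], [A,N,A,U,U,U],
    [A,N,U,U,U,U,U]] [])"
  by (rule refutableI[OF dep[OF r183 dep[OF r188 dep[OF r187 dep[OF r82 no_deps]]]], where t =
    "Split 5 6 (Use 0 [0,2,5,6,1,3,4,7]) (Split 3 6 (Split 4 6 (Use 1 [0,1,2,3,4,6,5,7]) (Use 2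
    [0,6,2,3,7,5,1,4])) (Use 3 [0,1,2,3,5,4,6,7]))"]) code_simp

lemma r190: "refutable (cfg [[], [A], [A,A], [A,A,N], [A,A,N,N], [A,N,A,A,U], [A,N,U,U,U,U],
    [A,N,U,U,U,U,U]] [])"
  by (rule refutableI[OF dep[OF r188 dep[OF r189 dep[OF r187 no_deps]]], where t = "Split 4 5 (Use
    0 [0,1,2,3,4,5,6,7]) (Split 2 6 (Use 1 [0,1,2,3,4,5,6,7]) (Split 3 6 (Use 1 [0,1,3,2,4,5,6,7])
    (Use 2 [0,3,1,5,7,2,4,6])))"]) code_simp

lemma r191: "refutable (cfg [[], [A], [A,A], [A,A,N], [A,A,N,N], [A,N,A,U,U], [A,N,U,U,U,U],
    [A,N,U,U,U,U,U]] [])"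
  by (rule refutableI[OF dep[OF r190 dep[OF r176 no_deps]], where t = "Split 3 5 (Use 0
    [0,1,2,3,4,5,6,7]) (Split 4 5 (Use 0 [0,1,2,4,3,5,6,7]) (Use 1 [0,1,2,5,4,3,6,7]))"])
    code_simp

lemma r192: "refutable (cfg [[], [A], [A,A], [A,A,N], [A,A,U,U], [A,U,U,U,U], [A,U,U,U,U,U],
    [A,U,U,U,U,U,U]] [])"
  by (rule refutableI[OF dep[OF r183 dep[OF r185 dep[OF r191 dep[OF r186 no_deps]]]], where t =
    "Split 2 4 (Use 0 [0,1,2,4,3,5,6,7]) (Split 3 4 (Use 0 [0,1,3,4,2,5,6,7]) (Split 1 5 (Use 1
    [0,1,2,3,4,5,6,7]) (Split 1 6 (Use 1 [0,1,2,3,4,6,5,7]) (Split 1 7 (Use 1 [0,1,2,3,4,7,5,6])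
    (Split 2 5 (Use 2 [0,1,2,3,4,5,6,7]) (Split 3 5 (Use 2 [0,1,3,2,4,5,6,7]) (Split 4 5 (Use 2
    [0,1,4,2,3,5,6,7]) (Use 3 [0,2,1,6,7,3,5,4]))))))))"]) code_simp

lemma r193: "refutable (cfg [[], [A], [A,A], [A,A,U], [A,N,A,N], [A,N,N,A,U], [A,N,N,U,U,U],
    [A,N,U,U,U,U,U]] [])"
  by (rule refutableI[OF dep[OF r192 dep[OF r72 dep[OF r176 no_deps]]], where t = "Split 5 6
    (Split 3 7 (Use 0 [0,3,1,5,7,2,4,6]) (Use 1 [0,5,1,3,6,2,4,7])) (Use 2 [0,3,1,2,6,5,4,7])"])
    code_simp

lemma r194: "refutable (cfg [[], [A], [A,A], [A,A,N], [A,N,A,U], [A,N,U,U,U], [A,N,U,U,U,U],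
    [A,N,U,U,U,U,U]] [])"
  by (rule refutableI[OF dep[OF r192 dep[OF r193 dep[OF r176 no_deps]]], where t = "Split 2 5 (Use
    0 [0,2,1,4,5,3,6,7]) (Split 2 6 (Use 0 [0,2,1,4,6,3,5,7]) (Split 2 7 (Use 0 [0,2,1,4,7,3,5,6])
    (Split 3 4 (Reduce [(0,1,2), (0,3,4)] [(1,2), (0,3), (0,4), (3,4)] []) (Split 3 5 (Use 1
    [0,1,2,3,4,5,6,7]) (Split 4 5 (Use 1 [0,2,1,4,3,5,6,7]) (Use 2 [0,1,2,4,5,3,6,7]))))))"])
    code_simp

lemma r195: "refutable (cfg [[], [A], [A,A], [A,A,U], [A,U,U,U], [A,U,U,U,U], [A,U,U,U,U,U],
    [A,U,U,U,U,U,U]] [])"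
  by (rule refutableI[OF dep[OF r183 dep[OF r192 dep[OF r194 dep[OF r176 dep[OF r186 no_deps]]]]],
    where t = "Split 2 3 (Use 0 [0,1,2,3,4,5,6,7]) (Split 1 4 (Use 1 [0,1,2,3,4,5,6,7]) (Split 1 5
    (Use 1 [0,1,2,3,5,4,6,7]) (Split 1 6 (Use 1 [0,1,2,3,6,4,5,7]) (Split 1 7 (Use 1
    [0,1,2,3,7,4,5,6]) (Split 2 4 (Use 2 [0,1,2,3,4,5,6,7]) (Split 3 4 (Use 2 [0,1,3,2,4,5,6,7])
    (Split 2 5 (Use 2 [0,1,2,3,5,4,6,7]) (Split 3 5 (Use 2 [0,1,3,2,5,4,6,7]) (Split 4 5 (Use 3
    [0,1,4,5,3,2,6,7]) (Use 4 [0,2,1,6,7,3,4,5]))))))))))"]) code_simp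

text \<open>A further neighbourhood edge at 1 or 2 to one of 3,...,6 gives the path of
  \<open>r195\<close>. Otherwise only 7 can be attached to 12, and it plays the cover vertex of
  \<open>r182\<close>.\<close>

lemma r196: "refutable (cfg [[], [A], [A,A], [A,U,U], [A,U,U,U], [A,U,U,U,U], [A,U,U,U,U,U],
    [A,U,U,U,U,U,U]] [])"
  by (rule refutableI[OF dep[OF r195 dep[OF r182 no_deps]], where t = "Split 1 3 (Use 0
    [0,1,2,3,4,5,6,7]) (Split 2 3 (Use 0 [0,2,1,3,4,5,6,7]) (Split 1 4 (Use 0 [0,1,2,4,3,5,6,7])
    (Split 2 4 (Use 0 [0,2,1,4,3,5,6,7]) (Split 1 5 (Use 0 [0,1,2,5,3,4,6,7]) (Split 2 5 (Use 0
    [0,2,1,5,3,4,6,7]) (Split 1 6 (Use 0 [0,1,2,6,3,4,5,7]) (Split 2 6 (Use 0 [0,2,1,6,3,4,5,7])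
    (Use 1 [0,1,2,7,3,4,5,6]))))))))"]) code_simp

text \<open>The neighbours of 0 are named one by one, and each degree is settled. Degree 1 leaves 01
  in no triangle; in degree 2 the deletion of 12 suffices; degrees 3 to 6 are \<open>r0\<close>,
  \<open>r3\<close>, \<open>r22\<close> and \<open>r54\<close>. In degree 7, either 1 has a
  neighbour among 2,...,6 and \<open>r196\<close> applies, or it can see only 7, which is
  \<open>r65\<close>.\<close>

lemma refutable_edge: "refutable (cfg [[], [A]] [])"
  by (rule refutableI[OF dep[OF r0 dep[OF r3 dep[OF r22 dep[OF r54 dep[OF r196 dep[OF r65
    no_deps]]]]]], where t = "Extend 0 (Bare 0 1) (Extend 0 (Split 1 2 (Reduce [(0,1,2)] [(1,2)]
    []) (Bare 0 1)) (Extend 0 (Split 1 2 (Use 0 [0,1,2,3]) (Split 1 3 (Use 0 [0,1,3,2]) (Bare 0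
    1))) (Extend 0 (Split 1 2 (Use 1 [0,1,2,3,4]) (Split 1 3 (Use 1 [0,1,3,2,4]) (Split 1 4 (Use 1
    [0,1,4,2,3]) (Bare 0 1)))) (Extend 0 (Use 2 [0,1,2,3,4,5]) (Extend 0 (Use 3 [0,1,2,3,4,5,6])
    (Split 1 2 (Use 4 [0,1,2,3,4,5,6,7]) (Split 1 3 (Use 4 [0,1,3,2,4,5,6,7]) (Split 1 4 (Use 4
    [0,1,4,2,3,5,6,7]) (Split 1 5 (Use 4 [0,1,5,2,3,4,6,7]) (Split 1 6 (Use 4 [0,1,6,2,3,4,5,7])
    (Use 5 [0,2,3,4,5,6,1,7])))))))))))"]) code_simp

lemma irreducible_empty:
  assumes E: "irreducible E"
  shows "E = {}"
proof (rule ccontr)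
  assume "E \<noteq> {}"
  then obtain e where "e \<in> E" by blast
  moreover from this E have "card e = 2" by (simp add: irreducible_def sparse_def)
  ultimately obtain a b where ab: "a \<noteq> b" "{a, b} \<in> E" by (auto simp: card_2_iff)
  have no: "{a} \<notin> E" "{b} \<notin> E" using E sparse_no_loop[of E] by (auto simp: irreducible_def)
  have edge: "cfg [[], [A]] [] = ([[N, A], [A, N]], [False, False])" by code_simp
  have "holds E (\<lambda>i. if i = 0 then a else b) (cfg [[], [A]] [])"
    unfolding edge holds_def using ab no
    by (auto simp: inj_on_def less_Suc_eq insert_commute numeral_2_eq_2)
  with refutable_sound[OF E refutable_edge] show False by blast
qed

theorem theorem1p4:
  fixes V :: "'a set" and E :: "'a set set"
  assumes "simple_graph V E"
    and "regular_graph 7 V E"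
  shows "triangle_transversal_number E \<le> 2 * triangle_packing_number E"
proof -
  \<comment> \<open>\<open>sparse\<close> bounds the degree of every element of the type, hence the
    case of points outside \<open>V\<close>.\<close>
  have "vertex_degree E v \<le> 7" for v
  proof (cases "v \<in> V")
    case True
    with assms(2) show ?thesis by (simp add: regular_graph_def)
  next
    case False
    with assms(1) have "{e \<in> E. v \<in> e} = {}" by (auto simp: simple_graph_def)
    then have "card {e \<in> E. v \<in> e} = 0" by (simp only: card.empty)
    then show ?thesis by (simp add: vertex_degree_def)
  qed
  with assms(1) simple_graph_finite_edges[OF assms(1)] have "sparse E"
    by (simp add: sparse_def simple_graph_def)
  then have "tuza E" using irreducible_empty tuza_minimal_counterexample by blast
  then show ?thesis by (simp add: tuza_def)
qed

end
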